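(* Let $n_1,n_2\in\mathbb{N}$ and let $(X_1,\dots,X_{n_1+n_2})$ be a mean zero Gaussian vector with positive definite covariance matrix $\Sigma$. For $a>0$ put $Q=Q(a)=I-(I+a\Sigma)^{-1}$ and write $$Q=\begin{pmatrix}Q_{11}&Q_{12}\\ Q_{21}&Q_{22}\end{pmatrix},$$ where $Q_{11}$ is $n_1\times n_1$, $Q_{22}$ is $n_2\times n_2$, and $Q_{12}=Q_{21}^t$ is $n_1\times n_2$. For $k,m\in\mathbb{N}_0$ let $$T_{k,m}(a)=\sum \operatorname{trace}\, Q_{11}^{k_1}Q_{12}Q_{22}^{m_1}Q_{21}Q_{11}^{k_2}\cdots Q_{11}^{k_d}Q_{12}Q_{22}^{m_d}Q_{21}Q_{11}^{k_{d+1}}+\sum \operatorname{trace}\, Q_{22}^{m_1}Q_{21}Q_{11}^{k_1}Q_{12}Q_{22}^{m_2}\cdots Q_{22}^{m_d}Q_{21}Q_{11}^{k_d}Q_{12}Q_{22}^{m_{d+1}},$$ where the first sum is over all $d\in\mathbb{N}_0$ and all $k_1,\dots,k_{d+1},m_1,\dots,m_d\in\mathbb{N}_0$ with $$k_1+\dots+k_{d+1}+d=k\quad\text{and}\quad m_1+\dots+m_d+d=m,$$ and the second sum is over all $d\in\mathbb{N}_0$ and all $m_1,\dots,m_{d+1},k_1,\dots,k_d\in\mathbb{N}_0$ with $$m_1+\dots+m_{d+1}+d=m\quad\text{and}\quad k_1+\dots+k_d+d=k.$$ Then the random vector $$(X_1^2+\dots+X_{n_1}^2,\; X_{n_1+1}^2+\dots+X_{n_1+n_2}^2)$$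 is infinitely divisible if and only if, for all sufficiently large $a>0$, $T_{k,m}(a)\ge 0$ for all $k,m\in\mathbb{N}_0$.
   Context: $\mathbb{N}_0=\{0,1,2,\dots\}$. The zeroth power of a square matrix is the identity matrix. For $d=0$ the products in the first and second sums are interpreted as $Q_{11}^{k_1}$ and $Q_{22}^{m_1}$, respectively (these occur only when $m=0$, respectively $k=0$). A random vector is infinitely divisible if for every $n\in\mathbb{N}$ it has the same distribution as a sum of $n$ independent identically distributed random vectors. "For all sufficiently large $a>0$" means that there is $a_0>0$ such that the assertion holds for all $a\ge a_0$. *)

theory Defs
  imports "HOL-Probability.Probability"
begin

(* Degenerate (constant) linear combinations count as Gaussian. *)
definition gaussian_vector :: "'w measure \<Rightarrow> ('w \<Rightarrow> 'a::euclidean_space) \<Rightarrow> bool" where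
  "gaussian_vector M X \<longleftrightarrow>
     X \<in> borel_measurable M \<and>
     (\<forall>u. (\<exists>c. AE w in M. u \<bullet> X w = c) \<or>
          (\<exists>\<mu> \<sigma>. \<sigma> > 0 \<and> distributed M lborel (\<lambda>w. u \<bullet> X w) (normal_density \<mu> \<sigma>)))"

definition covariance_matrix :: "'w measure \<Rightarrow> ('w \<Rightarrow> real ^ 'n) \<Rightarrow> real ^ 'n ^ 'n" where
  "covariance_matrix M X =
     (\<chi> i j. (LINT w|M. (X w $ i - (LINT v|M. X v $ i)) * (X w $ j - (LINT v|M. X v $ j))))"

(* The sample space of the n i.i.d. vectors may be any probability space; its type can be fixed
   to nat => 'a because only the joint distribution of Z matters and the n-fold product measure
   on {..<n} already lives on that type. *)
definition infinitely_divisible :: "'w measure \<Rightarrow> ('w \<Rightarrow> 'a::euclidean_space) \<Rightarrow> bool" where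
  "infinitely_divisible M Y \<longleftrightarrow>
     Y \<in> borel_measurable M \<and>
     (\<forall>n\<ge>1. \<exists>(N :: (nat \<Rightarrow> 'a) measure) (Z :: nat \<Rightarrow> (nat \<Rightarrow> 'a) \<Rightarrow> 'a).
        prob_space N \<and>
        prob_space.indep_vars N (\<lambda>_. borel) Z {..<n} \<and>
        (\<forall>i<n. \<forall>j<n. distr N borel (Z i) = distr N borel (Z j)) \<and>
        distr N borel (\<lambda>w. \<Sum>i<n. Z i w) = distr M borel Y)"

definition positive_definite :: "real ^ 'n ^ 'n \<Rightarrow> bool" where
  "positive_definite A \<longleftrightarrow> transpose A = A \<and> (\<forall>x. x \<noteq> 0 \<longrightarrow> x \<bullet> (A *v x) > 0)"

(* The overloaded power operator on vectors of vectors is componentwise, hence this definition. *)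
primrec mat_pow :: "real ^ 'n ^ 'n \<Rightarrow> nat \<Rightarrow> real ^ 'n ^ 'n" where
  "mat_pow A 0 = mat 1"
| "mat_pow A (Suc k) = A ** mat_pow A k"

(* Coordinates 1..n1 are indexed by Inl and n1+1..n1+n2 by Inr. *)
definition block11 :: "real ^ ('p::finite + 'q::finite) ^ ('p + 'q) \<Rightarrow> real ^ 'p ^ 'p" where
  "block11 A = (\<chi> i j. A $ Inl i $ Inl j)"

definition block12 :: "real ^ ('p::finite + 'q::finite) ^ ('p + 'q) \<Rightarrow> real ^ 'q ^ 'p" where
  "block12 A = (\<chi> i j. A $ Inl i $ Inr j)"

definition block21 :: "real ^ ('p::finite + 'q::finite) ^ ('p + 'q) \<Rightarrow> real ^ 'p ^ 'q" where
  "block21 A = (\<chi> i j. A $ Inr i $ Inl j)"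

definition block22 :: "real ^ ('p::finite + 'q::finite) ^ ('p + 'q) \<Rightarrow> real ^ 'q ^ 'q" where
  "block22 A = (\<chi> i j. A $ Inr i $ Inr j)"

definition resolvent_Q :: "real ^ 'n ^ 'n \<Rightarrow> real \<Rightarrow> real ^ 'n ^ 'n" where
  "resolvent_Q S a = mat 1 - matrix_inv (mat 1 + a *\<^sub>R S)"

(* For ks = [k_1, ..., k_(d+1)] and ms = [m_1, ..., m_d] this is the product
     P^k_1 U R^m_1 V P^k_2 ... P^k_d U R^m_d V P^k_(d+1);
   zip discards the last entry of ks. *)
definition alt_prod ::
  "real ^ 'p ^ 'p \<Rightarrow> real ^ 'q ^ 'p \<Rightarrow> real ^ 'q ^ 'q \<Rightarrow> real ^ 'p ^ 'q
     \<Rightarrow> nat list \<Rightarrow> nat list \<Rightarrow> real ^ 'p ^ 'p" where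
  "alt_prod P U R V ks ms =
     foldr (\<lambda>(k, m) W. mat_pow P k ** U ** mat_pow R m ** V ** W) (zip ks ms)
       (mat_pow P (last ks))"

definition exponents :: "nat \<Rightarrow> nat \<Rightarrow> (nat list \<times> nat list) set" where
  "exponents k m =
     {(ks, ms). \<exists>d. length ks = d + 1 \<and> length ms = d \<and> sum_list ks + d = k \<and> sum_list ms + d = m}"

lemma finite_exponents: "finite (exponents k m)"
proof (rule finite_subset)
  let ?L = "{xs. set xs \<subseteq> {..k + m} \<and> length xs \<le> k + 1}"
  show "exponents k m \<subseteq> ?L \<times> ?L"
  proof (rule subrelI, unfold mem_Times_iff fst_conv snd_conv)
    fix ks ms assume "(ks, ms) \<in> exponents k m"
    then obtain d where d: "length ks = d + 1" "length ms = d" "sum_list ks + d = k"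
      "sum_list ms + d = m" by (auto simp: exponents_def)
    have "x \<le> k + m" if "x \<in> set ks \<union> set ms" for x
      using that d member_le_sum_list[of x ks] member_le_sum_list[of x ms] by auto
    with d show "ks \<in> ?L \<and> ms \<in> ?L" by auto
  qed
  show "finite (?L \<times> ?L)"
    by (intro finite_cartesian_product finite_lists_length_le) auto
qed

definition trace_sum :: "real ^ ('p::finite + 'q::finite) ^ ('p + 'q) \<Rightarrow> nat \<Rightarrow> nat \<Rightarrow> real" where
  "trace_sum Q k m =
     (\<Sum>(ks, ms)\<in>exponents k m.
        trace (alt_prod (block11 Q) (block12 Q) (block22 Q) (block21 Q) ks ms)) +
     (\<Sum>(ms, ks)\<in>exponents m k.
        trace (alt_prod (block22 Q) (block21 Q) (block11 Q) (block12 Q) ms ks))"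

end

theory Submission
  imports Defs
begin

text \<open>
Let \<open>Y\<close> be the pair of squared norms of the two blocks of \<open>X\<close> and
\<open>\<psi>(x, y) = E exp (- (x Y\<^sub>1 + y Y\<^sub>2) / 2)\<close>. Fix \<open>a > 0\<close>, substitute \<open>x = a (1 - s)\<close>, \<open>y = a (1 - t)\<close>, and let
\<open>S\<close> be the diagonal matrix with entries \<open>s\<close> on the first block and \<open>t\<close> on the second. A Gaussian
computation (\<open>gaussian_laplace\<close>) gives \<open>\<psi> = sqrt (det \<Sigma>\<inverse> / det (\<Sigma>\<inverse> + a (I - S)))\<close>, and since
\<open>Q = a (\<Sigma>\<inverse> + a I)\<inverse>\<close>, the matrix in the denominator is \<open>(I - S Q) (\<Sigma>\<inverse> + a I)\<close>. Therefore
\<open>ln \<psi>(a (1 - s), a (1 - t)) - ln \<psi>(a, a) = - ln det (I - S Q) / 2\<close>, which is half the sum over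
\<open>n \<ge> 1\<close> of \<open>trace ((S Q) ^ n) / n\<close> because \<open>S Q\<close> is a strict contraction (\<open>ln_det_series\<close>).
Multiplying out \<open>(S Q) ^ n\<close> in blocks, each product is a closed walk on the two blocks, and the walks with
\<open>k\<close> steps from the first block and \<open>m\<close> steps from the second are collected in \<open>T\<^bsub>k,m\<^esub>\<close>
(\<open>trace_sum_generating\<close>). So \<open>T\<^bsub>k,m\<^esub> / (2 (k + m))\<close> is the coefficient of \<open>s ^ k t ^ m\<close> in
\<open>ln \<psi>(a (1 - s), a (1 - t))\<close>. What remains is a statement about nonnegative random pairs: such a pair
is infinitely divisible iff these coefficients are nonnegative for all large \<open>a\<close>.

If \<open>Y\<close> is the sum of \<open>N\<close> independent copies of \<open>Z\<close>, then \<open>Z \<ge> 0\<close>, and expanding the exponential in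
\<open>E exp (- (a (1 - s) Z\<^sub>1 + a (1 - t) Z\<^sub>2) / 2)\<close> shows that \<open>\<psi>\<close> to the power \<open>1 / N\<close> has nonnegative
coefficients in \<open>s\<close> and \<open>t\<close>. Since \<open>N (u powr (1 / N) - 1)\<close> tends to \<open>ln u\<close>, the coefficients of \<open>ln \<psi>\<close>
are limits of nonnegative numbers (\<open>infinitely_divisible_coefficients_nonneg\<close>).

Conversely, if the coefficients are nonnegative, then for each \<open>n\<close> the function
\<open>\<psi>(a (1 - s), a (1 - t))\<close> to the power \<open>1 / n\<close> is the generating function of a compound Poisson pair
\<open>(K, L)\<close> of natural numbers (\<open>compound_poisson_generating_function\<close>). At \<open>s = exp (- 2 i / a)\<close> and
\<open>t = exp (- 2 j / a)\<close> this says that \<open>(exp (- 2 K / a), exp (- 2 L / a))\<close> is a random point of the unit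
square with \<open>(i, j)\<close>-th moment close to \<open>\<psi>(2 i, 2 j)\<close> to the power \<open>1 / n\<close> when \<open>a\<close> is large. By
compactness there is a law on the square having exactly these moments (\<open>unit_square_compactness\<close>), and
the coordinatewise product of \<open>n\<close> independent points with this law has the moments, hence the law, of
\<open>(exp (- Y\<^sub>1), exp (- Y\<^sub>2))\<close> (\<open>hausdorff_moment_uniqueness\<close>). Taking logarithms writes \<open>Y\<close> in law as a
sum of \<open>n\<close> independent identically distributed pairs.
\<close>

section \<open>Positive definite matrices and one-dimensional Gaussian integrals\<close>

definition diag_mat :: "('n::finite \<Rightarrow> real) \<Rightarrow> real ^ 'n ^ 'n" where
  "diag_mat d = (\<chi> i j. if i = j then d i else 0)"

lemma diag_mat_mult_vec: "diag_mat d *v x = (\<chi> i. d i * x $ i)"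
  by (simp add: vec_eq_iff matrix_vector_mult_def diag_mat_def if_distrib[of "\<lambda>z. z * _"] cong: if_cong)

lemma inner_diag_mat: "x \<bullet> (diag_mat d *v x) = (\<Sum>i\<in>UNIV. d i * (x $ i)\<^sup>2)"
  by (simp add: diag_mat_mult_vec inner_vec_def power2_eq_square mult.left_commute)

lemma transpose_diag_mat: "transpose (diag_mat d) = diag_mat d"
  by (auto simp: transpose_def diag_mat_def vec_eq_iff)

lemma positive_definite_det_nz:
  assumes "positive_definite A" shows "det A \<noteq> 0"
proof -
  have "x = 0" if "A *v x = 0" for x
    using assms that unfolding positive_definite_def by force
  then have "invertible A"
    by (simp add: invertible_left_inverse matrix_left_invertible_ker)
  then show ?thesis by (simp add: invertible_det_nz)
qed

lemma matrix_inv_mult: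
  fixes A :: "real ^ 'n ^ 'n"
  assumes "det A \<noteq> 0"
  shows "A ** matrix_inv A = mat 1" "matrix_inv A ** A = mat 1"
proof -
  have "\<exists>B. A ** B = mat 1 \<and> B ** A = mat 1"
    using assms by (simp add: invertible_det_nz[symmetric] invertible_def)
  then have "A ** matrix_inv A = mat 1 \<and> matrix_inv A ** A = mat 1"
    unfolding matrix_inv_def by (rule someI_ex)
  then show "A ** matrix_inv A = mat 1" "matrix_inv A ** A = mat 1" by auto
qed

lemma matrix_inv_mult_vec:
  fixes A :: "real ^ 'n ^ 'n"
  assumes "det A \<noteq> 0"
  shows "A *v (matrix_inv A *v x) = x" "matrix_inv A *v (A *v x) = x"
  by (simp_all add: matrix_vector_mul_assoc matrix_inv_mult[OF assms])

lemma positive_definite_symmetric: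
  assumes "positive_definite A" shows "x \<bullet> (A *v y) = (A *v x) \<bullet> y"
proof -
  have "(A *v x) \<bullet> y = (x v* transpose A) \<bullet> y" by simp
  also have "\<dots> = x \<bullet> (transpose A *v y)" by (rule dot_lmul_matrix)
  also have "transpose A = A" using assms by (simp add: positive_definite_def)
  finally show ?thesis by simp
qed

lemma positive_definite_matrix_inv:
  assumes A: "positive_definite A" shows "positive_definite (matrix_inv A)"
proof -
  note nz = positive_definite_det_nz[OF A]
  have "transpose (matrix_inv A) = matrix_inv A"
  proof -
    let ?B = "matrix_inv A"
    have "transpose ?B ** A = transpose (A ** ?B)"
      using A by (simp add: positive_definite_def matrix_transpose_mul)
    then have "transpose ?B ** A = mat 1" by (simp add: matrix_inv_mult[OF nz])
    then have "(transpose ?B ** A) ** ?B = ?B" by simp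
    then show ?thesis by (simp add: matrix_mul_assoc[symmetric] matrix_inv_mult[OF nz])
  qed
  moreover have "x \<bullet> (matrix_inv A *v x) > 0" if "x \<noteq> 0" for x
  proof -
    define y where "y = matrix_inv A *v x"
    have x: "x = A *v y" by (simp add: y_def matrix_inv_mult_vec[OF nz])
    then have "y \<noteq> 0" using that by auto
    then have "y \<bullet> (A *v y) > 0" using A by (simp add: positive_definite_def)
    then show ?thesis by (simp add: x[symmetric] y_def[symmetric] inner_commute)
  qed
  ultimately show ?thesis by (simp add: positive_definite_def)
qed

lemma positive_definite_add_diag:
  assumes A: "positive_definite A" and d: "\<And>i. 0 \<le> d i"
  shows "positive_definite (A + diag_mat d)"
proof -
  have "transpose (A + diag_mat d) = A + diag_mat d"
    using A transpose_diag_mat[of d]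
    by (simp add: positive_definite_def transpose_def vec_eq_iff)
  moreover have "x \<bullet> ((A + diag_mat d) *v x) > 0" if "x \<noteq> 0" for x
  proof -
    have "x \<bullet> (diag_mat d *v x) \<ge> 0"
      unfolding inner_diag_mat by (intro sum_nonneg) (simp add: d)
    with A that show ?thesis
      by (simp add: positive_definite_def matrix_vector_mult_add_rdistrib inner_add_right add_pos_nonneg)
  qed
  ultimately show ?thesis by (simp add: positive_definite_def)
qed

lemma inner_axis_mult: "axis e 1 \<bullet> x = (x $ e :: real)"
  by (simp add: inner_axis')

text \<open>The update changes a single row, in which the determinant is linear; by Cramer's rule the coefficient
of \<open>t\<close> is \<open>det A\<close> times a diagonal entry of the inverse.\<close>
lemma det_rank_one_update:
  fixes A :: "real ^ 'n ^ 'n"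
  assumes A: "positive_definite A"
  shows "det (A + diag_mat (\<lambda>i. if i = e then t else 0)) =
           det A * (1 + t * (axis e 1 \<bullet> (matrix_inv A *v axis e 1)))"
proof -
  note nz = positive_definite_det_nz[OF A]
  have sym: "A $ i $ j = A $ j $ i" for i j
    using A by (simp add: positive_definite_def transpose_def vec_eq_iff)
  let ?B = "\<chi> i. if i = e then axis e 1 else A $ i"
  have "A + diag_mat (\<lambda>i. if i = e then t else 0) =
          (\<chi> i. if i = e then A $ i + t *s axis e 1 else A $ i)"
    by (auto simp: vec_eq_iff diag_mat_def axis_def)
  then have "det (A + diag_mat (\<lambda>i. if i = e then t else 0)) =
      det (\<chi> i. if i = e then A $ i else A $ i) + det (\<chi> i. if i = e then t *s axis e 1 else A $ i)"
    by (simp only: det_row_add)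
  also have "det (\<chi> i. if i = e then t *s axis e 1 else A $ i) = t * det ?B"
    by (rule det_row_mul)
  also have "(\<chi> i. if i = e then A $ i else A $ i) = A"
    by (simp add: vec_eq_iff)
  also have "det ?B = det A * (matrix_inv A *v axis e 1) $ e"
  proof -
    have "A *v (matrix_inv A *v axis e 1) = axis e 1"
      by (rule matrix_inv_mult_vec[OF nz])
    then have "matrix_inv A *v axis e 1 =
        (\<chi> k. det (\<chi> i j. if j = k then axis e 1 $ i else A $ i $ j) / det A)"
      by (simp only: cramer[OF nz])
    then have "(matrix_inv A *v axis e 1) $ e = det (\<chi> i j. if j = e then axis e 1 $ i else A $ i $ j) / det A"
      by simp
    also have "(\<chi> i j. if j = e then axis e 1 $ i else A $ i $ j) = transpose ?B"
      by (auto simp: vec_eq_iff transpose_def sym)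
    finally show ?thesis using nz by simp
  qed
  finally show ?thesis by (simp add: inner_axis_mult algebra_simps)
qed

text \<open>The Sherman--Morrison formula for the quadratic form of the inverse, obtained by solving
\<open>A v + t v\<^sub>e e = u\<close> first for \<open>v\<^sub>e\<close> and then for \<open>v\<close>.\<close>
lemma inverse_form_rank_one_update:
  fixes A :: "real ^ 'n ^ 'n"
  assumes A: "positive_definite A" and t: "0 \<le> t"
  defines "B \<equiv> matrix_inv A"
  shows "u \<bullet> (matrix_inv (A + diag_mat (\<lambda>i. if i = e then t else 0)) *v u) =
           u \<bullet> (B *v u) - t * (u \<bullet> (B *v axis e 1))\<^sup>2 / (1 + t * (axis e 1 \<bullet> (B *v axis e 1)))"
proof -
  let ?A = "A + diag_mat (\<lambda>i. if i = e then t else 0)"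
  have A': "positive_definite ?A"
    by (rule positive_definite_add_diag) (use A t in auto)
  note nz = positive_definite_det_nz[OF A] and nz' = positive_definite_det_nz[OF A']
  have B: "positive_definite B" unfolding B_def by (rule positive_definite_matrix_inv[OF A])
  define v where "v = matrix_inv ?A *v u"
  have De: "diag_mat (\<lambda>i. if i = e then t else 0) *v v = (t * v $ e) *s axis e 1"
    by (auto simp: diag_mat_mult_vec vec_eq_iff axis_def)
  have "?A *v v = u" by (simp add: v_def matrix_inv_mult_vec[OF nz'])
  then have "A *v v = u - (t * v $ e) *s axis e 1"
    by (simp add: matrix_vector_mult_add_rdistrib De eq_diff_eq)
  then have "B *v (A *v v) = B *v (u - (t * v $ e) *s axis e 1)" by simp
  then have v: "v = B *v u - (t * v $ e) *s (B *v axis e 1)"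
    by (simp add: B_def matrix_inv_mult_vec[OF nz] matrix_vector_mult_diff_distrib
        vector_scalar_commute)
  let ?s = "axis e 1 \<bullet> (B *v axis e 1)" let ?b = "u \<bullet> (B *v axis e 1)"
  have b: "axis e 1 \<bullet> (B *v u) = ?b"
    using positive_definite_symmetric[OF B, of u "axis e 1"] by (simp add: inner_commute)
  have s: "1 + t * ?s > 0"
    using B t by (intro add_pos_nonneg mult_nonneg_nonneg)
      (auto simp: positive_definite_def less_imp_le axis_eq_0_iff)
  have "axis e 1 \<bullet> v = axis e 1 \<bullet> (B *v u) - (t * v $ e) * ?s"
    by (subst v) (simp add: inner_diff_right scalar_mult_eq_scaleR)
  then have "v $ e * (1 + t * ?s) = ?b"
    using b by (simp add: inner_axis_mult algebra_simps)
  then have ve: "v $ e = ?b / (1 + t * ?s)" using s by (simp add: field_simps)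
  have "u \<bullet> v = u \<bullet> (B *v u) - (t * v $ e) * ?b"
    by (subst v) (simp add: inner_diff_right scalar_mult_eq_scaleR)
  then show ?thesis unfolding v_def[symmetric] ve by (simp add: power2_eq_square)
qed

text \<open>Completing the square makes the integrand a multiple of the normal density with mean
\<open>- \<beta> / (1 + \<gamma>)\<close> and variance \<open>1 / (1 + \<gamma>)\<close>.\<close>
lemma std_normal_integral_exp_quadratic:
  assumes "0 \<le> \<gamma>"
  shows "(LINT g|std_normal_distribution. exp (- (\<beta> * g) - \<gamma> * g\<^sup>2 / 2)) =
           exp (\<beta>\<^sup>2 / (2 * (1 + \<gamma>))) / sqrt (1 + \<gamma>)"
proof -
  let ?c = "exp (\<beta>\<^sup>2 / (2 * (1 + \<gamma>))) / sqrt (1 + \<gamma>)"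
  let ?m = "- \<beta> / (1 + \<gamma>)" and ?s = "1 / sqrt (1 + \<gamma>)"
  have pos: "1 + \<gamma> > 0" using assms by simp
  have "std_normal_density g * exp (- (\<beta> * g) - \<gamma> * g\<^sup>2 / 2) = ?c * normal_density ?m ?s g" for g
  proof -
    have "exp (- g\<^sup>2 / 2) * exp (- (\<beta> * g) - \<gamma> * g\<^sup>2 / 2) =
          exp (\<beta>\<^sup>2 / (2 * (1 + \<gamma>))) * exp (- (g - ?m)\<^sup>2 / (2 * ?s\<^sup>2))"
      unfolding exp_add[symmetric] using pos
      by (intro arg_cong[of _ _ exp]) (simp add: power_divide divide_simps power2_eq_square, algebra)
    moreover have "1 / sqrt (2 * pi * ?s\<^sup>2) = sqrt (1 + \<gamma>) / sqrt (2 * pi)"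
      using pos by (simp add: power_divide real_sqrt_divide real_sqrt_mult)
    ultimately show ?thesis
      using pos unfolding normal_density_def by (simp add: field_simps)
  qed
  moreover have "?s > 0" using pos by simp
  ultimately show ?thesis
    by (subst integral_density)
      (auto simp: normal_density_nonneg)
qed

text \<open>The characteristic function of the standard normal law, read as a representation of \<open>exp (- d x\<^sup>2 / 2)\<close>
as an average of exponentials of imaginary linear forms. Through it, expectations of exponentials of
\<open>- X\<^sub>e\<^sup>2\<close> reduce to the characteristic function of \<open>X\<close>.\<close>
lemma std_normal_exp_neg_square:
  assumes "0 \<le> d"
  shows "(CLINT g|std_normal_distribution. iexp (sqrt d * x * g)) = complex_of_real (exp (- d * x\<^sup>2 / 2))"
proof -
  have "(sqrt d * x)\<^sup>2 = d * x\<^sup>2" using assms by (simp add: power_mult_distrib)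
  then show ?thesis
    using fun_cong[OF char_std_normal_distribution, of "sqrt d * x"]
    unfolding char_def by (simp only: mult_minus_left)
qed

section \<open>The Laplace transform of the squares of a Gaussian vector\<close>

context prob_space begin

text \<open>In the degenerate case the functional is almost surely constant; mean zero makes the constant \<open>0\<close>, so
the formula for the characteristic function persists with variance \<open>0\<close>.\<close>
lemma gaussian_linear_functional:
  fixes X :: "'a \<Rightarrow> real ^ 'n"
  assumes X: "gaussian_vector M X"
  shows "integrable M (\<lambda>w. u \<bullet> X w)" "integrable M (\<lambda>w. (u \<bullet> X w)\<^sup>2)"
    and "(LINT w|M. u \<bullet> X w) = 0 \<Longrightarrow>
       (CLINT w|M. iexp (u \<bullet> X w)) = complex_of_real (exp (- (LINT w|M. (u \<bullet> X w)\<^sup>2) / 2))"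
proof -
  have [measurable]: "X \<in> borel_measurable M" using X by (simp add: gaussian_vector_def)
  have "integrable M (\<lambda>w. u \<bullet> X w) \<and> integrable M (\<lambda>w. (u \<bullet> X w)\<^sup>2) \<and>
    ((LINT w|M. u \<bullet> X w) = 0 \<longrightarrow>
       (CLINT w|M. iexp (u \<bullet> X w)) = complex_of_real (exp (- (LINT w|M. (u \<bullet> X w)\<^sup>2) / 2)))"
  proof (cases "\<exists>c. AE w in M. u \<bullet> X w = c")
    case True
    then obtain c where c: "AE w in M. u \<bullet> X w = c" by auto
    have "integrable M (\<lambda>w. u \<bullet> X w)"
      by (rule integrable_const_bound[where B="\<bar>c\<bar>"]) (use c in auto)
    moreover have "integrable M (\<lambda>w. (u \<bullet> X w)\<^sup>2)"
      by (rule integrable_const_bound[where B="c\<^sup>2"]) (use c in auto)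
    moreover have "(LINT w|M. u \<bullet> X w) = (LINT w|M. c)"
      by (rule integral_cong_AE) (use c in auto)
    moreover have "(LINT w|M. (u \<bullet> X w)\<^sup>2) = (LINT w|M. c\<^sup>2)"
      by (rule integral_cong_AE) (use c in auto)
    moreover have "(CLINT w|M. iexp (u \<bullet> X w)) = (CLINT w|M. iexp c)"
      by (rule integral_cong_AE) (use c in auto)
    ultimately show ?thesis by (auto simp: prob_space)
  next
    case False
    then obtain \<mu> \<sigma> where \<sigma>: "\<sigma> > 0" and D: "distributed M lborel (\<lambda>w. u \<bullet> X w) (normal_density \<mu> \<sigma>)"
      using X unfolding gaussian_vector_def by blast
    have i1: "integrable M (\<lambda>w. u \<bullet> X w)"
      using distributed_integrable[OF D, of "\<lambda>x. x"] integrable_normal_moment_nz_1[OF \<sigma>, of \<mu>] by simp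
    have i2: "integrable M (\<lambda>w. (u \<bullet> X w - \<mu>)\<^sup>2)"
      using distributed_integrable[OF D, of "\<lambda>x. (x - \<mu>)\<^sup>2"] integrable_normal_moment[OF \<sigma>, of \<mu> 2] by simp
    have i2': "integrable M (\<lambda>w. (u \<bullet> X w)\<^sup>2)"
    proof -
      have "integrable M (\<lambda>w. (u \<bullet> X w - \<mu>)\<^sup>2 + 2 * \<mu> * (u \<bullet> X w) - \<mu>\<^sup>2)"
        using i1 i2 by auto
      then show ?thesis by (simp add: power2_eq_square algebra_simps)
    qed
    have cf: "(CLINT w|M. iexp (u \<bullet> X w)) = complex_of_real (exp (- (LINT w|M. (u \<bullet> X w)\<^sup>2) / 2))"
      if z: "(LINT w|M. u \<bullet> X w) = 0"
    proof -
      have \<mu>: "\<mu> = 0" using normal_distributed_expectation[OF \<sigma> D] z by simp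
      have var: "(LINT w|M. (u \<bullet> X w)\<^sup>2) = \<sigma>\<^sup>2"
        using normal_distributed_variance[OF \<sigma> D] z by simp
      have "distributed M lborel (\<lambda>w. 0 + (1 / \<sigma>) * (u \<bullet> X w)) (normal_density (0 + (1/\<sigma>) * 0) (\<bar>1/\<sigma>\<bar> * \<sigma>))"
        by (rule normal_density_affine) (use D \<sigma> \<mu> in auto)
      then have D1: "distributed M lborel (\<lambda>w. (u \<bullet> X w) / \<sigma>) std_normal_density"
        using \<sigma> by simp
      have "std_normal_distribution = distr M lborel (\<lambda>w. (u \<bullet> X w) / \<sigma>)"
        using distributed_distr_eq_density[OF D1] by simp
      then have "char std_normal_distribution \<sigma> = (CLINT w|M. iexp (\<sigma> * ((u \<bullet> X w) / \<sigma>)))"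
        unfolding char_def by (simp only:) (rule integral_distr, measurable)
      then show ?thesis using \<sigma> by (simp add: char_std_normal_distribution var)
    qed
    show ?thesis using i1 i2' cf by blast
  qed
  then show "integrable M (\<lambda>w. u \<bullet> X w)" "integrable M (\<lambda>w. (u \<bullet> X w)\<^sup>2)"
    and "(LINT w|M. u \<bullet> X w) = 0 \<Longrightarrow>
       (CLINT w|M. iexp (u \<bullet> X w)) = complex_of_real (exp (- (LINT w|M. (u \<bullet> X w)\<^sup>2) / 2))"
    by auto
qed

lemma gaussian_characteristic_function:
  fixes X :: "'a \<Rightarrow> real ^ 'n"
  assumes X: "gaussian_vector M X" and mean: "\<And>i. (LINT w|M. X w $ i) = 0"
    and cov: "covariance_matrix M X = \<Sigma>"
  shows "(CLINT w|M. iexp (u \<bullet> X w)) = complex_of_real (exp (- (u \<bullet> (\<Sigma> *v u)) / 2))"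
proof -
  have i1: "integrable M (\<lambda>w. X w $ i)" for i
    using gaussian_linear_functional(1)[OF X, of "axis i 1"] by (simp add: inner_axis_mult)
  have i2: "integrable M (\<lambda>w. X w $ i * X w $ j)" for i j
  proof -
    have "integrable M (\<lambda>w. (((axis i 1 + axis j 1) \<bullet> X w)\<^sup>2 - (axis i 1 \<bullet> X w)\<^sup>2 - (axis j 1 \<bullet> X w)\<^sup>2) / 2)"
      by (intro Bochner_Integration.integrable_diff integrable_divide_zero
          gaussian_linear_functional(2)[OF X])
    then show ?thesis
      by (simp add: inner_axis_mult inner_add_left power2_eq_square algebra_simps)
  qed
  have "(LINT w|M. u \<bullet> X w) = 0"
    unfolding inner_vec_def by (simp add: Bochner_Integration.integral_sum i1 mean)
  moreover have "(LINT w|M. (u \<bullet> X w)\<^sup>2) = u \<bullet> (\<Sigma> *v u)"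
  proof -
    have "(u \<bullet> X w)\<^sup>2 = (\<Sum>i\<in>UNIV. \<Sum>j\<in>UNIV. u $ i * u $ j * (X w $ i * X w $ j))" for w
      by (simp add: power2_eq_square inner_vec_def sum_product mult_ac)
    then have "(LINT w|M. (u \<bullet> X w)\<^sup>2) =
        (\<Sum>i\<in>UNIV. \<Sum>j\<in>UNIV. u $ i * u $ j * (LINT w|M. X w $ i * X w $ j))"
      by (simp add: Bochner_Integration.integral_sum i2)
    also have "\<dots> = u \<bullet> (\<Sigma> *v u)"
      unfolding cov[symmetric] covariance_matrix_def
      by (simp add: mean inner_vec_def matrix_vector_mult_def sum_distrib_left mult_ac)
    finally show ?thesis .
  qed
  ultimately show ?thesis using gaussian_linear_functional(3)[OF X, of u] by simp
qed

text \<open>Under the weight \<open>W\<close> the vector behaves like a Gaussian vector with precision matrix \<open>A\<close>. One more factor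
\<open>exp (- t X\<^sub>e\<^sup>2 / 2)\<close> is written as an average over a standard normal \<open>g\<close> of shifts of \<open>u\<close> by
\<open>sqrt t g e\<close>; Fubini leaves a one-dimensional Gaussian integral in \<open>g\<close>, whose value is the rank-one
update of \<open>A\<close>.\<close>
lemma gaussian_damping_step:
  fixes X :: "'a \<Rightarrow> real ^ 'n" and W :: "'a \<Rightarrow> real" and e :: 'n
  assumes [measurable]: "X \<in> borel_measurable M" "W \<in> borel_measurable M"
    and W: "\<And>w. 0 \<le> W w" "\<And>w. W w \<le> 1"
    and A: "positive_definite A" and t: "0 \<le> t"
    and cf: "\<And>u. (CLINT w|M. W w *\<^sub>R iexp (u \<bullet> X w)) =
       complex_of_real (c * exp (- (u \<bullet> (matrix_inv A *v u)) / 2))"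
  defines "A' \<equiv> A + diag_mat (\<lambda>i. if i = e then t else 0)"
  shows "(CLINT w|M. (W w * exp (- t * (X w $ e)\<^sup>2 / 2)) *\<^sub>R iexp (u \<bullet> X w)) =
       complex_of_real (c * sqrt (det A / det A') * exp (- (u \<bullet> (matrix_inv A' *v u)) / 2))"
proof -
  let ?N = "std_normal_distribution"
  interpret N: real_distribution ?N by (rule real_dist_normal_dist)
  interpret P: pair_prob_space M ?N ..
  define B where "B = matrix_inv A"
  have B: "positive_definite B" unfolding B_def by (rule positive_definite_matrix_inv[OF A])
  define a where "a = (axis e 1 :: real ^ 'n)"
  define b where "b = u \<bullet> (B *v a)"
  define s where "s = a \<bullet> (B *v a)"
  have s: "s > 0" using B unfolding s_def a_def by (simp add: positive_definite_def axis_eq_0_iff)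
  have ts: "1 + t * s > 0" using s t by (intro add_pos_nonneg) auto
  let ?f = "\<lambda>w g. W w *\<^sub>R iexp ((u + (sqrt t * g) *\<^sub>R a) \<bullet> X w)"
  have eq1: "(W w * exp (- t * (X w $ e)\<^sup>2 / 2)) *\<^sub>R iexp (u \<bullet> X w) = (CLINT g|?N. ?f w g)" for w
  proof -
    have "?f w g = (W w *\<^sub>R iexp (u \<bullet> X w)) * iexp (sqrt t * (X w $ e) * g)" for g
    proof -
      have "(u + (sqrt t * g) *\<^sub>R a) \<bullet> X w = u \<bullet> X w + sqrt t * (X w $ e) * g"
        by (simp add: a_def inner_add_left inner_axis_mult)
      then show ?thesis
        by (simp add: exp_add distrib_left)
    qed
    then have "(CLINT g|?N. ?f w g) = (W w *\<^sub>R iexp (u \<bullet> X w)) * (CLINT g|?N. iexp (sqrt t * (X w $ e) * g))"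
      by (simp only: integral_mult_right_zero)
    also have "\<dots> = (W w * exp (- t * (X w $ e)\<^sup>2 / 2)) *\<^sub>R iexp (u \<bullet> X w)"
      unfolding std_normal_exp_neg_square[OF t] by (simp add: scaleR_conv_of_real)
    finally show ?thesis by simp
  qed
  have int: "integrable (M \<Otimes>\<^sub>M ?N) (\<lambda>(w, g). ?f w g)"
    by (rule P.integrable_const_bound[where B=1]) (auto simp: W abs_of_nonneg)
  have "(CLINT w|M. (W w * exp (- t * (X w $ e)\<^sup>2 / 2)) *\<^sub>R iexp (u \<bullet> X w)) =
      (CLINT w|M. CLINT g|?N. ?f w g)"
    by (simp only: eq1)
  also have "\<dots> = (CLINT g|?N. CLINT w|M. ?f w g)"
    using P.Fubini_integral[OF int] by simp
  also have "\<dots> = (CLINT g|?N. complex_of_real ((c * exp (- (u \<bullet> (B *v u)) / 2)) *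
        exp (- ((sqrt t * b) * g) - (t * s) * g\<^sup>2 / 2)))"
  proof (rule Bochner_Integration.integral_cong[OF refl])
    fix g
    let ?v = "u + (sqrt t * g) *\<^sub>R a"
    have "a \<bullet> (B *v u) = b"
      using positive_definite_symmetric[OF B, of u a] by (simp add: b_def inner_commute)
    then have "?v \<bullet> (B *v ?v) = u \<bullet> (B *v u) + 2 * (sqrt t * g) * b + (sqrt t * g)\<^sup>2 * s"
      by (simp add: b_def s_def matrix_vector_right_distrib matrix_vector_mult_scaleR inner_add_left
          inner_add_right power2_eq_square algebra_simps)
    also have "(sqrt t * g)\<^sup>2 = t * g\<^sup>2" using t by (simp add: power_mult_distrib)
    finally have "- (?v \<bullet> (B *v ?v)) / 2 =
       - (u \<bullet> (B *v u)) / 2 + (- ((sqrt t * b) * g) - (t * s) * g\<^sup>2 / 2)"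
      by (simp add: field_simps)
    then have "exp (- (?v \<bullet> (B *v ?v)) / 2) =
       exp (- (u \<bullet> (B *v u)) / 2) * exp (- ((sqrt t * b) * g) - (t * s) * g\<^sup>2 / 2)"
      by (simp only: exp_add)
    with cf[of ?v] show "(CLINT w|M. ?f w g) = complex_of_real ((c * exp (- (u \<bullet> (B *v u)) / 2)) *
        exp (- ((sqrt t * b) * g) - (t * s) * g\<^sup>2 / 2))"
      by (simp only: B_def mult.assoc)
  qed
  also have "\<dots> = complex_of_real ((c * exp (- (u \<bullet> (B *v u)) / 2)) *
       (exp ((sqrt t * b)\<^sup>2 / (2 * (1 + t * s))) / sqrt (1 + t * s)))"
    unfolding integral_complex_of_real integral_mult_right_zero
    by (subst std_normal_integral_exp_quadratic) (use t s in auto)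
  also have "(c * exp (- (u \<bullet> (B *v u)) / 2)) *
       (exp ((sqrt t * b)\<^sup>2 / (2 * (1 + t * s))) / sqrt (1 + t * s)) =
       c * (1 / sqrt (1 + t * s)) * exp (- (u \<bullet> (matrix_inv A' *v u)) / 2)"
  proof -
    have "u \<bullet> (matrix_inv A' *v u) = u \<bullet> (B *v u) - t * b\<^sup>2 / (1 + t * s)"
      unfolding A'_def inverse_form_rank_one_update[OF A t] B_def b_def s_def a_def ..
    then have "- (u \<bullet> (matrix_inv A' *v u)) / 2 =
        - (u \<bullet> (B *v u)) / 2 + (sqrt t * b)\<^sup>2 / (2 * (1 + t * s))"
      using t ts by (simp add: power_mult_distrib field_simps)
    then have "exp (- (u \<bullet> (matrix_inv A' *v u)) / 2) =
        exp (- (u \<bullet> (B *v u)) / 2) * exp ((sqrt t * b)\<^sup>2 / (2 * (1 + t * s)))"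
      by (simp only: exp_add)
    then show ?thesis by simp
  qed
  also have "1 / sqrt (1 + t * s) = sqrt (det A / det A')"
    using positive_definite_det_nz[OF A]
    unfolding A'_def det_rank_one_update[OF A] s_def B_def a_def by (simp add: real_sqrt_divide)
  finally show ?thesis .
qed

text \<open>Induction over the set of damped coordinates: each step adds one diagonal entry to the precision matrix
\<open>\<Sigma>\<inverse>\<close>, and the determinant quotients telescope. Carrying the characteristic function along, and not
only its value at \<open>u = 0\<close>, is what makes the induction work.\<close>
lemma gaussian_laplace:
  fixes X :: "'a \<Rightarrow> real ^ 'n"
  assumes X: "gaussian_vector M X" and mean: "\<And>i. (LINT w|M. X w $ i) = 0"
    and cov: "covariance_matrix M X = \<Sigma>" and pd: "positive_definite \<Sigma>"
    and d: "\<And>i. 0 \<le> d i"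
  shows "(LINT w|M. exp (- (\<Sum>i\<in>UNIV. d i * (X w $ i)\<^sup>2) / 2)) =
           sqrt (det (matrix_inv \<Sigma>) / det (matrix_inv \<Sigma> + diag_mat d))"
proof -
  have [measurable]: "X \<in> borel_measurable M" using X by (simp add: gaussian_vector_def)
  define R where "R = matrix_inv \<Sigma>"
  have R: "positive_definite R" unfolding R_def by (rule positive_definite_matrix_inv[OF pd])
  have RR: "matrix_inv R = \<Sigma>"
  proof -
    note n1 = positive_definite_det_nz[OF pd] and n2 = positive_definite_det_nz[OF R]
    have "\<Sigma> = \<Sigma> ** (R ** matrix_inv R)" using matrix_inv_mult(1)[OF n2] by simp
    also have "\<dots> = matrix_inv R"
      using matrix_inv_mult(1)[OF n1] by (simp add: matrix_mul_assoc R_def)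
    finally show ?thesis by simp
  qed
  define D where "D J = diag_mat (\<lambda>i. if i \<in> J then d i else 0)" for J
  have pdD: "positive_definite (R + D J)" for J
    unfolding D_def by (rule positive_definite_add_diag[OF R]) (simp add: d)
  have D0: "R + D {} = R" by (simp add: D_def diag_mat_def vec_eq_iff)
  have "\<forall>u. (CLINT w|M. exp (- (\<Sum>i\<in>J. d i * (X w $ i)\<^sup>2) / 2) *\<^sub>R iexp (u \<bullet> X w)) =
     complex_of_real (sqrt (det R / det (R + D J)) * exp (- (u \<bullet> (matrix_inv (R + D J) *v u)) / 2))"
    if "finite J" for J
    using that
  proof induction
    case empty
    show ?case
      using gaussian_characteristic_function[OF X mean cov] positive_definite_det_nz[OF R]
      by (simp add: D0 RR)
  next
    case (insert e J)
    let ?W = "\<lambda>w. exp (- (\<Sum>i\<in>J. d i * (X w $ i)\<^sup>2) / 2)"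
    have [measurable]: "(\<lambda>w. X w $ i) \<in> borel_measurable M" for i
    proof -
      have "(\<lambda>w. axis i 1 \<bullet> X w) \<in> borel_measurable M" by measurable
      then show ?thesis by (simp add: inner_axis_mult)
    qed
    have W_meas: "?W \<in> borel_measurable M" by measurable
    have DJ: "R + D (insert e J) = (R + D J) + diag_mat (\<lambda>i. if i = e then d e else 0)"
      using insert by (auto simp: D_def diag_mat_def vec_eq_iff)
    have W: "?W w * exp (- d e * (X w $ e)\<^sup>2 / 2) = exp (- (\<Sum>i\<in>insert e J. d i * (X w $ i)\<^sup>2) / 2)" for w
      using insert by (simp add: exp_add[symmetric] add_divide_distrib diff_divide_distrib)
    have "(CLINT w|M. (?W w * exp (- d e * (X w $ e)\<^sup>2 / 2)) *\<^sub>R iexp (u \<bullet> X w)) =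
       complex_of_real (sqrt (det R / det (R + D J)) *
          sqrt (det (R + D J) / det (R + D J + diag_mat (\<lambda>i. if i = e then d e else 0))) *
          exp (- (u \<bullet> (matrix_inv (R + D J + diag_mat (\<lambda>i. if i = e then d e else 0)) *v u)) / 2))" for u
      by (rule gaussian_damping_step)
        (use insert pdD d W_meas in \<open>auto intro!: sum_nonneg\<close>)
    moreover have "sqrt (det R / det (R + D J)) * sqrt (det (R + D J) / det (R + D (insert e J)))
        = sqrt (det R / det (R + D (insert e J)))"
      using positive_definite_det_nz[OF pdD, of J] by (simp add: real_sqrt_mult[symmetric])
    ultimately show ?case unfolding W DJ[symmetric] by simp
  qed
  from this[of UNIV, THEN spec, of 0]
  have "(CLINT w|M. complex_of_real (exp (- (\<Sum>i\<in>UNIV. d i * (X w $ i)\<^sup>2) / 2))) =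
     complex_of_real (sqrt (det R / det (R + diag_mat d)))"
    by (simp add: D_def scaleR_conv_of_real)
  then show ?thesis by (simp add: R_def)
qed

end

section \<open>The logarithm of a determinant as a series of traces\<close>

text \<open>Jacobi's formula at the identity matrix, from the Leibniz expansion: the identity permutation
contributes the trace, every other permutation a term of second order.\<close>
lemma DERIV_det_at_identity:
  fixes B :: "real ^ 'n ^ 'n"
  shows "((\<lambda>h. det (mat 1 + h *\<^sub>R B)) has_real_derivative trace B) (at 0)"
proof -
  let ?P = "{p :: 'n \<Rightarrow> 'n. p permutes UNIV}"
  let ?I = "mat 1 :: real ^ 'n ^ 'n"
  have "((\<lambda>h. \<Sum>p\<in>?P. of_int (sign p) * (\<Prod>i\<in>UNIV. (?I + h *\<^sub>R B) $ i $ p i))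
      has_real_derivative
      (\<Sum>p\<in>?P. of_int (sign p) * (\<Sum>i\<in>UNIV. B $ i $ p i * (\<Prod>j\<in>UNIV - {i}. (?I + 0 *\<^sub>R B) $ j $ p j)))) (at 0)"
  proof (intro DERIV_sum DERIV_cmult has_field_derivative_prod)
    fix p i
    show "((\<lambda>h. (?I + h *\<^sub>R B) $ i $ p i) has_real_derivative B $ i $ p i) (at 0)"
      by (auto intro!: derivative_eq_intros)
  qed
  also have "(\<Sum>p\<in>?P. of_int (sign p) * (\<Sum>i\<in>UNIV. B $ i $ p i * (\<Prod>j\<in>UNIV - {i}. (?I + 0 *\<^sub>R B) $ j $ p j)))
     = (\<Sum>p\<in>?P. if p = id then trace B else 0)"
  proof (rule sum.cong[OF refl])
    fix p assume "p \<in> ?P"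
    then have p: "inj p" by (simp add: permutes_inj)
    show "of_int (sign p) * (\<Sum>i\<in>UNIV. B $ i $ p i * (\<Prod>j\<in>UNIV - {i}. (?I + 0 *\<^sub>R B) $ j $ p j)) =
       (if p = id then trace B else 0)"
    proof (cases "p = id")
      case True
      then show ?thesis by (simp add: trace_def mat_def)
    next
      case False
      then obtain k where k: "p k \<noteq> k" by (auto simp: fun_eq_iff)
      \<comment> \<open>A permutation other than the identity moves two points.\<close>
      then have pk: "p (p k) \<noteq> p k" using p by (auto dest: injD)
      have "(\<Prod>j\<in>UNIV - {i}. (?I + 0 *\<^sub>R B) $ j $ p j) = 0" for i
      proof -
        obtain j where "j \<noteq> i" "p j \<noteq> j" using k pk by metis
        then show ?thesis by (intro prod_zero bexI[of _ j]) (auto simp: mat_def)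
      qed
      then have "(\<Sum>i\<in>UNIV. B $ i $ p i * (\<Prod>j\<in>UNIV - {i}. (?I + 0 *\<^sub>R B) $ j $ p j)) = 0"
        by (simp only: mult_zero_right sum.neutral_const)
      then show ?thesis using False by (simp only: mult_zero_right if_False)
    qed
  qed
  also have "\<dots> = trace B" by (simp add: permutes_id finite_permutations)
  finally show ?thesis by (simp add: det_def)
qed

lemma matrix_mult_scaleR:
  fixes A :: "real ^ 'n ^ 'm" and B :: "real ^ 'k ^ 'n"
  shows "(c *\<^sub>R A) ** B = c *\<^sub>R (A ** B)" "A ** (c *\<^sub>R B) = c *\<^sub>R (A ** B)"
  by (simp_all add: matrix_matrix_mult_def vec_eq_iff sum_distrib_left mult_ac)

lemma matrix_mult_distrib_right:
  fixes A A' :: "real ^ 'n ^ 'm" and B :: "real ^ 'k ^ 'n"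
  shows "(A + A') ** B = A ** B + A' ** B" "(A - A') ** B = A ** B - A' ** B"
  by (simp_all add: matrix_matrix_mult_def vec_eq_iff sum.distrib sum_subtractf algebra_simps)

lemma trace_mult_swap: "trace (A ** (B :: real ^ 'm ^ 'n)) = trace (B ** (A :: real ^ 'n ^ 'm))"
  unfolding trace_def matrix_matrix_mult_def
  by (simp add: mult.commute) (rule sum.swap)

text \<open>The identity \<open>ln det = trace ln\<close>, proved without eigenvalues. By Jacobi's formula the derivative of
\<open>ln det (I - r C)\<close> in \<open>r\<close> is \<open>- trace (C (I - r C)\<inverse>)\<close>; the Neumann series for the inverse shows that this
is minus the derivative of the sum of \<open>trace (C ^ n) r ^ n / n\<close>. In this sum the term for \<open>n = 0\<close> is a
division by zero, hence \<open>0\<close>.\<close>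
lemma ln_det_series:
  fixes C :: "real ^ 'n ^ 'n"
  assumes q: "0 \<le> q" "q < 1" and C: "\<And>n i j. \<bar>mat_pow C n $ i $ j\<bar> \<le> q ^ n"
  shows "0 < det (mat 1 - C)"
    and "summable (\<lambda>n. \<bar>trace (mat_pow C n) / real n\<bar>)"
    and "(\<lambda>n. trace (mat_pow C n) / real n) sums (- ln (det (mat 1 - C)))"
proof -
  \<comment> \<open>Working on \<open>\<bar>r\<bar> \<le> K\<close> with \<open>K > 1\<close> makes \<open>r = 1\<close> an interior point, where power series may be
    differentiated termwise.\<close>
  define K where "K = 2 / (1 + q)"
  have K: "1 < K" "q * K < 1" using q by (auto simp: K_def field_simps)
  have qK: "0 \<le> q * K" using q K by simp
  define N where "N r = (\<chi> i j. \<Sum>n. r ^ n * mat_pow C n $ i $ j)" for r :: real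
  have smN: "summable (\<lambda>n. r ^ n * mat_pow C n $ i $ j)" if r: "\<bar>r\<bar> \<le> K" for r i j
  proof (rule summable_comparison_test')
    show "summable (\<lambda>n. (q * K) ^ n)" using K qK by (intro summable_geometric) auto
    show "norm (r ^ n * mat_pow C n $ i $ j) \<le> (q * K) ^ n" for n
      using mult_mono[OF power_mono[OF r] C[of n i j]] q K
      by (simp add: abs_mult power_abs power_mult_distrib mult.commute)
  qed
  have N: "(mat 1 - r *\<^sub>R C) ** N r = mat 1" if r: "\<bar>r\<bar> \<le> K" for r
  proof -
    have "(\<Sum>k\<in>UNIV. (mat 1 - r *\<^sub>R C) $ i $ k * N r $ k $ j) = mat 1 $ i $ j" for i j
    proof -
      have "(\<Sum>k\<in>UNIV. (mat 1 - r *\<^sub>R C) $ i $ k * N r $ k $ j) =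
          (\<Sum>k\<in>UNIV. (if i = k then N r $ k $ j else 0)) - r * (\<Sum>k\<in>UNIV. C $ i $ k * N r $ k $ j)"
        by (simp add: left_diff_distrib sum_subtractf sum_distrib_left mat_def mult.assoc
            if_distrib[of "\<lambda>z. z * _"] cong: if_cong)
      also have "\<dots> = N r $ i $ j - r * (\<Sum>k\<in>UNIV. C $ i $ k * N r $ k $ j)" by simp
      also have "r * (\<Sum>k\<in>UNIV. C $ i $ k * N r $ k $ j) =
          (\<Sum>k\<in>UNIV. \<Sum>n. r * C $ i $ k * (r ^ n * mat_pow C n $ k $ j))"
      proof -
        have "r * C $ i $ k * N r $ k $ j = (\<Sum>n. r * C $ i $ k * (r ^ n * mat_pow C n $ k $ j))" for k
          by (simp add: N_def suminf_mult[OF smN[OF r]])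
        then show ?thesis by (simp only: sum_distrib_left mult.assoc)
      qed
      also have "\<dots> = (\<Sum>n. \<Sum>k\<in>UNIV. r * C $ i $ k * (r ^ n * mat_pow C n $ k $ j))"
        by (rule suminf_sum[symmetric]) (intro summable_mult smN r)
      also have "\<dots> = (\<Sum>n. r ^ Suc n * mat_pow C (Suc n) $ i $ j)"
        by (simp add: matrix_matrix_mult_def sum_distrib_left mult_ac)
      also have "\<dots> = N r $ i $ j - mat 1 $ i $ j"
        using suminf_split_head[OF smN[OF r, of i j]] by (simp add: N_def)
      finally show ?thesis by simp
    qed
    then show ?thesis by (simp add: vec_eq_iff matrix_matrix_mult_def)
  qed
  have nz: "det (mat 1 - r *\<^sub>R C) \<noteq> 0" if "\<bar>r\<bar> \<le> K" for r
  proof -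
    have "det (mat 1 - r *\<^sub>R C) * det (N r) = det (mat 1 :: real ^ 'n ^ 'n)"
      unfolding det_mul[symmetric] N[OF that] ..
    then show ?thesis by auto
  qed
  have der: "((\<lambda>r. det (mat 1 - r *\<^sub>R C)) has_real_derivative
      - det (mat 1 - r *\<^sub>R C) * trace (C ** N r)) (at r)" if r: "\<bar>r\<bar> \<le> K" for r
  proof -
    have eq: "det (mat 1 - x *\<^sub>R C) = det (mat 1 - r *\<^sub>R C) * det (mat 1 + (r - x) *\<^sub>R (N r ** C))" for x
    proof -
      have "(mat 1 - r *\<^sub>R C) ** (mat 1 + (r - x) *\<^sub>R (N r ** C)) =
         (mat 1 - r *\<^sub>R C) + (r - x) *\<^sub>R (((mat 1 - r *\<^sub>R C) ** N r) ** C)"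
        by (simp add: matrix_add_ldistrib matrix_mult_scaleR matrix_mul_assoc)
      also have "\<dots> = mat 1 - x *\<^sub>R C" unfolding N[OF r] by (simp add: algebra_simps)
      finally show ?thesis unfolding det_mul[symmetric] by simp
    qed
    have "((\<lambda>x. det (mat 1 + (r - x) *\<^sub>R (N r ** C))) has_real_derivative trace (N r ** C) * (-1)) (at r)"
      by (rule DERIV_chain2[where f="\<lambda>h. det (mat 1 + h *\<^sub>R (N r ** C))" and g="\<lambda>x. r - x"])
        (use DERIV_det_at_identity[of "N r ** C"] in \<open>auto intro!: derivative_eq_intros\<close>)
    from DERIV_cmult[OF this, of "det (mat 1 - r *\<^sub>R C)"] show ?thesis
      unfolding eq[symmetric] by (simp add: trace_mult_swap[of "N r"])
  qed
  define c where "c n = trace (mat_pow C n) / real n" for n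
  have tr: "\<bar>trace (mat_pow C n)\<bar> \<le> real CARD('n) * q ^ n" for n
    unfolding trace_def using sum_mono[of UNIV "\<lambda>i. \<bar>mat_pow C n $ i $ i\<bar>" "\<lambda>_. q ^ n"] C
    by (intro order_trans[OF sum_abs]) auto
  have c_le: "\<bar>c n\<bar> \<le> real CARD('n) * q ^ n" for n
  proof (cases n)
    case (Suc m)
    have "\<bar>c n\<bar> \<le> \<bar>trace (mat_pow C n)\<bar> / 1"
      unfolding c_def abs_divide using Suc by (intro divide_left_mono) auto
    with tr[of n] show ?thesis by simp
  qed (simp add: c_def)
  have smK: "summable (\<lambda>n. c n * K ^ n)"
  proof (rule summable_comparison_test')
    show "summable (\<lambda>n. real CARD('n) * (q * K) ^ n)"
      using K qK by (intro summable_mult summable_geometric) auto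
    show "norm (c n * K ^ n) \<le> real CARD('n) * (q * K) ^ n" for n
      using mult_right_mono[OF c_le[of n], of "K ^ n"] K
      by (simp add: abs_mult power_mult_distrib mult.assoc)
  qed
  define S where "S r = (\<Sum>n. c n * r ^ n)" for r
  have derS: "(S has_real_derivative trace (C ** N r)) (at r)" if r: "\<bar>r\<bar> < K" for r
  proof -
    have "(S has_real_derivative (\<Sum>n. diffs c n * r ^ n)) (at r)"
      unfolding S_def by (rule termdiffs_strong[OF smK]) (use r K in auto)
    also have "(\<Sum>n. diffs c n * r ^ n) = (\<Sum>n. \<Sum>i\<in>UNIV. \<Sum>k\<in>UNIV. C $ i $ k * (r ^ n * mat_pow C n $ k $ i))"
    proof -
      have "diffs c = (\<lambda>n. trace (mat_pow C (Suc n)))"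
        by (simp add: diffs_def c_def fun_eq_iff del: of_nat_Suc mat_pow.simps)
      then show ?thesis
        by (simp add: trace_def matrix_matrix_mult_def sum_distrib_left mult_ac)
    qed
    also have "\<dots> = (\<Sum>i\<in>UNIV. \<Sum>k\<in>UNIV. \<Sum>n. C $ i $ k * (r ^ n * mat_pow C n $ k $ i))"
      using r by (subst suminf_sum, intro summable_sum summable_mult smN, simp)
        (intro sum.cong refl suminf_sum summable_mult smN, simp)
    also have "\<dots> = trace (C ** N r)"
      using r by (simp add: trace_def matrix_matrix_mult_def N_def suminf_mult smN)
    finally show ?thesis .
  qed
  have pos: "0 < det (mat 1 - r *\<^sub>R C)" if r: "0 \<le> r" "r \<le> 1" for r
  proof (rule ccontr)
    assume "\<not> ?thesis"
    then have "det (mat 1 - r *\<^sub>R C) \<le> 0" by simp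
    moreover have "isCont (\<lambda>r. det (mat 1 - r *\<^sub>R C)) x" if "0 \<le> x" "x \<le> r" for x
      using der[of x] that r K by (intro DERIV_isCont) auto
    ultimately obtain x where "0 \<le> x" "x \<le> r" "det (mat 1 - x *\<^sub>R C) = 0"
      using IVT2[of "\<lambda>r. det (mat 1 - r *\<^sub>R C)" r 0 0] r by auto
    with nz[of x] r K show False by auto
  qed
  show "0 < det (mat 1 - C)" using pos[of 1] by simp
  let ?g = "\<lambda>r. ln (det (mat 1 - r *\<^sub>R C)) + S r"
  have dg: "(?g has_real_derivative 0) (at r)" if r: "0 \<le> r" "r \<le> 1" for r
  proof -
    have "(?g has_real_derivative
        inverse (det (mat 1 - r *\<^sub>R C)) * (- det (mat 1 - r *\<^sub>R C) * trace (C ** N r)) + trace (C ** N r)) (at r)"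
      by (intro DERIV_add DERIV_chain2[OF DERIV_ln] der derS pos) (use r K in auto)
    moreover have "inverse d * (- d * T) + T = 0" if "0 < d" for d T :: real
      using that by (simp add: field_simps)
    note this[OF pos[OF r]]
    ultimately show ?thesis by (simp only:)
  qed
  have "?g 1 = ?g 0"
  proof (rule DERIV_isconst_end[where f="?g" and a=0 and b=1])
    show "continuous_on {0..1} ?g"
      by (intro continuous_at_imp_continuous_on ballI DERIV_isCont[OF dg]) auto
    show "(?g has_real_derivative 0) (at x)" if "0 < x" "x < 1" for x
      using that by (intro dg) auto
  qed simp
  moreover have "S 0 = 0" unfolding S_def using powser_zero[of c] by (simp add: c_def)
  moreover have "det (mat 1 - 0 *\<^sub>R C) = 1" by simp
  ultimately have "ln (det (mat 1 - C)) + S 1 = 0" by (simp only: scaleR_one ln_one add_0)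
  then have S1: "S 1 = - ln (det (mat 1 - C))" by linarith
  show sm: "summable (\<lambda>n. \<bar>trace (mat_pow C n) / real n\<bar>)"
  proof (rule summable_comparison_test')
    show "summable (\<lambda>n. real CARD('n) * q ^ n)"
      using q by (intro summable_mult summable_geometric) auto
    show "norm \<bar>trace (mat_pow C n) / real n\<bar> \<le> real CARD('n) * q ^ n" for n
      using c_le[of n] unfolding c_def by simp
  qed
  then have "summable c" unfolding c_def by (rule summable_rabs_cancel)
  then show "(\<lambda>n. trace (mat_pow C n) / real n) sums (- ln (det (mat 1 - C)))"
    using S1 summable_sums[of c] by (simp add: S_def c_def[abs_def])
qed

lemma mat_pow_contraction:
  fixes C :: "real ^ 'n ^ 'n"
  assumes q: "0 \<le> q" and C: "\<And>x. norm (C *v x) \<le> q * norm x"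
  shows "\<bar>mat_pow C n $ i $ j\<bar> \<le> q ^ n"
proof -
  have "norm (mat_pow C n *v x) \<le> q ^ n * norm x" for x
  proof (induction n arbitrary: x)
    case (Suc n)
    have "norm (mat_pow C (Suc n) *v x) = norm (C *v (mat_pow C n *v x))"
      by (simp add: matrix_vector_mul_assoc)
    also have "\<dots> \<le> q * (q ^ n * norm x)"
      by (rule order_trans[OF C mult_left_mono[OF Suc q]])
    finally show ?case by (simp add: mult.assoc)
  qed simp
  from this[of "axis j 1"] have "norm (mat_pow C n *v axis j 1) \<le> q ^ n" by (simp add: norm_axis_1)
  moreover have "mat_pow C n $ i $ j = (mat_pow C n *v axis j 1) $ i"
    by (simp add: matrix_vector_mult_basis column_def)
  ultimately show ?thesis using component_le_norm_cart order_trans by metis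
qed

text \<open>For \<open>y = (I + a \<Sigma>)\<inverse> x\<close> one has \<open>x = y + a \<Sigma> y\<close> and \<open>Q x = a \<Sigma> y\<close>, so that
\<open>\<parallel>x\<parallel>\<^sup>2 = \<parallel>y\<parallel>\<^sup>2 + 2 a y \<bullet> \<Sigma> y + \<parallel>Q x\<parallel>\<^sup>2\<close> exceeds \<open>\<parallel>Q x\<parallel>\<^sup>2\<close> unless \<open>x = 0\<close>. Compactness of the unit
sphere makes the contraction factor uniform. The second claim says \<open>Q = a (\<Sigma>\<inverse> + a I)\<inverse>\<close>.\<close>
lemma resolvent_facts:
  fixes \<Sigma> :: "real ^ 'n ^ 'n"
  assumes pd: "positive_definite \<Sigma>" and a: "0 < a"
  shows resolvent_contraction:
      "\<exists>q. 0 \<le> q \<and> q < 1 \<and> (\<forall>x. norm (resolvent_Q \<Sigma> a *v x) \<le> q * norm x)"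
    and resolvent_mult: "resolvent_Q \<Sigma> a ** (matrix_inv \<Sigma> + diag_mat (\<lambda>_. a)) = diag_mat (\<lambda>_. a)"
proof -
  let ?Q = "resolvent_Q \<Sigma> a" and ?J = "mat 1 + a *\<^sub>R \<Sigma>"
  have "transpose ?J = ?J"
    using pd by (simp add: positive_definite_def transpose_def vec_eq_iff mat_def)
  moreover have "x \<bullet> (?J *v x) > 0" if "x \<noteq> 0" for x
    using pd a that
    by (simp add: positive_definite_def matrix_vector_mult_add_rdistrib inner_add_right
        scaleR_matrix_vector_assoc[symmetric] add_pos_pos)
  ultimately have J: "positive_definite ?J" by (simp add: positive_definite_def)
  note nzJ = positive_definite_det_nz[OF J] and nz = positive_definite_det_nz[OF pd]
  have strict: "norm (?Q *v x) < norm x" if x: "x \<noteq> 0" for x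
  proof -
    define y where "y = matrix_inv ?J *v x"
    have Jy: "?J *v y = x" unfolding y_def by (rule matrix_inv_mult_vec[OF nzJ])
    then have xy: "x = y + a *\<^sub>R (\<Sigma> *v y)"
      by (simp add: matrix_vector_mult_add_rdistrib scaleR_matrix_vector_assoc)
    have Qx: "?Q *v x = a *\<^sub>R (\<Sigma> *v y)"
      unfolding resolvent_Q_def matrix_vector_mult_diff_rdistrib y_def[symmetric] using xy by simp
    have "y \<noteq> 0" using Jy x by auto
    then have "y \<bullet> (\<Sigma> *v y) > 0" "y \<bullet> y > 0" using pd by (auto simp: positive_definite_def)
    moreover have "x \<bullet> x = y \<bullet> y + 2 * a * (y \<bullet> (\<Sigma> *v y)) + (?Q *v x) \<bullet> (?Q *v x)"
      unfolding Qx arg_cong2[of x _ x _ inner, OF xy xy]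
      by (simp add: inner_add_left inner_add_right inner_commute)
    ultimately have "(?Q *v x) \<bullet> (?Q *v x) < x \<bullet> x"
      using a by (simp add: add_pos_pos)
    then show ?thesis unfolding norm_lt .
  qed
  have "sphere (0 :: real ^ 'n) 1 \<noteq> {}" by simp
  moreover have "continuous_on (sphere 0 1) (\<lambda>x. norm (?Q *v x))"
    by (intro continuous_intros)
  ultimately obtain z where "z \<in> sphere 0 1" "\<forall>y\<in>sphere 0 1. norm (?Q *v y) \<le> norm (?Q *v z)"
    using continuous_attains_sup[OF compact_sphere] by blast
  then have z: "norm z = 1" "\<And>x. norm x = 1 \<Longrightarrow> norm (?Q *v x) \<le> norm (?Q *v z)" by auto
  have "norm (?Q *v x) \<le> norm (?Q *v z) * norm x" for x
  proof (cases "x = 0")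
    case False
    have "norm (?Q *v ((1 / norm x) *\<^sub>R x)) \<le> norm (?Q *v z)"
      by (rule z) (use False in auto)
    then show ?thesis using False by (simp add: matrix_vector_mult_scaleR field_simps)
  qed simp
  moreover have "norm (?Q *v z) < 1" using strict[of z] z by force
  ultimately show "\<exists>q. 0 \<le> q \<and> q < 1 \<and> (\<forall>x. norm (?Q *v x) \<le> q * norm x)"
    by (intro exI[of _ "norm (?Q *v z)"]) auto
  let ?R = "matrix_inv \<Sigma>" and ?a = "diag_mat (\<lambda>_. a) :: real ^ 'n ^ 'n"
  have a_eq: "?a = a *\<^sub>R mat 1" by (simp add: diag_mat_def mat_def vec_eq_iff)
  have "?J ** ?R = ?R + ?a"
    unfolding a_eq by (simp add: matrix_mult_distrib_right matrix_mult_scaleR matrix_inv_mult(1)[OF nz])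
  then have "matrix_inv ?J ** (?R + ?a) = (matrix_inv ?J ** ?J) ** ?R"
    by (simp only: matrix_mul_assoc[symmetric])
  also have "\<dots> = ?R" using matrix_inv_mult(2)[OF nzJ] by simp
  finally show "?Q ** (?R + ?a) = ?a"
    unfolding resolvent_Q_def by (simp add: matrix_mult_distrib_right)
qed

section \<open>Alternating block products as coefficients of traces of powers\<close>

text \<open>If \<open>P\<close>, \<open>U\<close>, \<open>R\<close>, \<open>V\<close> are the blocks of \<open>Q\<close> in the order 11, 12, 22, 21, this is the 11-block of the
coefficient of \<open>s ^ k t ^ m\<close> in \<open>(S Q) ^ (k + m)\<close>: the sum over all walks of length \<open>k + m\<close> on the two
blocks from the first to itself with \<open>k\<close> steps that start in the first block.\<close>
definition alt_sum ::
  "real ^ 'p ^ 'p \<Rightarrow> real ^ 'q ^ 'p \<Rightarrow> real ^ 'q ^ 'q \<Rightarrow> real ^ 'p ^ 'q \<Rightarrow> nat \<Rightarrow> nat \<Rightarrow> real ^ 'p ^ 'p" where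
  "alt_sum P U R V k m = (\<Sum>(ks, ms)\<in>exponents k m. alt_prod P U R V ks ms)"

text \<open>The 21-block of the same coefficient, that is, the sum over the walks from the second block to the
first. The equations classify a walk by its first step.\<close>
primrec alt_sum_off ::
  "real ^ 'p ^ 'p \<Rightarrow> real ^ 'q ^ 'p \<Rightarrow> real ^ 'q ^ 'q \<Rightarrow> real ^ 'p ^ 'q \<Rightarrow> nat \<Rightarrow> nat \<Rightarrow> real ^ 'p ^ 'q" where
  "alt_sum_off P U R V k 0 = 0"
| "alt_sum_off P U R V k (Suc m) = V ** alt_sum P U R V k m + R ** alt_sum_off P U R V k m"

lemma exponents_0: "exponents 0 m = (if m = 0 then {([0], [])} else {})"
  by (auto simp: exponents_def length_Suc_conv)

text \<open>A product either begins with \<open>P\<close>, in which case the first exponent can be lowered by one, or it begins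
with \<open>U R\<^sup>j V\<close>, where \<open>j\<close> is the first entry of \<open>ms\<close>.\<close>
lemma exponents_Suc:
  "exponents (Suc k) m =
     (\<lambda>(ks, ms). (Suc (hd ks) # tl ks, ms)) ` exponents k m \<union>
     (\<Union>j<m. (\<lambda>(ks, ms). (0 # ks, j # ms)) ` exponents k (m - Suc j))" (is "_ = ?A \<union> ?B")
proof (intro equalityI subsetI)
  fix x assume "x \<in> exponents (Suc k) m"
  then obtain ks ms where x: "x = (ks, ms)" and len: "length ks = length ms + 1"
    and s: "sum_list ks + length ms = Suc k" "sum_list ms + length ms = m"
    by (auto simp: exponents_def)
  from len obtain k1 ks' where ks: "ks = k1 # ks'" by (cases ks) auto
  show "x \<in> ?A \<union> ?B"
  proof (cases k1)
    case (Suc k')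
    then have "(k' # ks', ms) \<in> exponents k m"
      using len s ks by (auto simp: exponents_def)
    then have "x \<in> ?A" by (rule rev_image_eqI) (simp add: x ks Suc)
    then show ?thesis ..
  next
    case 0
    with s ks len obtain j ms' where ms: "ms = j # ms'" by (cases ms) auto
    have "(ks', ms') \<in> exponents k (m - Suc j)"
      using len s ks ms 0 by (auto simp: exponents_def)
    then have "x \<in> (\<lambda>(ks, ms). (0 # ks, j # ms)) ` exponents k (m - Suc j)"
      by (rule rev_image_eqI) (simp add: x ks ms 0)
    moreover have "j < m" using s ms by simp
    ultimately show ?thesis by blast
  qed
next
  fix x assume "x \<in> ?A \<union> ?B"
  then show "x \<in> exponents (Suc k) m"
  proof
    assume "x \<in> ?A"
    then obtain ks ms where x: "x = (Suc (hd ks) # tl ks, ms)" and e: "(ks, ms) \<in> exponents k m" by auto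
    then obtain k1 ks' where "ks = k1 # ks'" by (cases ks) (auto simp: exponents_def)
    then show ?thesis using e x by (auto simp: exponents_def)
  next
    assume "x \<in> ?B"
    then show ?thesis by (auto simp: exponents_def)
  qed
qed

lemma exponents_nonempty: "(ks, ms) \<in> exponents k m \<Longrightarrow> ks \<noteq> []"
  by (auto simp: exponents_def)

lemma alt_prod_Suc:
  "length ks = length ms \<Longrightarrow> alt_prod P U R V (Suc k # ks) ms = P ** alt_prod P U R V (k # ks) ms"
  by (cases ms) (auto simp: alt_prod_def matrix_mul_assoc)

lemma alt_prod_0:
  "ks \<noteq> [] \<Longrightarrow> alt_prod P U R V (0 # ks) (m # ms) = U ** (mat_pow R m ** (V ** alt_prod P U R V ks ms))"
  by (simp add: alt_prod_def matrix_mul_assoc)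

lemma matrix_mult_sum_right:
  fixes A :: "real ^ 'n ^ 'm" shows "A ** (\<Sum>i\<in>I. f i) = (\<Sum>i\<in>I. A ** f i)"
  by (induction I rule: infinite_finite_induct) (simp_all add: matrix_add_ldistrib)

text \<open>The walks from the second block, classified by the number \<open>j\<close> of steps before the first block is
entered.\<close>
lemma alt_sum_off_eq:
  "alt_sum_off P U R V k m = (\<Sum>j<m. mat_pow R j ** (V ** alt_sum P U R V k (m - Suc j)))"
proof (induction m)
  case (Suc m)
  then show ?case
    by (simp only: alt_sum_off.simps sum.lessThan_Suc_shift)
      (simp add: matrix_mult_sum_right matrix_mul_assoc)
qed simp

lemma alt_sum_0: "alt_sum P U R V 0 m = (if m = 0 then mat 1 else 0)"
  by (simp add: alt_sum_def exponents_0 alt_prod_def)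

text \<open>The decomposition by the first step; together with the equations of \<open>alt_sum_off\<close> this is the recursion
satisfied by the first block column of the powers of \<open>S Q\<close>.\<close>
lemma alt_sum_Suc:
  "alt_sum P U R V (Suc k) m = P ** alt_sum P U R V k m + U ** alt_sum_off P U R V k m"
proof -
  let ?f = "\<lambda>(ks, ms). alt_prod P U R V ks ms"
  let ?g = "\<lambda>(ks :: nat list, ms :: nat list). (Suc (hd ks) # tl ks, ms)"
  let ?h = "\<lambda>j :: nat. \<lambda>(ks :: nat list, ms). (0 # ks, j # ms)"
  let ?A = "?g ` exponents k m" and ?B = "\<lambda>j. ?h j ` exponents k (m - Suc j)"
  have "alt_sum P U R V (Suc k) m = sum ?f ?A + sum ?f (\<Union>j<m. ?B j)"
    unfolding alt_sum_def exponents_Suc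
    by (rule sum.union_disjoint) (auto intro!: finite_imageI finite_UN_I finite_exponents)
  also have "sum ?f ?A = (\<Sum>x\<in>exponents k m. P ** ?f x)"
  proof (subst sum.reindex)
    have "ks = ks'" if "hd ks = hd ks'" "tl ks = tl ks'" "ks \<noteq> []" "ks' \<noteq> []" for ks ks' :: "nat list"
      using that by (metis list.collapse)
    then show "inj_on ?g (exponents k m)"
      by (auto simp: inj_on_def dest!: exponents_nonempty)
    show "sum (?f \<circ> ?g) (exponents k m) = (\<Sum>x\<in>exponents k m. P ** ?f x)"
    proof (rule sum.cong[OF refl])
      fix x assume x: "x \<in> exponents k m"
      obtain ks ms where "x = (ks, ms)" by (cases x)
      moreover then obtain k1 ks' where "ks = k1 # ks'" "length ks' = length ms"
        using x by (cases ks) (auto simp: exponents_def)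
      ultimately show "(?f \<circ> ?g) x = P ** ?f x" by (simp add: alt_prod_Suc)
    qed
  qed
  also have "\<dots> = P ** alt_sum P U R V k m"
    by (simp add: alt_sum_def matrix_mult_sum_right)
  also have "sum ?f (\<Union>j<m. ?B j) = (\<Sum>j<m. sum ?f (?B j))"
    by (rule sum.UNION_disjoint) (auto intro!: finite_exponents)
  also have "\<dots> = (\<Sum>j<m. U ** (mat_pow R j ** (V ** alt_sum P U R V k (m - Suc j))))"
  proof (rule sum.cong[OF refl])
    fix j
    have "sum ?f (?B j) = (\<Sum>x\<in>exponents k (m - Suc j). U ** (mat_pow R j ** (V ** ?f x)))"
      by (subst sum.reindex)
        (auto simp: inj_on_def alt_prod_0 dest: exponents_nonempty intro!: sum.cong)
    then show "sum ?f (?B j) = U ** (mat_pow R j ** (V ** alt_sum P U R V k (m - Suc j)))"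
      by (simp add: alt_sum_def matrix_mult_sum_right)
  qed
  also have "\<dots> = U ** alt_sum_off P U R V k m"
    by (simp add: alt_sum_off_eq matrix_mult_sum_right)
  finally show ?thesis .
qed

text \<open>\<open>X n\<close> and \<open>Y n\<close> stand for the two blocks in the first column of \<open>(S Q) ^ n\<close>. Stating the result for any
solution of the recursion lets it be used a second time with the roles of the blocks exchanged.\<close>
lemma alt_sum_generating:
  fixes P :: "real ^ 'p ^ 'p" and R :: "real ^ 'q ^ 'q"
  assumes X0: "X 0 = mat 1" "Y 0 = 0"
    and XS: "\<And>n. X (Suc n) = s *\<^sub>R (P ** X n + U ** Y n)"
    and YS: "\<And>n. Y (Suc n) = t *\<^sub>R (V ** X n + R ** Y n)"
  shows "X n = (\<Sum>k\<le>n. (s ^ k * t ^ (n - k)) *\<^sub>R alt_sum P U R V k (n - k))"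
    and "Y n = (\<Sum>k\<le>n. (s ^ k * t ^ (n - k)) *\<^sub>R alt_sum_off P U R V k (n - k))"
proof (induction n)
  case 0
  { case 1 show ?case by (simp add: X0 alt_sum_0) }
  { case 2 show ?case by (simp add: X0) }
next
  case (Suc n)
  { case 1
    have "X (Suc n) = (\<Sum>k\<le>n. (s ^ Suc k * t ^ (n - k)) *\<^sub>R alt_sum P U R V (Suc k) (n - k))"
      unfolding XS Suc alt_sum_Suc
      by (simp add: matrix_mult_sum_right matrix_mult_scaleR(2) scaleR_right.sum sum.distrib scaleR_add_right mult.assoc)
    then show ?case
      by (simp add: sum.atMost_Suc_shift alt_sum_0 del: sum.atMost_Suc) }
  { case 2
    have "Y (Suc n) = (\<Sum>k\<le>n. (s ^ k * t ^ (Suc n - k)) *\<^sub>R alt_sum_off P U R V k (Suc n - k))"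
      unfolding YS Suc
      by (simp add: matrix_mult_sum_right matrix_mult_scaleR(2) scaleR_right.sum sum.distrib scaleR_add_right
          Suc_diff_le mult_ac)
    then show ?case by simp }
qed

lemma trace_sum_matrix:
  fixes f :: "'a \<Rightarrow> real ^ 'n ^ 'n"
  shows "trace (\<Sum>x\<in>A. f x) = (\<Sum>x\<in>A. trace (f x))"
  unfolding trace_def by (simp add: sum.swap[of _ A])

lemma trace_scaleR:
  fixes A :: "real ^ 'n ^ 'n" shows "trace (r *\<^sub>R A) = r * trace A"
  by (simp add: trace_def sum_distrib_left)

lemma trace_sum_alt_sum:
  "trace_sum Q k m =
     trace (alt_sum (block11 Q) (block12 Q) (block22 Q) (block21 Q) k m) +
     trace (alt_sum (block22 Q) (block21 Q) (block11 Q) (block12 Q) m k)"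
  by (simp add: trace_sum_def alt_sum_def case_prod_beta trace_sum_matrix)

definition block_diag :: "real \<Rightarrow> real \<Rightarrow> 'p + 'q \<Rightarrow> real" where
  "block_diag s t = case_sum (\<lambda>_. s) (\<lambda>_. t)"

text \<open>The trace of \<open>(S Q) ^ n\<close> is the sum of the traces of its diagonal blocks, which count the walks that
return to the first block and those that return to the second.\<close>
lemma trace_sum_generating:
  fixes Q :: "real ^ ('a::finite + 'b::finite) ^ ('a + 'b)"
  shows
  "trace (mat_pow (diag_mat (block_diag s t) ** Q) n) =
     (\<Sum>k\<le>n. s ^ k * t ^ (n - k) * trace_sum Q k (n - k))"
proof -
  define C where "C = diag_mat (block_diag s t) ** Q"
  have C: "C $ i $ j = block_diag s t i * Q $ i $ j" for i j
    by (simp add: C_def matrix_matrix_mult_def diag_mat_def if_distrib[of "\<lambda>z. z * _"] cong: if_cong)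
  have sum_Plus: "(\<Sum>x\<in>UNIV. f x) = (\<Sum>i\<in>UNIV. f (Inl i)) + (\<Sum>j\<in>UNIV. f (Inr j))"
    for f :: "'a + 'b \<Rightarrow> real"
    using sum.Plus[of UNIV UNIV f] by simp
  note blocks = block11_def block12_def block21_def block22_def vec_eq_iff matrix_matrix_mult_def
    sum_Plus C block_diag_def sum_distrib_left distrib_left mult.assoc mat_def
  have "block11 (mat_pow C n) =
      (\<Sum>k\<le>n. (s ^ k * t ^ (n - k)) *\<^sub>R alt_sum (block11 Q) (block12 Q) (block22 Q) (block21 Q) k (n - k))"
    by (rule alt_sum_generating(1)[where Y="\<lambda>n. block21 (mat_pow C n)"]) (simp_all add: blocks)
  moreover have "block22 (mat_pow C n) =
      (\<Sum>k\<le>n. (t ^ k * s ^ (n - k)) *\<^sub>R alt_sum (block22 Q) (block21 Q) (block11 Q) (block12 Q) k (n - k))"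
    by (rule alt_sum_generating(1)[where Y="\<lambda>n. block12 (mat_pow C n)"]) (simp_all add: blocks add.commute)
  moreover have "(\<Sum>k\<le>n. (t ^ k * s ^ (n - k)) *\<^sub>R alt_sum (block22 Q) (block21 Q) (block11 Q) (block12 Q) k (n - k)) =
      (\<Sum>k\<le>n. (s ^ k * t ^ (n - k)) *\<^sub>R alt_sum (block22 Q) (block21 Q) (block11 Q) (block12 Q) (n - k) k)"
    by (rule sum.reindex_bij_witness[of _ "\<lambda>k. n - k" "\<lambda>k. n - k"]) (auto simp: mult.commute)
  moreover have "trace (mat_pow C n) = trace (block11 (mat_pow C n)) + trace (block22 (mat_pow C n))"
    by (simp add: trace_def sum_Plus block11_def block22_def)
  ultimately show ?thesis
    by (simp add: trace_sum_matrix trace_scaleR C_def[symmetric] trace_sum_alt_sum sum.distrib distrib_left)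
qed

section \<open>The Laplace transform in terms of the resolvent\<close>

text \<open>The substitution \<open>x = a (1 - s)\<close>, \<open>y = a (1 - t)\<close> turns the denominator \<open>\<Sigma>\<inverse> + a (I - S)\<close> of the
Laplace transform into \<open>(I - S Q) (\<Sigma>\<inverse> + a I)\<close>, and the first factor is expanded by
\<open>ln_det_series\<close>. The terms stay grouped by the degree \<open>n\<close>, the grouping in which the contraction
property of \<open>S Q\<close> gives absolute convergence.\<close>
lemma (in prob_space) gaussian_laplace_resolvent:
  fixes X :: "'a \<Rightarrow> real ^ ('p::finite + 'q::finite)"
  assumes X: "gaussian_vector M X" and mean: "\<And>i. (LINT w|M. X w $ i) = 0"
    and cov: "covariance_matrix M X = \<Sigma>" and pd: "positive_definite \<Sigma>"
    and a: "0 < a" and s: "0 \<le> s" "s \<le> 1" and t: "0 \<le> t" "t \<le> 1"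
  defines "\<psi> \<equiv> \<lambda>x y. LINT w|M. exp (- (x * (\<Sum>i\<in>UNIV. (X w $ Inl i)\<^sup>2) + y * (\<Sum>j\<in>UNIV. (X w $ Inr j)\<^sup>2)) / 2)"
  shows "summable (\<lambda>n. \<bar>\<Sum>k\<le>n. s ^ k * t ^ (n - k) * (trace_sum (resolvent_Q \<Sigma> a) k (n - k) / real n)\<bar>)"
    and "\<psi> (a * (1 - s)) (a * (1 - t)) = \<psi> a a *
      exp ((\<Sum>n. \<Sum>k\<le>n. s ^ k * t ^ (n - k) * (trace_sum (resolvent_Q \<Sigma> a) k (n - k) / real n)) / 2)"
    and "0 < \<psi> a a"
proof -
  let ?R = "matrix_inv \<Sigma>" and ?Q = "resolvent_Q \<Sigma> a"
  let ?D = "\<lambda>x y. diag_mat (block_diag x y) :: real ^ ('p + 'q) ^ ('p + 'q)"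
  define C where "C = ?D s t ** ?Q"
  have R: "positive_definite ?R" by (rule positive_definite_matrix_inv[OF pd])
  have \<psi>: "\<psi> x y = sqrt (det ?R / det (?R + ?D x y))" if "0 \<le> x" "0 \<le> y" for x y
  proof -
    have "(\<Sum>i\<in>UNIV. block_diag x y i * (X w $ i)\<^sup>2) =
        x * (\<Sum>i\<in>UNIV. (X w $ Inl i)\<^sup>2) + y * (\<Sum>j\<in>UNIV. (X w $ Inr j)\<^sup>2)" for w
      using sum.Plus[of "UNIV :: 'p set" "UNIV :: 'q set" "\<lambda>i. block_diag x y i * (X w $ i)\<^sup>2"]
      by (simp add: block_diag_def sum_distrib_left)
    then show ?thesis
      using gaussian_laplace[OF X mean cov pd, of "block_diag x y"] that
      unfolding \<psi>_def by (simp add: block_diag_def split: sum.split)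
  qed
  obtain q where q: "0 \<le> q" "q < 1" "\<And>x. norm (?Q *v x) \<le> q * norm x"
    using resolvent_contraction[OF pd a] by blast
  have "norm (C *v x) \<le> q * norm x" for x
  proof -
    have "norm (?D s t *v y) \<le> norm y" for y
    proof (rule norm_le_componentwise_cart)
      fix i :: "'p + 'q"
      have "\<bar>block_diag s t i\<bar> \<le> 1" using s t by (cases i) (auto simp: block_diag_def)
      then show "norm ((?D s t *v y) $ i) \<le> norm (y $ i)"
        by (simp add: diag_mat_mult_vec abs_mult mult_left_le_one_le)
    qed
    then have "norm (C *v x) \<le> norm (?Q *v x)"
      by (simp add: C_def matrix_vector_mul_assoc[symmetric])
    also have "\<dots> \<le> q * norm x" by (rule q)
    finally show ?thesis .
  qed
  from ln_det_series[OF q(1,2) mat_pow_contraction[OF q(1) this]]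
  have C: "0 < det (mat 1 - C)" "summable (\<lambda>n. \<bar>trace (mat_pow C n) / real n\<bar>)"
     "(\<lambda>n. trace (mat_pow C n) / real n) sums - ln (det (mat 1 - C))" by auto
  have tr: "trace (mat_pow C n) / real n = (\<Sum>k\<le>n. s ^ k * t ^ (n - k) * (trace_sum ?Q k (n - k) / real n))" for n
    unfolding C_def trace_sum_generating by (simp add: sum_divide_distrib)
  show "summable (\<lambda>n. \<bar>\<Sum>k\<le>n. s ^ k * t ^ (n - k) * (trace_sum ?Q k (n - k) / real n)\<bar>)"
    using C(2) unfolding tr .
  have Daa: "?D a a = diag_mat (\<lambda>_. a)"
    by (intro arg_cong[where f=diag_mat]) (auto simp: block_diag_def fun_eq_iff split: sum.split)
  have "?D s t ** diag_mat (\<lambda>_. a) = ?D (a * s) (a * t)"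
    by (simp add: diag_mat_def matrix_matrix_mult_def vec_eq_iff block_diag_def mult.commute
        if_distrib[of "\<lambda>z. z * _"] cong: if_cong split: sum.split)
  then have "C ** (?R + ?D a a) = ?D (a * s) (a * t)"
    unfolding C_def Daa matrix_mul_assoc[symmetric] resolvent_mult[OF pd a] .
  then have "(mat 1 - C) ** (?R + ?D a a) = ?R + ?D a a - ?D (a * s) (a * t)"
    by (simp add: matrix_mult_distrib_right)
  also have "\<dots> = ?R + ?D (a * (1 - s)) (a * (1 - t))"
    by (simp add: diag_mat_def vec_eq_iff block_diag_def algebra_simps split: sum.split)
  finally have det: "det (?R + ?D (a * (1 - s)) (a * (1 - t))) = det (mat 1 - C) * det (?R + ?D a a)"
    by (metis det_mul)
  have "\<psi> (a * (1 - s)) (a * (1 - t)) = \<psi> a a * (1 / sqrt (det (mat 1 - C)))"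
    using a s t by (simp add: \<psi> det real_sqrt_divide real_sqrt_mult)
  also have "1 / sqrt (det (mat 1 - C)) = exp (- ln (det (mat 1 - C)) / 2)"
    using C(1) by (simp add: powr_half_sqrt[symmetric] powr_def exp_minus field_simps)
  also have "- ln (det (mat 1 - C)) =
      (\<Sum>n. \<Sum>k\<le>n. s ^ k * t ^ (n - k) * (trace_sum ?Q k (n - k) / real n))"
    using sums_unique[OF C(3)] unfolding tr by simp
  finally show "\<psi> (a * (1 - s)) (a * (1 - t)) = \<psi> a a *
      exp ((\<Sum>n. \<Sum>k\<le>n. s ^ k * t ^ (n - k) * (trace_sum ?Q k (n - k) / real n)) / 2)" .
  have "0 \<le> \<psi> a a" unfolding \<psi>_def by (rule Bochner_Integration.integral_nonneg) simp
  moreover have "\<psi> a a \<noteq> 0"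
  proof -
    have "positive_definite (?R + ?D a a)" unfolding Daa
      by (rule positive_definite_add_diag[OF R]) (use a in auto)
    then show ?thesis using a R by (simp add: \<psi> positive_definite_det_nz)
  qed
  ultimately show "0 < \<psi> a a" by simp
qed

section \<open>Compound Poisson distributions\<close>

primrec iid_sum_pmf :: "'m::comm_monoid_add pmf \<Rightarrow> nat \<Rightarrow> 'm pmf" where
  "iid_sum_pmf q 0 = return_pmf 0"
| "iid_sum_pmf q (Suc j) = map_pmf (\<lambda>(x, y). x + y) (pair_pmf q (iid_sum_pmf q j))"

text \<open>A character \<open>\<xi>\<close> of the monoid turns sums of independent variables into products of expectations.\<close>
lemma nn_integral_iid_sum_pmf:
  fixes \<xi> :: "'m::comm_monoid_add \<Rightarrow> ennreal"
  assumes "\<xi> 0 = 1" "\<And>x y. \<xi> (x + y) = \<xi> x * \<xi> y"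
  shows "(\<integral>\<^sup>+z. \<xi> z \<partial>iid_sum_pmf q j) = (\<integral>\<^sup>+z. \<xi> z \<partial>q) ^ j"
proof (induction j)
  case (Suc j)
  then show ?case
    by (simp add: nn_integral_pair_pmf' assms nn_integral_cmult nn_integral_multc)
qed (simp add: assms)

text \<open>A Poisson number with mean \<open>\<theta>\<close> of independent jumps with law \<open>q\<close>: the expectation of a character is the
sum of \<open>exp (- \<theta>) (\<theta> g) ^ j / j!\<close>. One law serves for all characters at once.\<close>
lemma compound_poisson_pmf:
  fixes q :: "'m::comm_monoid_add pmf" and \<theta> :: real
  assumes "0 < \<theta>"
  shows "\<exists>p :: 'm pmf. \<forall>\<xi> :: 'm \<Rightarrow> ennreal. \<forall>g\<ge>0. \<xi> 0 = 1 \<longrightarrow> (\<forall>x y. \<xi> (x + y) = \<xi> x * \<xi> y) \<longrightarrow>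
     (\<integral>\<^sup>+z. \<xi> z \<partial>q) = ennreal g \<longrightarrow> (\<integral>\<^sup>+z. \<xi> z \<partial>p) = ennreal (exp (\<theta> * g - \<theta>))"
proof (intro exI[of _ "bind_pmf (poisson_pmf \<theta>) (iid_sum_pmf q)"] allI impI)
  fix \<xi> :: "'m \<Rightarrow> ennreal" and g :: real
  assume g0: "0 \<le> g" and \<xi>: "\<xi> 0 = 1" "\<forall>x y. \<xi> (x + y) = \<xi> x * \<xi> y" and g: "(\<integral>\<^sup>+z. \<xi> z \<partial>q) = ennreal g"
  have sums: "(\<lambda>j. \<theta> ^ j / fact j * exp (- \<theta>) * g ^ j) sums exp (\<theta> * g - \<theta>)"
    using sums_mult[OF exp_converges[of "\<theta> * g"], of "exp (- \<theta>)"]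
    by (simp add: exp_add[symmetric] power_mult_distrib field_simps)
  have "(\<integral>\<^sup>+z. \<xi> z \<partial>bind_pmf (poisson_pmf \<theta>) (iid_sum_pmf q)) =
      (\<integral>\<^sup>+j. ennreal (g ^ j) \<partial>poisson_pmf \<theta>)"
    using \<xi> g g0 by (simp add: nn_integral_iid_sum_pmf ennreal_power)
  also have "\<dots> = (\<Sum>j. ennreal (\<theta> ^ j / fact j * exp (- \<theta>) * g ^ j))"
    unfolding nn_integral_measure_pmf nn_integral_count_space_nat
    using assms g0 by (intro suminf_cong) (simp add: ennreal_mult[symmetric])
  also have "\<dots> = ennreal (exp (\<theta> * g - \<theta>))"
    using assms g0 by (intro suminf_ennreal_eq[OF _ sums]) auto
  finally show "(\<integral>\<^sup>+z. \<xi> z \<partial>bind_pmf (poisson_pmf \<theta>) (iid_sum_pmf q)) = ennreal (exp (\<theta> * g - \<theta>))" .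
qed

text \<open>The weight \<open>w n k\<close> is the rate of jumps by \<open>(k, n - k)\<close>. This indexing by the total \<open>n\<close> agrees with the
grouping of the series for the logarithm of the Laplace transform.\<close>
lemma compound_poisson_generating_function:
  fixes w :: "nat \<Rightarrow> nat \<Rightarrow> real"
  assumes w: "\<And>n k. 0 \<le> w n k" and w0: "w 0 0 = 0" and sm: "summable (\<lambda>n. \<Sum>k\<le>n. w n k)"
  shows "\<exists>p :: (nat \<times> nat) pmf. \<forall>x\<in>{0..1}. \<forall>y\<in>{0..1}.
     measure_pmf.expectation p (\<lambda>z. x ^ fst z * y ^ snd z) =
       exp ((\<Sum>n. \<Sum>k\<le>n. x ^ k * y ^ (n - k) * w n k) - (\<Sum>n. \<Sum>k\<le>n. w n k))"
proof -
  \<comment> \<open>A jump of size zero has no effect; giving it rate one makes the total rate positive.\<close>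
  define v where "v n k = (if n = 0 \<and> k = 0 then 1 else if k \<le> n then w n k else 0)" for n k :: nat
  define \<theta> where "\<theta> = 1 + (\<Sum>n. \<Sum>k\<le>n. w n k)"
  have \<theta>: "0 < \<theta>" unfolding \<theta>_def by (intro add_pos_nonneg suminf_nonneg sm sum_nonneg w) auto
  have int: "(\<integral>\<^sup>+z. ennreal (f (fst z) (snd z) * v (fst z) (snd z)) \<partial>count_space UNIV) =
      ennreal (f 0 0 + (\<Sum>n. \<Sum>k\<le>n. f n k * w n k))" (is "?I = _")
    and suminf_nonneg': "0 \<le> f 0 0 + (\<Sum>n. \<Sum>k\<le>n. f n k * w n k)"
    if f: "\<And>n k. 0 \<le> f n k" "\<And>n k. f n k \<le> 1" for f :: "nat \<Rightarrow> nat \<Rightarrow> real"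
  proof -
    have sm': "summable (\<lambda>n. \<Sum>k\<le>n. f n k * w n k)"
    proof (rule summable_comparison_test'[OF sm])
      show "norm (\<Sum>k\<le>n. f n k * w n k) \<le> (\<Sum>k\<le>n. w n k)" for n
        using f w by (auto simp: abs_of_nonneg sum_nonneg intro!: sum_mono mult_left_le_one_le)
    qed
    show "0 \<le> f 0 0 + (\<Sum>n. \<Sum>k\<le>n. f n k * w n k)"
      using f w by (intro add_nonneg_nonneg suminf_nonneg sm' sum_nonneg) auto
    have row: "(\<Sum>k. ennreal (f n k * v n k)) = ennreal ((if n = 0 then f 0 0 else 0) + (\<Sum>k\<le>n. f n k * w n k))" for n
    proof -
      have "(\<Sum>k. ennreal (f n k * v n k)) = (\<Sum>k\<le>n. ennreal (f n k * v n k))"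
        by (rule suminf_finite) (auto simp: v_def)
      also have "\<dots> = ennreal (\<Sum>k\<le>n. f n k * v n k)"
        using f w by (intro sum_ennreal) (auto simp: v_def)
      also have "(\<Sum>k\<le>n. f n k * v n k) = (if n = 0 then f 0 0 else 0) + (\<Sum>k\<le>n. f n k * w n k)"
        by (cases n) (auto simp: v_def w0 intro!: sum.cong)
      finally show ?thesis .
    qed
    have "(\<lambda>n. (if n = 0 then f 0 0 else 0) + (\<Sum>k\<le>n. f n k * w n k)) sums
        (f 0 0 + (\<Sum>n. \<Sum>k\<le>n. f n k * w n k))"
      using sums_add[OF sums_single[of 0 "\<lambda>_. f 0 0"] summable_sums[OF sm']] by simp
    then have "(\<Sum>n. ennreal ((if n = 0 then f 0 0 else 0) + (\<Sum>k\<le>n. f n k * w n k))) =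
        ennreal (f 0 0 + (\<Sum>n. \<Sum>k\<le>n. f n k * w n k))"
      using f w by (intro suminf_ennreal_eq) (auto intro!: add_nonneg_nonneg sum_nonneg)
    then show "?I = ennreal (f 0 0 + (\<Sum>n. \<Sum>k\<le>n. f n k * w n k))"
      unfolding nn_integral_fst_count_space[symmetric] nn_integral_count_space_nat fst_conv snd_conv row .
  qed
  define u where "u z = v (fst z) (snd z) / \<theta>" for z
  have u0: "0 \<le> u z" for z using w \<theta> by (auto simp: u_def v_def)
  have u_int: "(\<integral>\<^sup>+z. ennreal (f (fst z) (snd z) * u z) \<partial>count_space UNIV) =
      ennreal ((f 0 0 + (\<Sum>n. \<Sum>k\<le>n. f n k * w n k)) / \<theta>)"
    if f: "\<And>n k. 0 \<le> f n k" "\<And>n k. f n k \<le> 1" for f :: "nat \<Rightarrow> nat \<Rightarrow> real"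
  proof -
    have "(\<integral>\<^sup>+z. ennreal (f (fst z) (snd z) * u z) \<partial>count_space UNIV) =
       (\<integral>\<^sup>+z. ennreal (1 / \<theta>) * ennreal (f (fst z) (snd z) * v (fst z) (snd z)) \<partial>count_space UNIV)"
      using \<theta> f w by (intro nn_integral_cong) (simp add: u_def ennreal_mult'[symmetric])
    also have "\<dots> = ennreal (1 / \<theta>) * ennreal (f 0 0 + (\<Sum>n. \<Sum>k\<le>n. f n k * w n k))"
      by (subst nn_integral_cmult) (simp_all add: int f)
    finally show ?thesis using \<theta> by (simp add: ennreal_mult'[symmetric])
  qed
  have u1: "(\<integral>\<^sup>+z. ennreal (u z) \<partial>count_space UNIV) = 1"
    using u_int[of "\<lambda>_ _. 1"] \<theta> by (simp add: \<theta>_def)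
  define q where "q = map_pmf (\<lambda>(n, k). (k, n - k)) (embed_pmf u)"
  obtain p :: "(nat \<times> nat) pmf" where p: "\<And>\<xi> g. 0 \<le> g \<Longrightarrow> \<xi> 0 = 1 \<Longrightarrow> (\<And>x y. \<xi> (x + y) = \<xi> x * \<xi> y) \<Longrightarrow>
     (\<integral>\<^sup>+z. \<xi> z \<partial>q) = ennreal g \<Longrightarrow> (\<integral>\<^sup>+z. \<xi> z \<partial>p) = ennreal (exp (\<theta> * g - \<theta>))"
    using compound_poisson_pmf[OF \<theta>, of q] by metis
  have "measure_pmf.expectation p (\<lambda>z. x ^ fst z * y ^ snd z) =
       exp ((\<Sum>n. \<Sum>k\<le>n. x ^ k * y ^ (n - k) * w n k) - (\<Sum>n. \<Sum>k\<le>n. w n k))"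
    if x: "x \<in> {0..1}" and y: "y \<in> {0..1}" for x y
  proof -
    let ?S = "\<Sum>n. \<Sum>k\<le>n. x ^ k * y ^ (n - k) * w n k"
    define \<xi> where "\<xi> z = ennreal (x ^ fst z * y ^ snd z)" for z :: "nat \<times> nat"
    have f: "0 \<le> x ^ k * y ^ (n - k)" "x ^ k * y ^ (n - k) \<le> 1" for n k
      using x y by (auto intro!: mult_le_one power_le_one)
    have "(\<integral>\<^sup>+z. \<xi> z \<partial>q) = (\<integral>\<^sup>+z. ennreal (u z) * ennreal (x ^ snd z * y ^ (fst z - snd z)) \<partial>count_space UNIV)"
      unfolding q_def nn_integral_map_pmf
      by (subst nn_integral_measure_pmf) (simp add: pmf_embed_pmf u0 u1 \<xi>_def case_prod_beta)
    also have "\<dots> = ennreal ((1 + ?S) / \<theta>)"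
      using u_int[of "\<lambda>n k. x ^ k * y ^ (n - k)", OF f] u0 f(1)
      by (simp add: ennreal_mult[symmetric] mult.commute)
    finally have "(\<integral>\<^sup>+z. \<xi> z \<partial>p) = ennreal (exp (\<theta> * ((1 + ?S) / \<theta>) - \<theta>))"
      using suminf_nonneg'[of "\<lambda>n k. x ^ k * y ^ (n - k)", OF f] \<theta> x y
      by (intro p) (auto simp: \<xi>_def power_add ennreal_mult[symmetric] mult_ac)
    also have "\<theta> * ((1 + ?S) / \<theta>) - \<theta> = ?S - (\<Sum>n. \<Sum>k\<le>n. w n k)"
      using \<theta> by (simp add: \<theta>_def)
    finally have "(\<integral>\<^sup>+z. ennreal (x ^ fst z * y ^ snd z) \<partial>p) = ennreal (exp (?S - (\<Sum>n. \<Sum>k\<le>n. w n k)))"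
      unfolding \<xi>_def .
    then show ?thesis
      using x y by (subst integral_eq_nn_integral) auto
  qed
  then show ?thesis by blast
qed

section \<open>A space-filling curve and compactness on the unit square\<close>

text \<open>A continuous even function of period \<open>2\<close> that is \<open>0\<close> on \<open>[0, 1/3]\<close> and \<open>1\<close> on \<open>[2/3, 1]\<close>. At \<open>3 ^ j t\<close> it
reads off the \<open>j\<close>-th ternary digit of a point \<open>t\<close> of the Cantor set, up to the factor \<open>2\<close>.\<close>
definition schoenberg_wave :: "real \<Rightarrow> real" where
  "schoenberg_wave t = max 0 (min 1 (1 / 2 - cos (pi * t)))"

text \<open>Schoenberg's space-filling curve. The ternary digits of \<open>t\<close> at even places become the binary digits of
one coordinate, those at odd places the digits of the other.\<close>
definition schoenberg_curve :: "real \<Rightarrow> real \<times> real" where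
  "schoenberg_curve t =
     (\<Sum>k. schoenberg_wave (3 ^ (2 * k) * t) / 2 ^ Suc k, \<Sum>k. schoenberg_wave (3 ^ (2 * k + 1) * t) / 2 ^ Suc k)"

lemma schoenberg_wave_range: "0 \<le> schoenberg_wave t" "schoenberg_wave t \<le> 1"
  by (auto simp: schoenberg_wave_def)

lemma sums_half_powers: "(\<lambda>k. 1 / 2 ^ Suc k :: real) sums 1"
  using power_half_series by (simp add: power_one_over field_simps)

text \<open>The Weierstrass M-test with majorant \<open>2 ^ - (k + 1)\<close>.\<close>
lemma wave_series:
  fixes f :: "nat \<Rightarrow> real \<Rightarrow> real"
  assumes f: "\<And>k t. 0 \<le> f k t" "\<And>k t. f k t \<le> 1"
  shows "summable (\<lambda>k. f k t / 2 ^ Suc k)"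
    and "(\<Sum>k. f k t / 2 ^ Suc k) \<in> {0..1}"
    and "(\<And>k. continuous_on UNIV (f k)) \<Longrightarrow> continuous_on UNIV (\<lambda>t. \<Sum>k. f k t / 2 ^ Suc k)"
proof -
  note sm1 = sums_summable[OF sums_half_powers]
  have bd: "norm (f k t / 2 ^ Suc k) \<le> 1 / 2 ^ Suc k" for k t
    using f[of k t] by (simp add: divide_right_mono)
  show sm: "summable (\<lambda>k. f k t / 2 ^ Suc k)" by (rule summable_comparison_test'[OF sm1 bd])
  have "0 \<le> (\<Sum>k. f k t / 2 ^ Suc k)" by (intro suminf_nonneg sm) (simp add: f)
  moreover have "(\<Sum>k. f k t / 2 ^ Suc k) \<le> (\<Sum>k. 1 / 2 ^ Suc k)"
    by (intro suminf_le sm sm1) (simp add: f divide_right_mono)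
  ultimately show "(\<Sum>k. f k t / 2 ^ Suc k) \<in> {0..1}"
    using sums_unique[OF sums_half_powers] by simp
  show "continuous_on UNIV (\<lambda>t. \<Sum>k. f k t / 2 ^ Suc k)" if c: "\<And>k. continuous_on UNIV (f k)"
  proof (rule uniform_limit_theorem)
    show "uniform_limit UNIV (\<lambda>n t. \<Sum>k<n. f k t / 2 ^ Suc k) (\<lambda>t. \<Sum>k. f k t / 2 ^ Suc k) sequentially"
      by (rule Weierstrass_m_test[OF bd sm1])
    show "\<forall>\<^sub>F n in sequentially. continuous_on UNIV (\<lambda>t. \<Sum>k<n. f k t / 2 ^ Suc k)"
      by (intro always_eventually allI continuous_intros c) auto
  qed auto
qed

lemma continuous_schoenberg_curve: "continuous_on UNIV schoenberg_curve"
  and schoenberg_curve_range: "schoenberg_curve t \<in> {0..1} \<times> {0..1}"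
proof -
  have c: "continuous_on UNIV (\<lambda>t. schoenberg_wave (c * t))" for c
    unfolding schoenberg_wave_def by (intro continuous_intros)
  show "continuous_on UNIV schoenberg_curve"
    unfolding schoenberg_curve_def[abs_def]
    by (intro continuous_on_Pair wave_series(3)[of "\<lambda>k t. schoenberg_wave (3 ^ (2 * k) * t)"]
       wave_series(3)[of "\<lambda>k t. schoenberg_wave (3 ^ (2 * k + 1) * t)"] schoenberg_wave_range c)
  show "schoenberg_curve t \<in> {0..1} \<times> {0..1}"
    unfolding schoenberg_curve_def
    using wave_series(2)[of "\<lambda>k t. schoenberg_wave (3 ^ (2 * k) * t)" t]
      wave_series(2)[of "\<lambda>k t. schoenberg_wave (3 ^ (2 * k + 1) * t)" t]
    by (simp add: schoenberg_wave_range del: power_Suc)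
qed

text \<open>The greedy expansion; it also covers \<open>x = 1\<close>, with all digits equal to one.\<close>
lemma binary_expansion:
  fixes x :: real
  assumes "x \<in> {0..1}"
  shows "\<exists>c :: nat \<Rightarrow> bool. (\<lambda>k. of_bool (c k) / 2 ^ Suc k) sums x"
proof -
  define s where "s = rec_nat 0 (\<lambda>k y. if y + 1 / 2 ^ Suc k \<le> x then y + 1 / 2 ^ Suc k else y)"
  have s0: "s 0 = 0" and sS: "s (Suc k) = (if s k + 1 / 2 ^ Suc k \<le> x then s k + 1 / 2 ^ Suc k else s k)" for k
    by (simp_all add: s_def)
  define c where "c k \<longleftrightarrow> s k + 1 / 2 ^ Suc k \<le> x" for k
  have sum: "(\<Sum>k<n. of_bool (c k) / 2 ^ Suc k) = s n" for n
    by (induction n) (simp_all add: s0 sS c_def)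
  have bd: "s n \<le> x \<and> x \<le> s n + (1/2) ^ n" for n
  proof (induction n)
    case 0 then show ?case using assms by (simp add: s0)
  next
    case (Suc n)
    have "1 / 2 ^ Suc n = (1/2) ^ n / (2 :: real)" by (simp add: power_one_over)
    with Suc show ?case by (auto simp: sS simp del: power_Suc) (simp_all add: power_one_over)
  qed
  have "s \<longlonglongrightarrow> x"
  proof (rule tendsto_sandwich)
    show "(\<lambda>n. x - (1/2) ^ n) \<longlonglongrightarrow> x"
      using tendsto_diff[OF tendsto_const LIMSEQ_power_zero[of "1/2 :: real"], of x] by simp
    show "\<forall>\<^sub>F n in sequentially. x - (1/2) ^ n \<le> s n"
      using bd by (intro always_eventually allI) (simp add: diff_le_eq)
    show "\<forall>\<^sub>F n in sequentially. s n \<le> x" using bd by simp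
  qed simp
  then have "(\<lambda>k. of_bool (c k) / 2 ^ Suc k) sums x" unfolding sums_def sum .
  then show ?thesis by blast
qed

text \<open>Multiplied by \<open>3 ^ j\<close>, the digits of \<open>t\<close> before place \<open>j\<close> contribute an even integer, which the periodicity
removes, and the digits after place \<open>j\<close> contribute at most \<open>1/3\<close>.\<close>
lemma schoenberg_wave_digit:
  assumes t: "(\<lambda>k. 2 * of_bool (c k) / 3 ^ Suc k) sums t"
  shows "schoenberg_wave (3 ^ j * t) = of_bool (c j)"
proof -
  have geo: "(\<lambda>k. 2 / 3 ^ Suc k :: real) sums 1"
    using sums_mult[OF geometric_sums[of "1/3 :: real"], of "2/3"] by (simp add: power_one_over field_simps)
  have bd: "\<exists>r. 0 \<le> r \<and> r \<le> 1 / 3 \<and> 3 ^ j * t = 2 * real m + 2 * of_bool (c j) / 3 + r"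
    if m: "(\<Sum>k<j. 2 * of_bool (c k) / 3 ^ Suc k) * 3 ^ j = 2 * real m" for m
  proof -
    have tail: "(\<lambda>k. 2 * of_bool (c (k + Suc j)) / 3 ^ Suc (k + Suc j)) sums
        (t - (\<Sum>k<Suc j. 2 * of_bool (c k) / 3 ^ Suc k))"
      using sums_iff_shift[of "\<lambda>k. 2 * of_bool (c k) / 3 ^ Suc k :: real" "Suc j"] t by auto
    define r where "r = 3 ^ j * (t - (\<Sum>k<Suc j. 2 * of_bool (c k) / 3 ^ Suc k))"
    have r: "(\<lambda>k. 3 ^ j * (2 * of_bool (c (k + Suc j)) / 3 ^ Suc (k + Suc j))) sums r"
      unfolding r_def by (rule sums_mult[OF tail])
    have "0 \<le> r" by (rule sums_le[OF _ sums_zero r]) simp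
    moreover have "r \<le> 1 / 3"
    proof (rule sums_le[OF _ r])
      show "(\<lambda>k. (2 / 3 ^ Suc k) / 3 :: real) sums (1 / 3)" by (rule sums_divide[OF geo])
      show "3 ^ j * (2 * of_bool (c (k + Suc j)) / 3 ^ Suc (k + Suc j)) \<le> (2 / 3 ^ Suc k) / (3 :: real)" for k
        by (simp add: power_add field_simps)
    qed
    moreover have "3 ^ j * t = 2 * real m + 2 * of_bool (c j) / 3 + r"
      unfolding r_def using m by (simp add: algebra_simps)
    ultimately show ?thesis by blast
  qed
  have "\<exists>m. (\<Sum>k<j. 2 * of_bool (c k) / 3 ^ Suc k) * 3 ^ j = 2 * real m" for j
  proof (induction j)
    case 0 then show ?case by (intro exI[of _ 0]) simp
  next
    case (Suc j)
    then obtain m where "(\<Sum>k<j. 2 * of_bool (c k) / 3 ^ Suc k) * 3 ^ j = 2 * real m" ..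
    then have "(\<Sum>k<Suc j. 2 * of_bool (c k) / 3 ^ Suc k) * 3 ^ Suc j = 2 * real (3 * m + of_bool (c j))"
      by (simp add: distrib_right field_simps)
    then show ?case ..
  qed
  then obtain m where "(\<Sum>k<j. 2 * of_bool (c k) / 3 ^ Suc k) * 3 ^ j = 2 * real m" ..
  from bd[OF this] obtain r where r: "0 \<le> r" "r \<le> 1/3" "3 ^ j * t = 2 * real m + 2 * of_bool (c j) / 3 + r"
    by blast
  have "cos (pi * (3 ^ j * t)) = cos (pi * (2 * of_bool (c j) / 3 + r) + 2 * real m * pi)"
    unfolding r(3) by (simp add: algebra_simps)
  then have cos: "cos (pi * (3 ^ j * t)) = cos (pi * (2 * of_bool (c j) / 3 + r))"
    by (simp add: cos_add)
  show ?thesis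
  proof (cases "c j")
    case False
    have "cos (pi * (1 / 3)) \<le> cos (pi * r)"
      using r by (intro cos_monotone_0_pi_le mult_left_mono) auto
    then have "1 / 2 \<le> cos (pi * r)" using cos_60 by simp
    then show ?thesis using False cos by (simp add: schoenberg_wave_def)
  next
    case True
    have "cos (pi * (2 / 3 + r)) \<le> cos (pi * (2 / 3))"
      using r by (intro cos_monotone_0_pi_le mult_left_mono) (auto simp: field_simps)
    also have "\<dots> = - (1 / 2)" using cos_120 by (simp add: mult.commute)
    finally show ?thesis using True cos by (simp add: schoenberg_wave_def)
  qed
qed

lemma schoenberg_curve_surj:
  assumes "z \<in> {0..1} \<times> {0..1}"
  shows "\<exists>t\<in>{0..1}. schoenberg_curve t = z"
proof -
  obtain x y where z: "z = (x, y)" by (cases z)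
  obtain a b where a: "(\<lambda>k. of_bool (a k) / 2 ^ Suc k) sums x" and b: "(\<lambda>k. of_bool (b k) / 2 ^ Suc k) sums y"
    using binary_expansion assms unfolding z by (metis mem_Sigma_iff)
  define c where "c j = (if even j then a (j div 2) else b (j div 2))" for j
  have geo: "(\<lambda>k. 2 / 3 ^ Suc k :: real) sums 1"
    using sums_mult[OF geometric_sums[of "1/3 :: real"], of "2/3"] by (simp add: power_one_over field_simps)
  have sm: "summable (\<lambda>k. 2 * of_bool (c k) / 3 ^ Suc k :: real)"
    by (rule summable_comparison_test'[OF sums_summable[OF geo]]) simp
  define t where "t = (\<Sum>k. 2 * of_bool (c k) / 3 ^ Suc k :: real)"
  have t: "(\<lambda>k. 2 * of_bool (c k) / 3 ^ Suc k) sums t"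
    unfolding t_def by (rule summable_sums[OF sm])
  have "0 \<le> t" by (rule sums_le[OF _ sums_zero t]) simp
  moreover have "t \<le> 1" by (rule sums_le[OF _ t geo]) simp
  moreover have "schoenberg_curve t = z"
    unfolding schoenberg_curve_def schoenberg_wave_digit[OF t] z
    using sums_unique[OF a] sums_unique[OF b] by (simp add: c_def)
  ultimately show ?thesis by auto
qed

text \<open>Helly's selection theorem on the line yields compactness on the square: each point of the square is
replaced by a parameter of the space-filling curve, a subsequence of the laws of the parameters converges
weakly, and the continuous curve carries the limit back to the square.\<close>
lemma unit_square_compactness:
  fixes p :: "nat \<Rightarrow> (real \<times> real) pmf" and c :: "nat \<Rightarrow> nat \<Rightarrow> real"
  assumes supp: "\<And>r. set_pmf (p r) \<subseteq> {0..1} \<times> {0..1}"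
    and lim: "\<And>i j. (\<lambda>r. measure_pmf.expectation (p r) (\<lambda>z. fst z ^ i * snd z ^ j)) \<longlonglongrightarrow> c i j"
  shows "\<exists>N :: (real \<times> real) measure. prob_space N \<and> sets N = sets borel \<and>
     (AE z in N. z \<in> {0..1} \<times> {0..1}) \<and> (\<forall>i j. (LINT z|N. fst z ^ i * snd z ^ j) = c i j)"
proof -
  let ?\<gamma> = schoenberg_curve
  have \<gamma>_meas [measurable]: "?\<gamma> \<in> borel_measurable borel"
    by (rule borel_measurable_continuous_onI[OF continuous_schoenberg_curve])
  \<comment> \<open>A right inverse of the curve. Its values are parameters in \<open>{0..1}\<close> also off the square, so that the
    laws of the parameters form a tight sequence.\<close>
  define \<sigma> where "\<sigma> z = (SOME t. t \<in> {0..1} \<and> (z \<in> {0..1} \<times> {0..1} \<longrightarrow> ?\<gamma> t = z))" for z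
  have \<sigma>: "\<sigma> z \<in> {0..1} \<and> (z \<in> {0..1} \<times> {0..1} \<longrightarrow> ?\<gamma> (\<sigma> z) = z)" for z
    unfolding \<sigma>_def
  proof (rule someI_ex)
    show "\<exists>t. t \<in> {0..1} \<and> (z \<in> {0..1} \<times> {0..1} \<longrightarrow> ?\<gamma> t = z)"
    proof (cases "z \<in> {0..1} \<times> {0..1}")
      case True
      then show ?thesis using schoenberg_curve_surj by blast
    next
      case False
      then show ?thesis by (intro exI[of _ 0]) simp
    qed
  qed
  define \<nu> where "\<nu> r = distr (measure_pmf (p r)) borel \<sigma>" for r
  have \<sigma>_meas: "\<sigma> \<in> measure_pmf (p r) \<rightarrow>\<^sub>M borel" for r by simp
  have "tight \<nu>" unfolding tight_def
  proof (intro conjI allI impI)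
    show "real_distribution (\<nu> r)" for r
      unfolding \<nu>_def by (rule prob_space.real_distribution_distr[OF prob_space_measure_pmf \<sigma>_meas])
    fix \<epsilon> :: real assume "0 < \<epsilon>"
    have "measure (\<nu> r) {-1<..1} = 1" for r
    proof -
      have "measure (\<nu> r) {-1<..1} = measure (measure_pmf (p r)) (\<sigma> -` {-1<..1})"
        unfolding \<nu>_def by (subst measure_distr[OF \<sigma>_meas]) auto
      also have "\<sigma> -` {-1<..1} = UNIV"
      proof -
        have "\<sigma> z \<in> {-1<..1}" for z using conjunct1[OF \<sigma>[of z]] by simp
        then show ?thesis by blast
      qed
      finally show ?thesis by simp
    qed
    then show "\<exists>a b. a < b \<and> (\<forall>n. 1 - \<epsilon> < measure (\<nu> n) {a<..b})"
      using \<open>0 < \<epsilon>\<close> by (intro exI[of _ "-1"] exI[of _ 1]) auto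
  qed
  from tight_imp_convergent_subsubsequence[OF this strict_mono_id]
  obtain r L where r: "strict_mono (r :: nat \<Rightarrow> nat)" and L: "real_distribution L"
    and conv: "weak_conv_m (\<nu> \<circ> id \<circ> r) L" by blast
  interpret L: real_distribution L by fact
  interpret \<nu>: real_distribution "(\<nu> \<circ> id \<circ> r) k" for k
    unfolding \<nu>_def comp_def by (rule prob_space.real_distribution_distr[OF prob_space_measure_pmf \<sigma>_meas])
  define N where "N = distr L borel ?\<gamma>"
  have "(LINT z|N. fst z ^ i * snd z ^ j) = c i j" for i j
  proof -
    have mon: "(\<lambda>z :: real \<times> real. fst z ^ i * snd z ^ j) \<in> borel_measurable borel"
      by (intro borel_measurable_continuous_onI continuous_intros)
    let ?f = "\<lambda>t. fst (?\<gamma> t) ^ i * snd (?\<gamma> t) ^ j"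
    have "(\<lambda>k. integral\<^sup>L ((\<nu> \<circ> id \<circ> r) k) ?f) \<longlonglongrightarrow> integral\<^sup>L L ?f"
    proof (rule weak_conv_imp_integral_bdd_continuous_conv[OF \<nu>.real_distribution_axioms L conv])
      show "isCont ?f t" for t
        using continuous_schoenberg_curve by (auto simp: continuous_on_eq_continuous_at intro!: continuous_intros)
      show "norm (?f t) \<le> 1" for t
        using schoenberg_curve_range[of t]
        by (auto simp: mem_Times_iff abs_mult power_abs intro!: mult_le_one power_le_one)
    qed
    moreover have "integral\<^sup>L ((\<nu> \<circ> id \<circ> r) k) ?f = measure_pmf.expectation (p (r k)) (\<lambda>z. fst z ^ i * snd z ^ j)" for k
    proof -
      have "integral\<^sup>L ((\<nu> \<circ> id \<circ> r) k) ?f = measure_pmf.expectation (p (r k)) (\<lambda>z. ?f (\<sigma> z))"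
        unfolding \<nu>_def comp_def id_def by (rule integral_distr[OF \<sigma>_meas measurable_compose[OF \<gamma>_meas mon]])
      also have "\<dots> = measure_pmf.expectation (p (r k)) (\<lambda>z. fst z ^ i * snd z ^ j)"
        using \<sigma> supp[of "r k"] by (intro integral_cong_AE) (auto simp: AE_measure_pmf_iff subset_iff)
      finally show ?thesis .
    qed
    ultimately have "integral\<^sup>L L ?f = c i j"
      using LIMSEQ_subseq_LIMSEQ[OF lim r, of i j] by (auto simp: comp_def intro: LIMSEQ_unique)
    then show ?thesis unfolding N_def by (subst integral_distr[OF _ mon]) simp_all
  qed
  moreover have "prob_space N" unfolding N_def by (rule L.prob_space_distr) simp
  moreover have "AE z in N. z \<in> {0..1} \<times> {0..1}"
  proof -
    have "closed ({0..1} \<times> {0..1} :: (real \<times> real) set)" by (intro closed_Times) auto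
    then have "{z \<in> space borel. z \<in> {0..1} \<times> {0..1}} \<in> sets (borel :: (real \<times> real) measure)"
      by (simp add: borel_closed)
    from AE_distr_iff[OF _ this, of ?\<gamma> L] show ?thesis
      unfolding N_def using schoenberg_curve_range by simp
  qed
  moreover have "sets N = sets borel" by (simp add: N_def)
  ultimately show ?thesis by blast
qed

section \<open>Moments determine a distribution on the unit square\<close>

text \<open>Multiplication by a coordinate only shifts the moments of a function \<open>h\<close>. So the functions whose moments
of all orders agree under \<open>M\<close> and \<open>N\<close> are stable under multiplication by polynomials, and they contain
the constant \<open>1\<close>.\<close>
lemma real_polynomial_function_integral_eq:
  fixes M N :: "(real \<times> real) measure" and f :: "real \<times> real \<Rightarrow> real"
  assumes f: "real_polynomial_function f"
    and M: "prob_space M" "sets M = sets borel" "AE z in M. z \<in> {0..1} \<times> {0..1}"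
    and N: "prob_space N" "sets N = sets borel" "AE z in N. z \<in> {0..1} \<times> {0..1}"
    and mom: "\<And>i j. (LINT z|M. fst z ^ i * snd z ^ j) = (LINT z|N. fst z ^ i * snd z ^ j)"
  shows "(LINT z|M. f z) = (LINT z|N. f z)"
proof -
  interpret M: prob_space M by fact
  interpret N: prob_space N by fact
  define S where "S = {h. continuous_on UNIV h \<and>
     (\<forall>i j. (LINT z|M. h z * (fst z ^ i * snd z ^ j)) = (LINT z|N. h z * (fst z ^ i * snd z ^ j)))}"
  have int: "integrable M h \<and> integrable N h" if h: "continuous_on UNIV h" for h :: "real \<times> real \<Rightarrow> real"
  proof -
    have "compact ({0..1} \<times> {0..1} :: (real \<times> real) set)" by (intro compact_Times) auto
    then have "bounded (h ` ({0..1} \<times> {0..1}))"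
      using h by (intro compact_imp_bounded compact_continuous_image continuous_on_subset[OF h]) auto
    then obtain B where B: "\<And>z. z \<in> {0..1} \<times> {0..1} \<Longrightarrow> \<bar>h z\<bar> \<le> B"
      unfolding bounded_iff by auto
    have [measurable]: "h \<in> borel_measurable M" "h \<in> borel_measurable N"
      using borel_measurable_continuous_onI[OF h] M(2) N(2) by (simp_all cong: measurable_cong_sets)
    have "integrable M h"
      by (rule M.integrable_const_bound[where B=B]) (use M(3) B in \<open>auto elim!: AE_mp\<close>)
    moreover have "integrable N h"
      by (rule N.integrable_const_bound[where B=B]) (use N(3) B in \<open>auto elim!: AE_mp\<close>)
    ultimately show ?thesis ..
  qed
  have add_closed: "(\<lambda>z. g z + h z) \<in> S" if "g \<in> S" "h \<in> S" for g h
  proof -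
    have c: "continuous_on UNIV g" "continuous_on UNIV h" using that by (auto simp: S_def)
    have "integrable M (\<lambda>z. g z * (fst z ^ i * snd z ^ j)) \<and> integrable N (\<lambda>z. g z * (fst z ^ i * snd z ^ j))"
      "integrable M (\<lambda>z. h z * (fst z ^ i * snd z ^ j)) \<and> integrable N (\<lambda>z. h z * (fst z ^ i * snd z ^ j))" for i j
      by (rule int, intro continuous_intros c)+
    moreover have "continuous_on UNIV (\<lambda>z. g z + h z)" by (intro continuous_intros c)
    ultimately show ?thesis using that by (simp add: S_def distrib_right)
  qed
  have scale: "(\<lambda>z. a * h z) \<in> S" if "h \<in> S" for a :: real and h
  proof -
    have "continuous_on UNIV (\<lambda>z. a * h z)"
      using that by (intro continuous_intros) (simp add: S_def)
    then show ?thesis using that by (simp add: S_def mult.assoc)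
  qed
  have fst: "(\<lambda>z. fst z * h z) \<in> S" if h: "h \<in> S" for h
  proof -
    have c: "continuous_on UNIV h"
      and eq: "\<And>i j. (LINT z|M. h z * (fst z ^ i * snd z ^ j)) = (LINT z|N. h z * (fst z ^ i * snd z ^ j))"
      using h by (auto simp: S_def)
    have "continuous_on UNIV (\<lambda>z. fst z * h z)" by (intro continuous_intros c)
    moreover have "(LINT z|M. fst z * h z * (fst z ^ i * snd z ^ j)) =
        (LINT z|N. fst z * h z * (fst z ^ i * snd z ^ j))" for i j
      using eq[of "Suc i" j] by (simp add: mult_ac)
    ultimately show ?thesis by (simp add: S_def)
  qed
  have snd: "(\<lambda>z. snd z * h z) \<in> S" if h: "h \<in> S" for h
  proof -
    have c: "continuous_on UNIV h"
      and eq: "\<And>i j. (LINT z|M. h z * (fst z ^ i * snd z ^ j)) = (LINT z|N. h z * (fst z ^ i * snd z ^ j))"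
      using h by (auto simp: S_def)
    have "continuous_on UNIV (\<lambda>z. snd z * h z)" by (intro continuous_intros c)
    moreover have "(LINT z|M. snd z * h z * (fst z ^ i * snd z ^ j)) =
        (LINT z|N. snd z * h z * (fst z ^ i * snd z ^ j))" for i j
      using eq[of i "Suc j"] by (simp add: mult_ac)
    ultimately show ?thesis by (simp add: S_def)
  qed
  have "\<forall>h\<in>S. (\<lambda>z. f z * h z) \<in> S"
    using f
  proof induction
    case (linear f)
    have expand: "f z = fst z * f (1, 0) + snd z * f (0, 1)" for z
    proof -
      have "f z = f (fst z *\<^sub>R (1, 0) + snd z *\<^sub>R (0, 1))" by (cases z) simp
      also have "\<dots> = fst z *\<^sub>R f (1, 0) + snd z *\<^sub>R f (0, 1)"
        by (simp only: linear_add[OF bounded_linear.linear[OF linear]] linear_scale[OF bounded_linear.linear[OF linear]])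
      finally show ?thesis by simp
    qed
    have "f z * h z = f (1, 0) * (fst z * h z) + f (0, 1) * (snd z * h z)" for h z
      by (subst expand) (simp add: algebra_simps)
    then show ?case by (simp only:) (intro ballI add_closed scale fst snd)
  next
    case (const c)
    then show ?case by (intro ballI scale)
  next
    case (add f g)
    then show ?case unfolding distrib_right by (intro ballI add_closed) blast+
  next
    case (mult f g)
    show ?case unfolding mult.assoc
    proof
      fix h assume "h \<in> S"
      then have "(\<lambda>z. g z * h z) \<in> S" using mult.IH(2) by blast
      then show "(\<lambda>z. f z * (g z * h z)) \<in> S" by (rule bspec[OF mult.IH(1)])
    qed
  qed
  moreover have "(\<lambda>_. 1) \<in> S" using mom by (simp add: S_def)
  ultimately have "(\<lambda>z. f z * 1) \<in> S" by (rule bspec)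
  then show ?thesis unfolding S_def by (auto dest!: spec[of _ 0])
qed

text \<open>By the Stone--Weierstrass theorem the integrals of all bounded continuous functions agree. The indicator
of a closed set is a bounded pointwise limit of continuous functions, and the closed sets are an
intersection-stable generator of the Borel sets.\<close>
lemma hausdorff_moment_uniqueness:
  fixes M N :: "(real \<times> real) measure"
  assumes M: "prob_space M" "sets M = sets borel" "AE z in M. z \<in> {0..1} \<times> {0..1}"
    and N: "prob_space N" "sets N = sets borel" "AE z in N. z \<in> {0..1} \<times> {0..1}"
    and mom: "\<And>i j. (LINT z|M. fst z ^ i * snd z ^ j) = (LINT z|N. fst z ^ i * snd z ^ j)"
  shows "M = N"
proof -
  interpret M: prob_space M by fact
  interpret N: prob_space N by fact
  let ?K = "{0..1} \<times> {0..1} :: (real \<times> real) set"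
  have K: "compact ?K" by (intro compact_Times) auto
  have cont: "(LINT z|M. f z) = (LINT z|N. f z)"
    if f: "continuous_on UNIV f" and B: "\<And>z. \<bar>f z\<bar> \<le> B" for f :: "real \<times> real \<Rightarrow> real" and B
  proof -
    have "\<bar>(LINT z|M. f z) - (LINT z|N. f z)\<bar> \<le> 2 * e" if e: "e > 0" for e
    proof -
      obtain g where g: "real_polynomial_function g" and fg: "\<And>z. z \<in> ?K \<Longrightarrow> \<bar>f z - g z\<bar> < e"
        using Stone_Weierstrass_real_polynomial_function[OF K continuous_on_subset[OF f] e] by auto
      have close: "\<bar>(LINT z|L. f z) - (LINT z|L. g z)\<bar> \<le> e"
        if L: "prob_space L" "sets L = sets borel" "AE z in L. z \<in> ?K" for L
      proof -
        interpret L: prob_space L by fact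
        have [measurable]: "f \<in> borel_measurable L" "g \<in> borel_measurable L"
          using borel_measurable_continuous_onI[OF f]
            borel_measurable_continuous_onI[OF continuous_on_polymonial_function[of g UNIV]]
            g L(2) by (simp_all add: real_polynomial_function_eq cong: measurable_cong_sets)
        have f_int: "integrable L f"
          by (rule L.integrable_const_bound[where B=B]) (use B in auto)
        have ae: "AE z in L. \<bar>f z - g z\<bar> \<le> e"
          using L(3) by eventually_elim (simp add: fg less_imp_le)
        have d_int: "integrable L (\<lambda>z. f z - g z)"
          by (rule L.integrable_const_bound[where B=e]) (use ae in auto)
        have "integrable L (\<lambda>z. f z - (f z - g z))" by (intro Bochner_Integration.integrable_diff f_int d_int)
        then have g_int: "integrable L g" by simp
        have "\<bar>LINT z|L. f z - g z\<bar> \<le> (LINT z|L. \<bar>f z - g z\<bar>)" by (rule integral_abs_bound)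
        also have "\<dots> \<le> (LINT z|L. e)"
          by (intro integral_mono_AE integrable_abs d_int ae) simp
        also have "\<dots> = e" by (simp add: L.prob_space)
        finally show ?thesis using f_int g_int by simp
      qed
      show ?thesis
        using close[OF M] close[OF N] real_polynomial_function_integral_eq[OF g M N mom] by linarith
    qed
    from this[of "\<bar>(LINT z|M. f z) - (LINT z|N. f z)\<bar> / 4"]
    have "\<not> 0 < \<bar>(LINT z|M. f z) - (LINT z|N. f z)\<bar>" by auto
    then show ?thesis by simp
  qed
  have closed_eq: "emeasure M C = emeasure N C" if C: "closed C" for C
  proof (cases "C = {}")
    case False
    \<comment> \<open>Continuous functions that decrease to the indicator of \<open>C\<close>.\<close>
    define f where "f n z = max 0 (1 - real n * infdist z C)" for n z
    have f_cont: "continuous_on UNIV (f n)" for n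
      unfolding f_def by (intro continuous_intros)
    have f_bd: "\<bar>f n z\<bar> \<le> 1" for n z by (auto simp: f_def infdist_nonneg)
    have f_lim: "(\<lambda>n. f n z) \<longlonglongrightarrow> indicator C z" for z
    proof (cases "z \<in> C")
      case True
      then show ?thesis by (simp add: f_def)
    next
      case zC: False
      then have pos: "0 < infdist z C"
        using C False by (metis in_closed_iff_infdist_zero infdist_nonneg less_eq_real_def)
      obtain m where m: "1 < real m * infdist z C" using reals_Archimedean3[OF pos] by blast
      have "f n z = 0" if "m \<le> n" for n
      proof -
        have "real m * infdist z C \<le> real n * infdist z C" using that pos by (intro mult_right_mono) auto
        with m show ?thesis by (simp add: f_def)
      qed
      then show ?thesis using zC by (auto intro!: tendsto_eventually eventually_sequentiallyI[of m])
    qed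
    have lim: "(\<lambda>n. LINT z|L. f n z) \<longlonglongrightarrow> measure L C" if L: "prob_space L" "sets L = sets borel" for L
    proof -
      interpret L: prob_space L by fact
      have [measurable]: "f n \<in> borel_measurable L" for n
        using borel_measurable_continuous_onI[OF f_cont] L(2) by (simp cong: measurable_cong_sets)
      have C': "C \<in> sets L" using C L(2) by simp
      have "(\<lambda>n. LINT z|L. f n z) \<longlonglongrightarrow> (LINT z|L. indicator C z)"
        by (rule integral_dominated_convergence[where w="\<lambda>_. 1"]) (use f_lim f_bd C' in auto)
      then show ?thesis using C' by simp
    qed
    have "measure M C = measure N C"
      using lim[OF M(1,2)] lim[OF N(1,2)] cont[OF f_cont f_bd] by (auto intro: LIMSEQ_unique)
    then show ?thesis by (simp add: M.emeasure_eq_measure N.emeasure_eq_measure)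
  qed simp
  show "M = N"
  proof (rule measure_eqI_generator_eq[where \<Omega>=UNIV and E="Collect closed" and A="\<lambda>_. UNIV"])
    show "Int_stable (Collect closed :: (real \<times> real) set set)" by (auto simp: Int_stable_def)
    have "sets borel = sigma_sets UNIV (Collect closed :: (real \<times> real) set set)"
      by (subst borel_eq_closed) simp
    then show "sets M = sigma_sets UNIV (Collect closed)" "sets N = sigma_sets UNIV (Collect closed)"
      using M N by simp_all
    show "emeasure M C = emeasure N C" if "C \<in> Collect closed" for C
      using that closed_eq by simp
    show "emeasure M UNIV \<noteq> \<infinity>" by simp
  qed auto
qed

section \<open>Coefficients of infinitely divisible pairs\<close>

text \<open>Solve the power series for its \<open>j\<close>-th term. The terms after it carry an additional factor \<open>x\<close>.\<close>
lemma power_series_coeff_bound: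
  fixes d :: "nat \<Rightarrow> real"
  assumes sm: "summable (\<lambda>i. \<bar>d i\<bar>)" and B: "(\<Sum>i. \<bar>d i\<bar>) \<le> B" and x: "0 < x" "x \<le> 1"
  shows "\<bar>d j\<bar> \<le> (\<bar>\<Sum>i. d i * x ^ i\<bar> + (\<Sum>i<j. \<bar>d i\<bar>)) / x ^ j + x * B"
proof -
  have le: "\<bar>d i * x ^ i\<bar> \<le> \<bar>d i\<bar>" for i
    using x by (simp add: abs_mult mult_left_le power_le_one)
  have sm_x: "summable (\<lambda>i. d i * x ^ i)"
    by (rule summable_comparison_test'[OF sm]) (use le in auto)
  define R where "R = (\<Sum>i. d (i + Suc j) * x ^ (i + Suc j))"
  have "(\<Sum>i. d i * x ^ i) = R + (\<Sum>i<j. d i * x ^ i) + d j * x ^ j"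
    unfolding R_def using suminf_split_initial_segment[OF sm_x, of "Suc j"] by simp
  moreover have "\<bar>R\<bar> \<le> x ^ Suc j * B"
  proof -
    have sm_tail: "summable (\<lambda>i. \<bar>d (i + Suc j)\<bar>)"
      using sm summable_iff_shift[of "\<lambda>i. \<bar>d i\<bar>" "Suc j"] by blast
    have tail_le: "\<bar>d (i + Suc j) * x ^ (i + Suc j)\<bar> \<le> x ^ Suc j * \<bar>d (i + Suc j)\<bar>" for i
    proof -
      have "x ^ (i + Suc j) \<le> x ^ Suc j" using x by (intro power_decreasing) auto
      then have "\<bar>d (i + Suc j)\<bar> * x ^ (i + Suc j) \<le> \<bar>d (i + Suc j)\<bar> * x ^ Suc j"
        by (rule mult_left_mono) simp
      then show ?thesis using x by (simp add: abs_mult mult.commute)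
    qed
    have sm_abs: "summable (\<lambda>i. \<bar>d (i + Suc j) * x ^ (i + Suc j)\<bar>)"
      by (rule summable_comparison_test'[OF summable_mult[OF sm_tail, of "x ^ Suc j"]]) (use tail_le in auto)
    have "\<bar>R\<bar> \<le> (\<Sum>i. \<bar>d (i + Suc j) * x ^ (i + Suc j)\<bar>)"
      unfolding R_def by (rule summable_rabs[OF sm_abs])
    also have "\<dots> \<le> (\<Sum>i. x ^ Suc j * \<bar>d (i + Suc j)\<bar>)"
      by (intro suminf_le tail_le sm_abs summable_mult sm_tail)
    also have "\<dots> = x ^ Suc j * (\<Sum>i. \<bar>d (i + Suc j)\<bar>)" by (rule suminf_mult[OF sm_tail])
    also have "\<dots> \<le> x ^ Suc j * B"
    proof (rule mult_left_mono)
      have "(\<Sum>i. \<bar>d (i + Suc j)\<bar>) \<le> (\<Sum>i. \<bar>d i\<bar>)"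
        using suminf_split_initial_segment[OF sm, of "Suc j"] sum_nonneg[of "{..<Suc j}" "\<lambda>i. \<bar>d i\<bar>"]
        by linarith
      then show "(\<Sum>i. \<bar>d (i + Suc j)\<bar>) \<le> B" using B by linarith
    qed (use x in simp)
    finally show ?thesis .
  qed
  moreover have "\<bar>\<Sum>i<j. d i * x ^ i\<bar> \<le> (\<Sum>i<j. \<bar>d i\<bar>)"
    by (intro order_trans[OF sum_abs] sum_mono le)
  ultimately have "\<bar>d j * x ^ j\<bar> \<le> \<bar>\<Sum>i. d i * x ^ i\<bar> + (\<Sum>i<j. \<bar>d i\<bar>) + x ^ Suc j * B" by linarith
  then have "\<bar>d j\<bar> \<le> (\<bar>\<Sum>i. d i * x ^ i\<bar> + (\<Sum>i<j. \<bar>d i\<bar>) + x ^ Suc j * B) / x ^ j"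
    using x by (simp add: pos_le_divide_eq abs_mult)
  also have "\<dots> = (\<bar>\<Sum>i. d i * x ^ i\<bar> + (\<Sum>i<j. \<bar>d i\<bar>)) / x ^ j + x * B"
    using x by (simp add: add_divide_distrib)
  finally show ?thesis .
qed

text \<open>If power series with absolutely bounded coefficients tend to \<open>0\<close> pointwise, then so do their
coefficients, one after the other: a small \<open>x\<close> makes the tail harmless, and for this \<open>x\<close> a large \<open>n\<close> makes
the remaining terms small.\<close>
lemma power_series_coeff_tendsto_0:
  fixes d :: "nat \<Rightarrow> nat \<Rightarrow> real"
  assumes sm: "\<And>n. summable (\<lambda>i. \<bar>d n i\<bar>)" and B: "\<And>n. (\<Sum>i. \<bar>d n i\<bar>) \<le> B"
    and lim: "\<And>x. 0 < x \<Longrightarrow> x \<le> 1 \<Longrightarrow> (\<lambda>n. \<Sum>i. d n i * x ^ i) \<longlonglongrightarrow> 0"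
  shows "(\<lambda>n. d n j) \<longlonglongrightarrow> 0"
proof (induction j rule: less_induct)
  case (less j)
  have B0: "0 \<le> B" using suminf_nonneg[OF sm[of 0]] B[of 0] by simp
  show ?case
  proof (rule LIMSEQ_I)
    fix e :: real assume e: "0 < e"
    define x where "x = min 1 (e / (2 * (B + 1)))"
    have x: "0 < x" "x \<le> 1" using e B0 by (auto simp: x_def)
    have xB: "x * B < e / 2"
    proof -
      have "x * (B + 1) \<le> e / (2 * (B + 1)) * (B + 1)"
        unfolding x_def using B0 by (intro mult_right_mono) auto
      also have "\<dots> = e / 2" using B0 by (simp add: field_simps)
      finally show ?thesis using x by (simp add: distrib_left)
    qed
    have "(\<lambda>n. (\<bar>\<Sum>i. d n i * x ^ i\<bar> + (\<Sum>i<j. \<bar>d n i\<bar>)) / x ^ j) \<longlonglongrightarrow> (\<bar>0\<bar> + (\<Sum>i<j. \<bar>0\<bar>)) / x ^ j"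
      by (intro tendsto_intros lim x less.IH) (use x in auto)
    then have "\<forall>\<^sub>F n in sequentially. (\<bar>\<Sum>i. d n i * x ^ i\<bar> + (\<Sum>i<j. \<bar>d n i\<bar>)) / x ^ j < e / 2"
      using e by (intro order_tendstoD) auto
    then obtain N where N: "\<And>n. n \<ge> N \<Longrightarrow> (\<bar>\<Sum>i. d n i * x ^ i\<bar> + (\<Sum>i<j. \<bar>d n i\<bar>)) / x ^ j < e / 2"
      unfolding eventually_sequentially by blast
    have "norm (d n j - 0) < e" if "n \<ge> N" for n
      using power_series_coeff_bound[OF sm B x, of n j] N[OF that] xB
      unfolding real_norm_def diff_0_right by linarith
    then show "\<exists>N. \<forall>n\<ge>N. norm (d n j - 0) < e" by blast
  qed
qed

text \<open>Given \<open>(U, V)\<close>, take independent Poisson variables with means \<open>U\<close> and \<open>V\<close>. The integral is the generating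
function of this pair at \<open>(r x, r)\<close>, and \<open>e n k\<close> is the probability of the value \<open>(k, n - k)\<close>. The
variable \<open>r\<close> collects the terms of total degree \<open>n\<close>, in which \<open>x\<close> separates the individual coefficients.\<close>
lemma (in prob_space) poisson_mixture_expansion:
  assumes [measurable]: "U \<in> borel_measurable M" "V \<in> borel_measurable M"
    and nonneg: "AE w in M. 0 \<le> U w" "AE w in M. 0 \<le> (V w :: real)"
  shows "\<exists>e. (\<forall>n k. 0 \<le> e n k) \<and> (\<forall>x\<in>{0..1}. \<forall>r\<in>{0..1}.
    (\<lambda>n. (\<Sum>k\<le>n. e n k * x ^ k) * r ^ n) sums (LINT w|M. exp (- ((1 - r * x) * U w + (1 - r) * V w))))"
proof -
  define U' where "U' w = max 0 (U w)" for w
  define V' where "V' w = max 0 (V w)" for w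
  have [measurable]: "U' \<in> borel_measurable M" "V' \<in> borel_measurable M"
    unfolding U'_def V'_def by measurable
  have pos: "0 \<le> U' w" "0 \<le> V' w" for w by (auto simp: U'_def V'_def)
  define g where "g n k w = exp (- (U' w + V' w)) * (U' w ^ k / fact k) * (V' w ^ (n - k) / fact (n - k))" for n k w
  have exp_le: "u ^ k / fact k \<le> exp u" if "0 \<le> u" for u :: real and k
  proof -
    have "(\<Sum>i\<in>{k}. u ^ i /\<^sub>R fact i) \<le> exp u"
      unfolding exp_def by (rule sum_le_suminf[OF summable_exp_generic]) (use that in auto)
    then show ?thesis by (simp add: field_simps)
  qed
  have g0: "0 \<le> g n k w" for n k w using pos by (simp add: g_def)
  have g1: "g n k w \<le> 1" for n k w
  proof -
    have "(U' w ^ k / fact k) * (V' w ^ (n - k) / fact (n - k)) \<le> exp (U' w) * exp (V' w)"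
      using pos by (intro mult_mono exp_le) auto
    then have "exp (- (U' w + V' w)) * ((U' w ^ k / fact k) * (V' w ^ (n - k) / fact (n - k)))
        \<le> exp (- (U' w + V' w)) * (exp (U' w) * exp (V' w))"
      by (rule mult_left_mono) simp
    also have "\<dots> = 1" by (simp add: exp_add[symmetric])
    finally show ?thesis by (simp add: g_def mult.assoc)
  qed
  have [measurable]: "g n k \<in> borel_measurable M" for n k unfolding g_def by measurable
  have g_int: "integrable M (g n k)" for n k
    by (rule integrable_const_bound[where B=1]) (use g0 g1 in auto)
  define e where "e n k = (LINT w|M. g n k w)" for n k
  have "0 \<le> e n k" for n k unfolding e_def by (rule Bochner_Integration.integral_nonneg[OF g0])
  moreover have "(\<lambda>n. (\<Sum>k\<le>n. e n k * x ^ k) * r ^ n) sums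
      (LINT w|M. exp (- ((1 - r * x) * U w + (1 - r) * V w)))"
    if x: "x \<in> {0..1}" and r: "r \<in> {0..1}" for x r
  proof -
    let ?h = "\<lambda>w. exp (- ((1 - r * x) * U' w + (1 - r) * V' w))"
    define G where "G n w = (\<Sum>k\<le>n. g n k w * x ^ k) * r ^ n" for n w
    have G_eq: "G n w = exp (- (U' w + V' w)) * ((r * (x * U' w + V' w)) ^ n /\<^sub>R fact n)" for n w
    proof -
      have "(x * U' w + V' w) ^ n / fact n = (\<Sum>k\<le>n. (U' w ^ k / fact k) * (V' w ^ (n - k) / fact (n - k)) * x ^ k)"
        unfolding binomial_ring sum_divide_distrib
        by (intro sum.cong refl) (simp add: binomial_fact power_mult_distrib)
      moreover have "G n w = exp (- (U' w + V' w)) *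
          (\<Sum>k\<le>n. (U' w ^ k / fact k) * (V' w ^ (n - k) / fact (n - k)) * x ^ k) * r ^ n"
        by (simp add: G_def g_def sum_distrib_left mult.assoc)
      ultimately have "G n w = exp (- (U' w + V' w)) * ((x * U' w + V' w) ^ n / fact n) * r ^ n"
        by (simp only:)
      then show ?thesis by (simp add: power_mult_distrib divide_inverse)
    qed
    have G_sums: "(\<lambda>n. G n w) sums ?h w" for w
    proof -
      have "(\<lambda>n. G n w) sums (exp (- (U' w + V' w)) * exp (r * (x * U' w + V' w)))"
        unfolding G_eq by (rule sums_mult[OF exp_converges])
      also have "exp (- (U' w + V' w)) * exp (r * (x * U' w + V' w)) = ?h w"
        by (simp add: exp_add[symmetric] algebra_simps)
      finally show ?thesis .
    qed
    have G0: "0 \<le> G n w" for n w using g0 x r by (auto simp: G_def intro!: mult_nonneg_nonneg sum_nonneg)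
    have h1: "?h w \<le> 1" for w
    proof -
      have "r * x \<le> 1" using x r by (auto intro: mult_le_one)
      then have "0 \<le> (1 - r * x) * U' w + (1 - r) * V' w"
        using pos r by (intro add_nonneg_nonneg mult_nonneg_nonneg) auto
      then show ?thesis by simp
    qed
    have partial: "\<bar>\<Sum>i<n. G i w\<bar> \<le> 1" for n w
    proof -
      have "(\<Sum>i<n. G i w) \<le> ?h w"
        unfolding sums_unique[OF G_sums] by (rule sum_le_suminf[OF sums_summable[OF G_sums]]) (auto simp: G0)
      then have "(\<Sum>i<n. G i w) \<le> 1" by (rule order_trans[OF _ h1])
      then show ?thesis using G0 by (simp add: abs_of_nonneg sum_nonneg)
    qed
    have [measurable]: "G n \<in> borel_measurable M" for n unfolding G_def by measurable
    have "(\<lambda>n. LINT w|M. (\<Sum>i<n. G i w)) \<longlonglongrightarrow> (LINT w|M. ?h w)"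
    proof (rule integral_dominated_convergence[where w="\<lambda>_. 1"])
      show "AE w in M. (\<lambda>n. \<Sum>i<n. G i w) \<longlonglongrightarrow> ?h w" using G_sums by (simp add: sums_def)
    qed (use partial in auto)
    moreover have "(LINT w|M. (\<Sum>i<n. G i w)) = (\<Sum>i<n. (\<Sum>k\<le>i. e i k * x ^ k) * r ^ i)" for n
    proof -
      have "integrable M (G i)" "(LINT w|M. G i w) = (\<Sum>k\<le>i. e i k * x ^ k) * r ^ i" for i
        unfolding G_def e_def using g_int by simp_all
      then show ?thesis by simp
    qed
    ultimately have "(\<lambda>n. (\<Sum>k\<le>n. e n k * x ^ k) * r ^ n) sums (LINT w|M. ?h w)"
      by (simp add: sums_def)
    also have "(LINT w|M. ?h w) = (LINT w|M. exp (- ((1 - r * x) * U w + (1 - r) * V w)))"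
      by (rule integral_cong_AE) (use nonneg in \<open>auto simp: U'_def V'_def\<close>)
    finally show ?thesis .
  qed
  ultimately show ?thesis by blast
qed

text \<open>The derivative of the exponential function at \<open>0\<close>.\<close>
lemma tendsto_scaled_exp:
  fixes a :: "nat \<Rightarrow> real"
  assumes a: "filterlim a at_top sequentially"
  shows "(\<lambda>N. a N * (exp (z / a N) - 1)) \<longlonglongrightarrow> z"
proof (cases "z = 0")
  case False
  have pos: "\<forall>\<^sub>F N in sequentially. 0 < a N"
    using a by (simp add: filterlim_at_top_dense)
  have "((\<lambda>h. (exp h - 1) / h) \<longlongrightarrow> 1) (at (0::real))"
    using DERIV_exp[of "0::real"] by (simp add: has_field_derivative_iff)
  moreover have "filterlim (\<lambda>N. z / a N) (at 0) sequentially"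
    unfolding filterlim_at
  proof
    show "(\<lambda>N. z / a N) \<longlonglongrightarrow> 0"
      by (rule tendsto_divide_0[OF tendsto_const filterlim_at_top_imp_at_infinity[OF a]])
    show "\<forall>\<^sub>F N in sequentially. z / a N \<in> UNIV \<and> z / a N \<noteq> 0"
      using pos by eventually_elim (use False in simp)
  qed
  ultimately have "(\<lambda>N. (exp (z / a N) - 1) / (z / a N)) \<longlonglongrightarrow> 1"
    by (rule filterlim_compose)
  from tendsto_mult[OF tendsto_const this, of z]
  have "(\<lambda>N. z * ((exp (z / a N) - 1) / (z / a N))) \<longlonglongrightarrow> z" by simp
  then show ?thesis
  proof (rule Lim_transform_eventually)
    show "\<forall>\<^sub>F N in sequentially. z * ((exp (z / a N) - 1) / (z / a N)) = a N * (exp (z / a N) - 1)"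
      using pos by eventually_elim (use False in simp)
  qed
qed simp

lemma tendsto_scaled_exp_Suc: "(\<lambda>N. real (Suc N) * (exp (z / real (Suc N)) - 1)) \<longlonglongrightarrow> z"
  by (rule tendsto_scaled_exp) (rule filterlim_compose[OF filterlim_real_sequentially filterlim_Suc])

text \<open>The \<open>(N + 1)\<close>-st root of the Laplace transform is \<open>c N\<close> times \<open>exp (L / (N + 1))\<close>, where \<open>L\<close> is the power
series with coefficients \<open>l\<close>, and it has nonnegative coefficients. Divided by \<open>c N\<close>, reduced by one and
multiplied by \<open>N + 1\<close> it tends to \<open>L\<close>, so that the coefficients of \<open>L\<close> are limits of nonnegative numbers.
The passage from functions to coefficients is made twice, in \<open>r\<close> and then in \<open>x\<close>; in this order the
inner sums are finite, and only the grouping by total degree has to converge absolutely.\<close>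
lemma infinitely_divisible_coefficients_nonneg:
  fixes l :: "nat \<Rightarrow> nat \<Rightarrow> real" and P :: "nat \<Rightarrow> 'a measure" and U V :: "nat \<Rightarrow> 'a \<Rightarrow> real"
  assumes P: "\<And>N. prob_space (P N)"
    and meas: "\<And>N. U N \<in> borel_measurable (P N)" "\<And>N. V N \<in> borel_measurable (P N)"
    and pos: "\<And>N. AE w in P N. 0 \<le> U N w" "\<And>N. AE w in P N. 0 \<le> V N w"
    and l0: "l 0 0 = 0"
    and sm: "\<And>x. x \<in> {0..1} \<Longrightarrow> summable (\<lambda>n. \<bar>\<Sum>k\<le>n. l n k * x ^ k\<bar>)"
    and c: "\<And>N. 0 < c N"
    and eq: "\<And>N x r. x \<in> {0..1} \<Longrightarrow> r \<in> {0..1} \<Longrightarrow>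
      (LINT w|P N. exp (- ((1 - r * x) * U N w + (1 - r) * V N w))) =
        c N * exp ((\<Sum>n. (\<Sum>k\<le>n. l n k * x ^ k) * r ^ n) / real (Suc N))"
    and kn: "k \<le> n"
  shows "0 \<le> l n k"
proof -
  have "\<forall>N. \<exists>e. (\<forall>n k. 0 \<le> e n k) \<and> (\<forall>x\<in>{0..1}. \<forall>r\<in>{0..1}.
    (\<lambda>n. (\<Sum>k\<le>n. e n k * x ^ k) * r ^ n) sums (LINT w|P N. exp (- ((1 - r * x) * U N w + (1 - r) * V N w))))"
    by (intro allI prob_space.poisson_mixture_expansion P meas pos)
  from choice[OF this] obtain e where e': "\<forall>N. (\<forall>n k. 0 \<le> e N n k) \<and> (\<forall>x\<in>{0..1}. \<forall>r\<in>{0..1}.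
    (\<lambda>n. (\<Sum>k\<le>n. e N n k * x ^ k) * r ^ n) sums (LINT w|P N. exp (- ((1 - r * x) * U N w + (1 - r) * V N w))))" ..
  have e0: "0 \<le> e N n k" for N n k using e' by simp
  have e: "(\<lambda>n. (\<Sum>k\<le>n. e N n k * x ^ k) * r ^ n) sums
      (LINT w|P N. exp (- ((1 - r * x) * U N w + (1 - r) * V N w)))" if "x \<in> {0..1}" "r \<in> {0..1}" for N x r
  proof -
    note * = conjunct2[OF spec[OF e', of N]]
    show ?thesis by (rule bspec[OF bspec[OF * that(1)] that(2)])
  qed
  define L where "L x r = (\<Sum>n. (\<Sum>k\<le>n. l n k * x ^ k) * r ^ n)" for x r
  \<comment> \<open>The coefficients of \<open>N + 1\<close> times the normalised root, which differ from those of the quantity that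
    tends to \<open>L\<close> only in degree \<open>0\<close>.\<close>
  define f where "f N n k = real (Suc N) * (e N n k / c N)" for N n k
  have f0: "0 \<le> f N n k" for N n k using e0 c[of N] by (simp add: f_def)
  have e00: "e N 0 0 = c N" for N
  proof -
    have "(\<lambda>n. (\<Sum>k\<le>n. e N n k * 0 ^ k) * 0 ^ n) sums (c N * exp (L 0 0 / real (Suc N)))"
      using e[of 0 0 N] eq[of 0 0 N] by (simp add: L_def)
    moreover have "L 0 0 = 0" unfolding L_def powser_zero by (simp add: l0)
    moreover have "(\<lambda>n. (\<Sum>k\<le>n. e N n k * 0 ^ k) * 0 ^ n) sums (e N 0 0)"
      using powser_sums_zero[of "\<lambda>n. \<Sum>k\<le>n. e N n k * 0 ^ k"] by simp
    ultimately show ?thesis by (auto dest: sums_unique2)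
  qed
  have fsums: "(\<lambda>n. (\<Sum>k\<le>n. f N n k * x ^ k) * r ^ n - (if n = 0 then real (Suc N) else 0)) sums
      (real (Suc N) * (exp (L x r / real (Suc N)) - 1))" if "x \<in> {0..1}" "r \<in> {0..1}" for N x r
  proof -
    have "(\<lambda>n. real (Suc N) / c N * ((\<Sum>k\<le>n. e N n k * x ^ k) * r ^ n)) sums
        (real (Suc N) / c N * (c N * exp (L x r / real (Suc N))))"
      using sums_mult[OF e[OF that, of N]] unfolding eq[OF that] L_def .
    also have "real (Suc N) / c N * (c N * exp (L x r / real (Suc N))) = real (Suc N) * exp (L x r / real (Suc N))"
      using c[of N] by (simp del: of_nat_Suc)
    also have "(\<lambda>n. real (Suc N) / c N * ((\<Sum>k\<le>n. e N n k * x ^ k) * r ^ n)) =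
        (\<lambda>n. (\<Sum>k\<le>n. f N n k * x ^ k) * r ^ n)"
      by (simp add: f_def sum_distrib_left sum_distrib_right mult_ac del: of_nat_Suc)
    finally have "(\<lambda>n. (\<Sum>k\<le>n. f N n k * x ^ k) * r ^ n) sums (real (Suc N) * exp (L x r / real (Suc N)))" .
    from sums_diff[OF this sums_single[of 0 "\<lambda>_. real (Suc N)"]] show ?thesis
      by (simp add: right_diff_distrib del: of_nat_Suc)
  qed
  \<comment> \<open>Convergence of the homogeneous parts, from the variable \<open>r\<close>.\<close>
  have hom: "(\<lambda>N. (\<Sum>k\<le>n. f N n k * x ^ k) - (if n = 0 then real (Suc N) else 0)) \<longlonglongrightarrow> (\<Sum>k\<le>n. l n k * x ^ k)"
    if x: "x \<in> {0..1}" for x n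
  proof -
    define F where "F N n = (\<Sum>k\<le>n. f N n k * x ^ k) - (if n = 0 then real (Suc N) else 0)" for N n
    define d where "d N n = F N n - (\<Sum>k\<le>n. l n k * x ^ k)" for N n
    have F0: "0 \<le> F N n" for N n
    proof (cases "n = 0")
      case True
      then show ?thesis using e00[of N] c[of N] by (simp add: F_def f_def del: of_nat_Suc)
    next
      case False
      then show ?thesis using x f0 by (auto simp: F_def intro!: sum_nonneg mult_nonneg_nonneg)
    qed
    have Fsums: "(\<lambda>n. F N n * r ^ n) sums (real (Suc N) * (exp (L x r / real (Suc N)) - 1))"
      if r: "r \<in> {0..1}" for N r
    proof -
      have "F N n * r ^ n = (\<Sum>k\<le>n. f N n k * x ^ k) * r ^ n - (if n = 0 then real (Suc N) else 0)" for n
        by (simp add: F_def left_diff_distrib)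
      then show ?thesis using fsums[OF x r, of N] by simp
    qed
    have Fsums1: "F N sums (real (Suc N) * (exp (L x 1 / real (Suc N)) - 1))" for N
      using Fsums[of 1 N] by simp
    have lsums: "summable (\<lambda>n. (\<Sum>k\<le>n. l n k * x ^ k) * r ^ n)" if r: "r \<in> {0..1}" for r
      using r by (intro summable_comparison_test'[OF sm[OF x]])
        (auto simp: abs_mult power_le_one intro!: mult_left_le)
    obtain B1 where B1: "\<And>N. \<bar>real (Suc N) * (exp (L x 1 / real (Suc N)) - 1)\<bar> \<le> B1"
      using convergent_imp_Bseq[OF convergentI[OF tendsto_scaled_exp_Suc[of "L x 1"]]]
      by (auto simp: Bseq_def)
    let ?B2 = "\<Sum>n. \<bar>\<Sum>k\<le>n. l n k * x ^ k\<bar>"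
    have d_le: "\<bar>d N n\<bar> \<le> F N n + \<bar>\<Sum>k\<le>n. l n k * x ^ k\<bar>" for N n
      using F0[of N n] unfolding d_def by linarith
    have sm_le: "summable (\<lambda>n. F N n + \<bar>\<Sum>k\<le>n. l n k * x ^ k\<bar>)" for N
      by (intro summable_add sums_summable[OF Fsums1] sm x)
    have sm_d: "summable (\<lambda>n. \<bar>d N n\<bar>)" for N
      by (rule summable_comparison_test'[OF sm_le]) (use d_le in auto)
    have "(\<Sum>n. \<bar>d N n\<bar>) \<le> B1 + ?B2" for N
    proof -
      have "(\<Sum>n. \<bar>d N n\<bar>) \<le> (\<Sum>n. F N n + \<bar>\<Sum>k\<le>n. l n k * x ^ k\<bar>)"
        by (intro suminf_le d_le sm_d sm_le)
      also have "\<dots> = (\<Sum>n. F N n) + ?B2"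
        by (rule suminf_add[symmetric]) (intro sums_summable[OF Fsums1] sm x)+
      finally show ?thesis using B1[of N] sums_unique[OF Fsums1[of N]] by linarith
    qed
    moreover have "(\<lambda>N. \<Sum>n. d N n * r ^ n) \<longlonglongrightarrow> 0" if r: "0 < r" "r \<le> 1" for r
    proof -
      have r': "r \<in> {0..1}" using r by simp
      have "(\<Sum>n. d N n * r ^ n) = real (Suc N) * (exp (L x r / real (Suc N)) - 1) - L x r" for N
        using sums_diff[OF Fsums[OF r', of N] summable_sums[OF lsums[OF r']]]
        by (simp add: d_def L_def left_diff_distrib sums_iff)
      then show ?thesis
        using tendsto_diff[OF tendsto_scaled_exp_Suc[of "L x r"] tendsto_const[of "L x r"]] by simp
    qed
    ultimately have "(\<lambda>N. d N n) \<longlonglongrightarrow> 0"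
      by (intro power_series_coeff_tendsto_0[of d] sm_d) auto
    from tendsto_add[OF this tendsto_const[of "\<Sum>k\<le>n. l n k * x ^ k"]] show ?thesis
      by (simp add: d_def F_def)
  qed
  show ?thesis
  proof (cases "n = 0")
    case True
    then show ?thesis using kn l0 by simp
  next
    case n: False
    \<comment> \<open>Convergence of the coefficients of one homogeneous part, from the variable \<open>x\<close>.\<close>
    define d where "d N k = (if k \<le> n then f N n k - l n k else 0)" for N k
    have sums_fin: "(\<Sum>k. g (d N k) k) = (\<Sum>k\<le>n. g (d N k) k)" if "\<And>k. g 0 k = 0" for g :: "real \<Rightarrow> nat \<Rightarrow> real" and N
      using that by (intro suminf_finite) (auto simp: d_def)
    obtain B1 where B1: "\<And>N. \<bar>\<Sum>k\<le>n. f N n k\<bar> \<le> B1"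
      using convergent_imp_Bseq[OF convergentI[OF hom[of 1 n]]] n by (auto simp: Bseq_def)
    have "(\<Sum>k. \<bar>d N k\<bar>) \<le> B1 + (\<Sum>k\<le>n. \<bar>l n k\<bar>)" for N
    proof -
      have "(\<Sum>k. \<bar>d N k\<bar>) = (\<Sum>k\<le>n. \<bar>d N k\<bar>)" by (rule sums_fin[of "\<lambda>y _. \<bar>y\<bar>"]) simp
      also have "\<dots> \<le> (\<Sum>k\<le>n. f N n k + \<bar>l n k\<bar>)"
      proof (rule sum_mono)
        fix k assume "k \<in> {..n}"
        then show "\<bar>d N k\<bar> \<le> f N n k + \<bar>l n k\<bar>" using f0[of N n k] by (simp add: d_def)
      qed
      finally show ?thesis using B1[of N] by (simp add: sum.distrib)
    qed
    moreover have "summable (\<lambda>k. \<bar>d N k\<bar>)" for N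
      by (rule summable_finite[of "{..n}"]) (auto simp: d_def)
    moreover have "(\<lambda>N. \<Sum>k. d N k * x ^ k) \<longlonglongrightarrow> 0" if x: "0 < x" "x \<le> 1" for x
    proof -
      have "(\<Sum>k. d N k * x ^ k) = (\<Sum>k\<le>n. f N n k * x ^ k) - (\<Sum>k\<le>n. l n k * x ^ k)" for N
        unfolding sums_fin[of "\<lambda>y k. y * x ^ k", simplified]
        by (simp add: d_def left_diff_distrib sum_subtractf)
      then show ?thesis
        using tendsto_diff[OF hom[of x n] tendsto_const[of "\<Sum>k\<le>n. l n k * x ^ k"]] x n by simp
    qed
    ultimately have "(\<lambda>N. d N k) \<longlonglongrightarrow> 0"
      by (intro power_series_coeff_tendsto_0[of d]) auto
    from tendsto_add[OF this tendsto_const[of "l n k"]] have "(\<lambda>N. f N n k) \<longlonglongrightarrow> l n k"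
      using kn by (simp add: d_def)
    then show ?thesis by (rule LIMSEQ_le_const) (use f0 in auto)
  qed
qed

text \<open>The summands of a nonnegative pair are nonnegative: if one coordinate were negative with positive
probability, then by independence all \<open>n\<close> summands would be negative there at the same time with
positive probability, and so would be their sum. Hence their Laplace
transform exists, and by independence it is an \<open>n\<close>-th root.\<close>
lemma infinitely_divisible_root:
  fixes Y :: "'w \<Rightarrow> real \<times> real"
  assumes M: "prob_space M" and id: "infinitely_divisible M Y" and n: "1 \<le> n"
    and pos: "AE w in M. 0 \<le> fst (Y w)" "AE w in M. 0 \<le> snd (Y w)"
  shows "\<exists>P :: (real \<times> real) measure. prob_space P \<and> sets P = sets borel \<and>
    (AE z in P. 0 \<le> fst z) \<and> (AE z in P. 0 \<le> snd z) \<and>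
    (\<forall>x\<ge>0. \<forall>y\<ge>0. (LINT z|P. exp (- (x * fst z + y * snd z))) ^ n = (LINT w|M. exp (- (x * fst (Y w) + y * snd (Y w)))))"
proof -
  have Y [measurable]: "Y \<in> borel_measurable M" using id by (simp add: infinitely_divisible_def)
  obtain N :: "(nat \<Rightarrow> real \<times> real) measure" and Z where N: "prob_space N"
    and indep: "prob_space.indep_vars N (\<lambda>_. borel) Z {..<n}"
    and iid: "\<And>i j. i < n \<Longrightarrow> j < n \<Longrightarrow> distr N borel (Z i) = distr N borel (Z j)"
    and sumZ: "distr N borel (\<lambda>w. \<Sum>i<n. Z i w) = distr M borel Y"
    using conjunct2[OF iffD1[OF infinitely_divisible_def id], rule_format, OF n] by (elim exE conjE) blast
  interpret N: prob_space N by fact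
  interpret M: prob_space M by fact
  have "0 \<in> {..<n}" using n by simp
  then have n0: "{..<n} \<noteq> {}" by blast
  have Z: "Z i \<in> borel_measurable N" if "i < n" for i
    using indep that unfolding N.indep_vars_def by simp
  have sumZ_meas: "(\<lambda>w. \<Sum>i<n. Z i w) \<in> borel_measurable N"
    using Z by (intro borel_measurable_sum) simp
  define P where "P = distr N borel (Z 0)"
  have P: "distr N borel (Z i) = P" if "i < n" for i
    unfolding P_def using that n by (intro iid) auto
  have P_prob: "prob_space P" unfolding P_def using n by (intro N.prob_space_distr Z) simp
  interpret P: prob_space P by fact
  have sets_P: "sets P = sets borel" by (simp add: P_def)
  have halfspace: "AE z in P. 0 \<le> f z" if f: "bounded_linear f" and fY: "AE w in M. 0 \<le> f (Y w)" for f :: "real \<times> real \<Rightarrow> real"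
  proof -
    let ?A = "{z. f z < 0}"
    have f_cont: "continuous_on UNIV f" by (rule linear_continuous_on[OF f])
    have f_meas [measurable]: "f \<in> borel_measurable borel" by (rule borel_measurable_continuous_onI[OF f_cont])
    have A: "?A \<in> sets borel" by measurable
    have A': "?A \<in> sets P" using A sets_P by simp
    have "measure P ?A ^ n = (\<Prod>i<n. N.prob (Z i -` ?A \<inter> space N))"
    proof -
      have "N.prob (Z i -` ?A \<inter> space N) = measure P ?A" if "i < n" for i
        unfolding P[OF that, symmetric] using measure_distr[OF Z[OF that] A] by simp
      then show ?thesis by simp
    qed
    also have "\<dots> = N.prob (\<Inter>i<n. Z i -` ?A \<inter> space N)"
      using n0 A by (intro N.indep_varsD[OF indep, symmetric]) auto
    also have "\<dots> \<le> N.prob ((\<lambda>w. \<Sum>i<n. Z i w) -` ?A \<inter> space N)"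
    proof (rule N.finite_measure_mono)
      show "(\<Inter>i<n. Z i -` ?A \<inter> space N) \<subseteq> (\<lambda>w. \<Sum>i<n. Z i w) -` ?A \<inter> space N"
      proof
        fix w assume w: "w \<in> (\<Inter>i<n. Z i -` ?A \<inter> space N)"
        then have neg: "i < n \<Longrightarrow> f (Z i w) < 0" for i by blast
        have "w \<in> space N" using w n0 by blast
        have "f (\<Sum>i<n. Z i w) = (\<Sum>i<n. f (Z i w))"
          by (rule linear_sum[OF bounded_linear.linear[OF f]])
        also have "\<dots> < (\<Sum>i<n. 0)"
        proof (rule sum_strict_mono)
          show "{..<n} \<noteq> {}" by (rule n0)
        qed (use neg in auto)
        finally show "w \<in> (\<lambda>w. \<Sum>i<n. Z i w) -` ?A \<inter> space N" using \<open>w \<in> space N\<close> by simp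
      qed
      show "(\<lambda>w. \<Sum>i<n. Z i w) -` ?A \<inter> space N \<in> N.events" by (rule measurable_sets[OF sumZ_meas A])
    qed
    also have "\<dots> = measure (distr N borel (\<lambda>w. \<Sum>i<n. Z i w)) ?A"
      by (rule measure_distr[OF sumZ_meas A, symmetric])
    also have "\<dots> = M.prob (Y -` ?A \<inter> space M)"
      unfolding sumZ by (rule measure_distr[OF Y A])
    also have "\<dots> = 0"
    proof -
      have "AE w in M. w \<notin> Y -` ?A \<inter> space M" using fY by eventually_elim simp
      then show ?thesis using M.prob_eq_0[OF measurable_sets[OF Y A]] by simp
    qed
    finally have "measure P ?A ^ n \<le> 0" .
    then have "\<not> 0 < measure P ?A" using zero_less_power[of "measure P ?A" n] by linarith
    then have "measure P ?A = 0" by (simp add: zero_less_measure_iff)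
    then have "?A \<in> null_sets P" using A' by (simp add: P.emeasure_eq_measure null_sets_def)
    then show ?thesis by (rule AE_I') auto
  qed
  have posP: "AE z in P. 0 \<le> fst z" "AE z in P. 0 \<le> snd z"
    using halfspace[OF bounded_linear_fst] halfspace[OF bounded_linear_snd] pos by auto
  have "(LINT z|P. exp (- (x * fst z + y * snd z))) ^ n = (LINT w|M. exp (- (x * fst (Y w) + y * snd (Y w))))"
    if xy: "0 \<le> x" "0 \<le> y" for x y
  proof -
    let ?f = "\<lambda>z :: real \<times> real. exp (- (x * fst z + y * snd z))"
    have f_meas: "?f \<in> borel_measurable borel" by (intro borel_measurable_continuous_onI continuous_intros)
    have f_int: "integrable P ?f"
    proof (rule P.integrable_const_bound[where B=1])
      show "AE z in P. norm (?f z) \<le> 1" using posP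
      proof eventually_elim
        fix z :: "real \<times> real" assume "0 \<le> fst z" "0 \<le> snd z"
        then have "0 \<le> x * fst z + y * snd z" using xy by (intro add_nonneg_nonneg mult_nonneg_nonneg)
        then show "norm (?f z) \<le> 1" by simp
      qed
      show "?f \<in> borel_measurable P" using f_meas sets_P by (simp cong: measurable_cong_sets)
    qed
    have intZ: "integrable N (\<lambda>w. ?f (Z i w))" "(LINT w|N. ?f (Z i w)) = (LINT z|P. ?f z)" if "i < n" for i
      using f_int integrable_distr_eq[OF Z[OF that] f_meas] integral_distr[OF Z[OF that] f_meas]
      by (simp_all add: P[OF that])
    have "(LINT w|M. ?f (Y w)) = (LINT w|N. ?f (\<Sum>i<n. Z i w))"
      using integral_distr[OF Y f_meas] integral_distr[OF sumZ_meas f_meas] by (simp add: sumZ)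
    also have "\<dots> = (LINT w|N. (\<Prod>i<n. ?f (Z i w)))"
      by (simp add: exp_sum[symmetric] fst_sum snd_sum sum_distrib_left sum.distrib sum_negf sum_subtractf)
    also have "\<dots> = (\<Prod>i<n. LINT w|N. ?f (Z i w))"
    proof (rule N.indep_vars_lebesgue_integral)
      show "N.indep_vars (\<lambda>_. borel) (\<lambda>i w. ?f (Z i w)) {..<n}"
        by (rule N.indep_vars_compose2[OF indep f_meas])
    qed (use intZ in auto)
    also have "\<dots> = (\<Prod>i<n. LINT z|P. ?f z)" by (rule prod.cong[OF refl]) (rule intZ, simp)
    also have "\<dots> = (LINT z|P. ?f z) ^ n" by simp
    finally show ?thesis by simp
  qed
  then show ?thesis using P_prob sets_P posP by blast
qed

section \<open>Infinite divisibility from roots of moments\<close>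

lemma iid_sequence:
  fixes P :: "'a measure"
  assumes P: "prob_space P" and n: "1 \<le> n"
  defines "G \<equiv> PiM {..<n :: nat} (\<lambda>_. P)"
  shows "prob_space G" and "prob_space.indep_vars G (\<lambda>_. P) (\<lambda>i \<omega>. \<omega> i) {..<n}"
    and "\<And>i. i < n \<Longrightarrow> distr G P (\<lambda>\<omega>. \<omega> i) = P"
proof -
  show G: "prob_space G" unfolding G_def by (rule prob_space_PiM[OF P])
  interpret G: prob_space G by (rule G)
  show dist: "distr G P (\<lambda>\<omega>. \<omega> i) = P" if "i < n" for i
    unfolding G_def using that by (intro distr_PiM_component P) auto
  have "0 \<in> {..<n}" using n by simp
  then have ne: "{..<n} \<noteq> {}" by blast
  have meas: "(\<lambda>\<omega>. \<omega> i) \<in> G \<rightarrow>\<^sub>M P" if "i \<in> {..<n}" for i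
    unfolding G_def using that by (rule measurable_component_singleton)
  have "distr G (PiM {..<n} (\<lambda>_. P)) (\<lambda>\<omega>. \<lambda>i\<in>{..<n}. \<omega> i) = distr G G (\<lambda>\<omega>. \<omega>)"
    by (rule distr_cong) (auto simp: G_def space_PiM PiE_def extensional_restrict)
  also have "\<dots> = PiM {..<n} (\<lambda>_. P)" by (simp add: G_def)
  also have "\<dots> = PiM {..<n} (\<lambda>i. distr G P (\<lambda>\<omega>. \<omega> i))"
    by (intro PiM_cong refl) (simp add: dist)
  finally show "G.indep_vars (\<lambda>_. P) (\<lambda>i \<omega>. \<omega> i) {..<n}"
    using G.indep_vars_iff_distr_eq_PiM'[OF ne meas] by simp
qed

text \<open>The coordinatewise product of \<open>n\<close> independent points with law \<open>P\<close> has the moments of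
\<open>(exp (- Y\<^sub>1), exp (- Y\<^sub>2))\<close>, hence its law, and the negative logarithm turns the product into a sum.\<close>
lemma infinitely_divisibleI_moments:
  fixes Y :: "'w \<Rightarrow> real \<times> real"
  assumes M: "prob_space M" and Y: "Y \<in> borel_measurable M"
    and pos: "\<And>w. 0 \<le> fst (Y w)" "\<And>w. 0 \<le> snd (Y w)"
    and root: "\<And>n. 1 \<le> n \<Longrightarrow> \<exists>P :: (real \<times> real) measure. prob_space P \<and> sets P = sets borel \<and>
      (AE z in P. z \<in> {0..1} \<times> {0..1}) \<and>
      (\<forall>i j. (LINT z|P. fst z ^ i * snd z ^ j) ^ n =
        (LINT w|M. exp (- (real i * fst (Y w) + real j * snd (Y w)))))"
  shows "infinitely_divisible M Y"
  unfolding infinitely_divisible_def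
proof (intro conjI allI impI Y)
  fix n :: nat assume n: "1 \<le> n"
  interpret M: prob_space M by fact
  let ?K = "{0..1} \<times> {0..1} :: (real \<times> real) set"
  have K: "closed ?K" by (intro closed_Times) auto
  obtain P :: "(real \<times> real) measure" where P: "prob_space P" and sets_P: "sets P = sets borel"
    and PK: "AE z in P. z \<in> ?K"
    and mom: "\<And>i j. (LINT z|P. fst z ^ i * snd z ^ j) ^ n =
        (LINT w|M. exp (- (real i * fst (Y w) + real j * snd (Y w))))"
    using root[OF n] by (elim exE conjE) blast
  interpret P: prob_space P by fact
  define G where "G = PiM {..<n} (\<lambda>_. P)"
  note iid = iid_sequence[OF P n, folded G_def]
  interpret G: prob_space G by (rule iid)
  define g where "g z = (- ln (fst z), - ln (snd z))" for z :: "real \<times> real"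
  have g_meas: "g \<in> borel_measurable borel"
    unfolding g_def[abs_def] by (intro borel_measurable_Pair borel_measurable_uminus
      borel_measurable_ln borel_measurable_continuous_onI[OF continuous_on_fst]
      borel_measurable_continuous_onI[OF continuous_on_snd] continuous_on_id)
  have comp: "(\<lambda>\<omega>. \<omega> i) \<in> G \<rightarrow>\<^sub>M borel" if "i < n" for i
    using measurable_component_singleton[of i "{..<n}" "\<lambda>_. P"] that sets_P
    by (simp add: G_def cong: measurable_cong_sets)
  have distG: "distr G borel (\<lambda>\<omega>. \<omega> i) = P" if "i < n" for i
    using iid(3)[OF that] sets_P by (simp cong: distr_cong)
  have GK: "AE \<omega> in G. \<forall>i<n. \<omega> i \<in> ?K"
  proof -
    have "AE \<omega> in G. \<omega> i \<in> ?K" if "i < n" for i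
      unfolding G_def using AE_PiM_component[of "{..<n}" "\<lambda>_. P" i "\<lambda>z. z \<in> ?K"] P that PK by simp
    then have "AE \<omega> in G. \<forall>i\<in>{..<n}. \<omega> i \<in> ?K" by (intro AE_finite_allI) auto
    then show ?thesis by (rule eventually_mono) simp
  qed
  define W where "W \<omega> = (\<Prod>i<n. fst (\<omega> i), \<Prod>i<n. snd (\<omega> i))" for \<omega> :: "nat \<Rightarrow> real \<times> real"
  define E where "E w = (exp (- fst (Y w)), exp (- snd (Y w)))" for w
  have fst_meas: "fst \<in> borel_measurable (borel :: (real \<times> real) measure)"
    and snd_meas: "snd \<in> borel_measurable (borel :: (real \<times> real) measure)"
    by (intro borel_measurable_continuous_onI continuous_intros)+
  have W_meas: "W \<in> borel_measurable G"
    unfolding W_def[abs_def]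
    by (intro borel_measurable_Pair borel_measurable_prod)
      (auto intro: measurable_compose[OF comp fst_meas] measurable_compose[OF comp snd_meas])
  have E_meas: "E \<in> borel_measurable M"
  proof -
    have "(\<lambda>z :: real \<times> real. (exp (- fst z), exp (- snd z))) \<in> borel_measurable borel"
      by (intro borel_measurable_continuous_onI continuous_intros)
    from measurable_compose[OF Y this] show ?thesis by (simp add: E_def[abs_def])
  qed
  have mono_meas: "(\<lambda>z :: real \<times> real. fst z ^ i * snd z ^ j) \<in> borel_measurable borel" for i j
    by (intro borel_measurable_continuous_onI continuous_intros)
  have law: "distr G borel W = distr M borel E"
  proof (rule hausdorff_moment_uniqueness)
    show "prob_space (distr G borel W)" "prob_space (distr M borel E)"
      by (intro G.prob_space_distr M.prob_space_distr W_meas E_meas)+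
    have sK: "{z \<in> space borel. z \<in> ?K} \<in> sets (borel :: (real \<times> real) measure)"
      using K by (simp add: borel_closed)
    show "AE z in distr G borel W. z \<in> ?K"
      unfolding AE_distr_iff[OF W_meas sK]
      using GK by eventually_elim (auto simp: W_def mem_Times_iff intro!: prod_nonneg prod_le_1)
    show "AE z in distr M borel E. z \<in> ?K"
      unfolding AE_distr_iff[OF E_meas sK] using pos by (auto simp: E_def)
    fix i j
    have pint: "integrable P (\<lambda>z. fst z ^ i * snd z ^ j)"
    proof (rule P.integrable_const_bound[where B=1])
      show "AE z in P. norm (fst z ^ i * snd z ^ j) \<le> 1"
        using PK by eventually_elim (auto simp: abs_mult power_abs intro!: mult_le_one power_le_one)
      show "(\<lambda>z. fst z ^ i * snd z ^ j) \<in> borel_measurable P"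
        using mono_meas sets_P by (simp cong: measurable_cong_sets)
    qed
    have cint: "integrable G (\<lambda>\<omega>. fst (\<omega> l) ^ i * snd (\<omega> l) ^ j)"
      "(LINT \<omega>|G. fst (\<omega> l) ^ i * snd (\<omega> l) ^ j) = (LINT z|P. fst z ^ i * snd z ^ j)" if "l < n" for l
      using pint integrable_distr_eq[OF comp[OF that] mono_meas] integral_distr[OF comp[OF that] mono_meas]
      by (simp_all add: distG[OF that])
    have "(LINT z|distr G borel W. fst z ^ i * snd z ^ j) = (LINT \<omega>|G. (\<Prod>l<n. fst (\<omega> l) ^ i * snd (\<omega> l) ^ j))"
      by (subst integral_distr[OF W_meas mono_meas]) (simp add: W_def prod_power_distrib prod.distrib)
    also have "\<dots> = (\<Prod>l<n. LINT \<omega>|G. fst (\<omega> l) ^ i * snd (\<omega> l) ^ j)"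
    proof (rule G.indep_vars_lebesgue_integral)
      show "G.indep_vars (\<lambda>_. borel) (\<lambda>l \<omega>. fst (\<omega> l) ^ i * snd (\<omega> l) ^ j) {..<n}"
        by (rule G.indep_vars_compose2[OF iid(2)])
          (use mono_meas sets_P in \<open>simp cong: measurable_cong_sets\<close>)
    qed (use cint in auto)
    also have "\<dots> = (LINT z|P. fst z ^ i * snd z ^ j) ^ n" by (simp add: cint)
    also have "\<dots> = (LINT z|distr M borel E. fst z ^ i * snd z ^ j)"
    proof -
      have "exp (- (real i * a + real j * b)) = exp (- a) ^ i * exp (- b) ^ j" for a b :: real
        by (simp add: exp_of_nat_mult[symmetric] exp_add[symmetric])
      then show ?thesis
        unfolding mom by (subst integral_distr[OF E_meas mono_meas]) (simp add: E_def)
    qed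
    finally show "(LINT z|distr G borel W. fst z ^ i * snd z ^ j) = (LINT z|distr M borel E. fst z ^ i * snd z ^ j)" .
  qed simp_all
  \<comment> \<open>On the coordinate axes the logarithm is not the inverse of the exponential function; the law of
    \<open>W\<close> does not charge them because it is the law of \<open>E\<close>.\<close>
  have Wpos: "AE \<omega> in G. 0 < fst (W \<omega>) \<and> 0 < snd (W \<omega>)"
  proof -
    have "open {z :: real \<times> real. 0 < fst z \<and> 0 < snd z}"
      by (intro open_Collect_conj open_Collect_less continuous_intros)
    then have s: "{z \<in> space borel. 0 < fst z \<and> 0 < snd z} \<in> sets (borel :: (real \<times> real) measure)"
      by (simp add: borel_open)
    have "AE z in distr M borel E. 0 < fst z \<and> 0 < snd z"
      unfolding AE_distr_iff[OF E_meas s] by (simp add: E_def)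
    then show ?thesis unfolding law[symmetric] AE_distr_iff[OF W_meas s] .
  qed
  have sum_meas: "(\<lambda>\<omega>. \<Sum>i<n. g (\<omega> i)) \<in> borel_measurable G"
    by (intro borel_measurable_sum) (auto intro: measurable_compose[OF comp g_meas])
  have "distr G borel (\<lambda>\<omega>. \<Sum>i<n. g (\<omega> i)) = distr G borel (\<lambda>\<omega>. g (W \<omega>))"
  proof (rule distr_cong_AE)
    show "AE \<omega> in G. (\<Sum>i<n. g (\<omega> i)) = g (W \<omega>)"
      using Wpos
    proof eventually_elim
      fix \<omega> assume \<omega>: "0 < fst (W \<omega>) \<and> 0 < snd (W \<omega>)"
      have nz: "fst (\<omega> i) \<noteq> 0" "snd (\<omega> i) \<noteq> 0" if "i < n" for i
      proof -
        have "0 < (\<Prod>i<n. fst (\<omega> i))" "0 < (\<Prod>i<n. snd (\<omega> i))" using \<omega> by (simp_all add: W_def)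
        then have "(\<Prod>i<n. fst (\<omega> i)) \<noteq> 0" "(\<Prod>i<n. snd (\<omega> i)) \<noteq> 0" by linarith+
        then show "fst (\<omega> i) \<noteq> 0" "snd (\<omega> i) \<noteq> 0" using that by auto
      qed
      have "ln (\<Prod>i<n. fst (\<omega> i)) = (\<Sum>i<n. ln (fst (\<omega> i)))"
        "ln (\<Prod>i<n. snd (\<omega> i)) = (\<Sum>i<n. ln (snd (\<omega> i)))"
        by (auto intro!: ln_prod simp: nz)
      then show "(\<Sum>i<n. g (\<omega> i)) = g (W \<omega>)"
        by (intro prod_eqI) (simp_all add: g_def W_def fst_sum snd_sum sum_negf)
    qed
  qed (use sum_meas measurable_compose[OF W_meas g_meas] in auto)
  also have "\<dots> = distr (distr M borel E) borel g"
    unfolding law[symmetric] by (subst distr_distr[OF g_meas W_meas]) (simp add: comp_def)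
  also have "\<dots> = distr M borel Y"
    by (subst distr_distr[OF g_meas E_meas]) (simp add: comp_def g_def E_def)
  finally have sum_law: "distr G borel (\<lambda>\<omega>. \<Sum>i<n. g (\<omega> i)) = distr M borel Y" .
  show "\<exists>(N :: (nat \<Rightarrow> real \<times> real) measure) Z. prob_space N \<and>
        prob_space.indep_vars N (\<lambda>_. borel) Z {..<n} \<and>
        (\<forall>i<n. \<forall>j<n. distr N borel (Z i) = distr N borel (Z j)) \<and>
        distr N borel (\<lambda>w. \<Sum>i<n. Z i w) = distr M borel Y"
  proof (intro exI conjI)
    show "prob_space G" by (rule iid)
    show "G.indep_vars (\<lambda>_. borel) (\<lambda>i \<omega>. g (\<omega> i)) {..<n}"
      by (rule G.indep_vars_compose2[OF iid(2)])
        (use g_meas sets_P in \<open>simp cong: measurable_cong_sets\<close>)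
    show "\<forall>i<n. \<forall>j<n. distr G borel (\<lambda>\<omega>. g (\<omega> i)) = distr G borel (\<lambda>\<omega>. g (\<omega> j))"
    proof -
      have "distr G borel (\<lambda>\<omega>. g (\<omega> i)) = distr P borel g" if "i < n" for i
        using distr_distr[OF g_meas comp[OF that]] by (simp add: comp_def distG[OF that])
      then show ?thesis by simp
    qed
  qed (rule sum_law)
qed

lemma (in prob_space) laplace_tendsto:
  fixes x y :: "nat \<Rightarrow> real"
  assumes [measurable]: "U \<in> borel_measurable M" "V \<in> borel_measurable M"
    and pos: "\<And>w. 0 \<le> U w" "\<And>w. 0 \<le> V w"
    and x: "x \<longlonglongrightarrow> x0" "\<And>r. 0 \<le> x r" and y: "y \<longlonglongrightarrow> y0" "\<And>r. 0 \<le> y r"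
  shows "(\<lambda>r. LINT w|M. exp (- (x r * U w + y r * V w))) \<longlonglongrightarrow> (LINT w|M. exp (- (x0 * U w + y0 * V w)))"
proof (rule integral_dominated_convergence[where w="\<lambda>_. 1"])
  show "AE w in M. (\<lambda>r. exp (- (x r * U w + y r * V w))) \<longlonglongrightarrow> exp (- (x0 * U w + y0 * V w))"
    by (intro always_eventually allI tendsto_intros x y)
  show "AE w in M. norm (exp (- (x r * U w + y r * V w))) \<le> 1" for r
  proof (intro always_eventually allI)
    fix w
    have "0 \<le> x r * U w + y r * V w" using pos x y by (intro add_nonneg_nonneg mult_nonneg_nonneg) auto
    then show "norm (exp (- (x r * U w + y r * V w))) \<le> 1" by simp
  qed
qed auto

section \<open>The characterisation of infinite divisibility\<close>

text \<open>The factor \<open>1 / 2\<close> is the one in the exponent of the Gaussian density.\<close>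
definition half_laplace :: "'w measure \<Rightarrow> ('w \<Rightarrow> real \<times> real) \<Rightarrow> real \<Rightarrow> real \<Rightarrow> real" where
  "half_laplace M Y x y = (LINT w|M. exp (- (x * fst (Y w) + y * snd (Y w)) / 2))"

text \<open>Up to its constant term, \<open>ln \<psi>(a (1 - s), a (1 - t))\<close> is the power series in \<open>s\<close>, \<open>t\<close> with coefficients
\<open>T k m / (2 (k + m))\<close>. The series is summed over the total degree \<open>n\<close>, with
absolute convergence of the sum of its homogeneous parts: bounds on traces of powers control these parts
directly.\<close>
definition has_log_coefficients ::
  "'w measure \<Rightarrow> ('w \<Rightarrow> real \<times> real) \<Rightarrow> real \<Rightarrow> (nat \<Rightarrow> nat \<Rightarrow> real) \<Rightarrow> bool" where
  "has_log_coefficients M Y a T \<longleftrightarrow> 0 < half_laplace M Y a a \<and>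
     (\<forall>s\<in>{0..1}. \<forall>t\<in>{0..1}.
        summable (\<lambda>n. \<bar>\<Sum>k\<le>n. s ^ k * t ^ (n - k) * (T k (n - k) / real n)\<bar>) \<and>
        half_laplace M Y (a * (1 - s)) (a * (1 - t)) = half_laplace M Y a a *
          exp ((\<Sum>n. \<Sum>k\<le>n. s ^ k * t ^ (n - k) * (T k (n - k) / real n)) / 2))"

lemma half_laplace_double:
  "half_laplace M Y (2 * x) (2 * y) = (LINT w|M. exp (- (x * fst (Y w) + y * snd (Y w))))"
  by (simp add: half_laplace_def add_divide_distrib diff_divide_distrib)

lemma has_log_coefficientsD:
  assumes "has_log_coefficients M Y a T" "s \<in> {0..1}" "t \<in> {0..1}"
  shows "summable (\<lambda>n. \<bar>\<Sum>k\<le>n. s ^ k * t ^ (n - k) * (T k (n - k) / real n)\<bar>)"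
    and "half_laplace M Y (a * (1 - s)) (a * (1 - t)) = half_laplace M Y a a *
          exp ((\<Sum>n. \<Sum>k\<le>n. s ^ k * t ^ (n - k) * (T k (n - k) / real n)) / 2)"
  using assms unfolding has_log_coefficients_def by blast+

text \<open>The coefficient criterion applied to the laws of the summands, scaled by \<open>a / 2\<close>, along the rays
\<open>(s, t) = (r x, r)\<close>.\<close>
lemma infinitely_divisible_imp_nonneg:
  fixes Y :: "'w \<Rightarrow> real \<times> real"
  assumes M: "prob_space M" and id: "infinitely_divisible M Y"
    and pos: "\<And>w. 0 \<le> fst (Y w)" "\<And>w. 0 \<le> snd (Y w)"
    and a: "0 < a" and T: "has_log_coefficients M Y a T" and km: "0 < k + m"
  shows "0 \<le> T k m"
proof -
  let ?\<psi> = "half_laplace M Y"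
  have \<psi>0: "0 < ?\<psi> a a" using T by (simp add: has_log_coefficients_def)
  define l where "l n k = T k (n - k) / real n / 2" for n k
  have "\<forall>N. \<exists>P :: (real \<times> real) measure. prob_space P \<and> sets P = sets borel \<and>
    (AE z in P. 0 \<le> fst z) \<and> (AE z in P. 0 \<le> snd z) \<and>
    (\<forall>x\<ge>0. \<forall>y\<ge>0. (LINT z|P. exp (- (x * fst z + y * snd z))) ^ Suc N =
      (LINT w|M. exp (- (x * fst (Y w) + y * snd (Y w)))))"
    by (intro allI infinitely_divisible_root M id) (simp_all add: pos)
  from choice[OF this] obtain P :: "nat \<Rightarrow> (real \<times> real) measure" where
    P: "\<And>N. prob_space (P N)" "\<And>N. sets (P N) = sets borel"
      "\<And>N. AE z in P N. 0 \<le> fst z" "\<And>N. AE z in P N. 0 \<le> snd z"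
    and root: "\<And>N x y. 0 \<le> x \<Longrightarrow> 0 \<le> y \<Longrightarrow> (LINT z|P N. exp (- (x * fst z + y * snd z))) ^ Suc N =
      (LINT w|M. exp (- (x * fst (Y w) + y * snd (Y w))))"
    by blast
  have L: "(\<Sum>k\<le>n. l n k * x ^ k) * r ^ n =
      (\<Sum>k\<le>n. (r * x) ^ k * r ^ (n - k) * (T k (n - k) / real n)) / 2" for n x r
    unfolding sum_distrib_right sum_divide_distrib
    by (rule sum.cong[OF refl]) (simp add: l_def power_mult_distrib power_add[symmetric] mult_ac)
  have "0 \<le> l (k + m) k"
  proof (rule infinitely_divisible_coefficients_nonneg[where P=P and U="\<lambda>_ z. a / 2 * fst z"
        and V="\<lambda>_ z. a / 2 * snd z" and c="\<lambda>N. root (Suc N) (?\<psi> a a)"])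
    fix N
    show "prob_space (P N)" by (rule P)
    have "(\<lambda>z :: real \<times> real. a / 2 * fst z) \<in> borel_measurable borel"
      "(\<lambda>z :: real \<times> real. a / 2 * snd z) \<in> borel_measurable borel"
      by (intro borel_measurable_continuous_onI continuous_intros)+
    then show "(\<lambda>z. a / 2 * fst z) \<in> borel_measurable (P N)" "(\<lambda>z. a / 2 * snd z) \<in> borel_measurable (P N)"
      using P(2)[of N] by (simp_all cong: measurable_cong_sets)
    show "AE z in P N. 0 \<le> a / 2 * fst z" using P(3)[of N] by eventually_elim (use a in simp)
    show "AE z in P N. 0 \<le> a / 2 * snd z" using P(4)[of N] by eventually_elim (use a in simp)
    show "l 0 0 = 0" by (simp add: l_def)
    show "0 < root (Suc N) (?\<psi> a a)" using \<psi>0 by simp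
  next
    fix x :: real assume x: "x \<in> {0..1}"
    have "summable (\<lambda>n. \<bar>\<Sum>k\<le>n. x ^ k * 1 ^ (n - k) * (T k (n - k) / real n)\<bar> / 2)"
      by (rule summable_divide[OF has_log_coefficientsD(1)[OF T x]]) simp
    moreover have "\<bar>\<Sum>k\<le>n. l n k * x ^ k\<bar> = \<bar>\<Sum>k\<le>n. x ^ k * 1 ^ (n - k) * (T k (n - k) / real n)\<bar> / 2" for n
      using L[of n x 1] by simp
    ultimately show "summable (\<lambda>n. \<bar>\<Sum>k\<le>n. l n k * x ^ k\<bar>)" by (simp only:)
  next
    fix N x r assume xr: "x \<in> {0..1 :: real}" "r \<in> {0..1 :: real}"
    then have rx: "r * x \<in> {0..1}" by (auto intro: mult_le_one)
    let ?I = "LINT z|P N. exp (- ((1 - r * x) * (a / 2 * fst z) + (1 - r) * (a / 2 * snd z)))"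
    let ?L = "\<Sum>n. (\<Sum>k\<le>n. l n k * x ^ k) * r ^ n"
    have "?I ^ Suc N = ?\<psi> (a * (1 - r * x)) (a * (1 - r))"
    proof -
      have "?\<psi> (2 * ((1 - r * x) * (a / 2))) (2 * ((1 - r) * (a / 2))) = ?I ^ Suc N"
        unfolding half_laplace_double using root[of "(1 - r * x) * (a / 2)" "(1 - r) * (a / 2)" N] rx xr a
        by (simp only: mult.assoc) simp
      then show ?thesis by (simp add: mult.commute)
    qed
    also have "\<dots> = ?\<psi> a a * exp ?L"
    proof -
      let ?f = "\<lambda>n. \<Sum>k\<le>n. (r * x) ^ k * r ^ (n - k) * (T k (n - k) / real n)"
      note eq = has_log_coefficientsD(2)[OF T rx xr(2)]
      have "summable ?f" by (rule summable_rabs_cancel[OF has_log_coefficientsD(1)[OF T rx xr(2)]])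
      from suminf_divide[OF this, of 2] show ?thesis unfolding eq L by simp
    qed
    also have "\<dots> = (root (Suc N) (?\<psi> a a) * exp (?L / real (Suc N))) ^ Suc N"
      using \<psi>0 by (simp add: power_mult_distrib exp_of_nat_mult[symmetric] del: power_Suc of_nat_Suc)
    finally show "?I = root (Suc N) (?\<psi> a a) * exp (?L / real (Suc N))"
      by (rule power_eq_imp_eq_base) (use \<psi>0 in \<open>auto intro!: Bochner_Integration.integral_nonneg\<close>)
  qed simp
  then show ?thesis using km by (simp add: l_def zero_le_divide_iff)
qed

text \<open>For each \<open>r\<close> the compound Poisson law with rates \<open>T k m / (2 n (k + m))\<close> has as its generating function the
\<open>n\<close>-th root of \<open>\<psi>(a (1 - s), a (1 - t))\<close>, where \<open>a = a r\<close>; the normalisation is \<open>\<psi>(0, 0) = 1\<close>. With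
\<open>b = exp (- 2 / a)\<close> its image under \<open>(k, m) \<mapsto> (b ^ k, b ^ m)\<close> has \<open>(i, j)\<close>-th moment
\<open>\<psi>(a (1 - b ^ i), a (1 - b ^ j))\<close> to the power \<open>1 / n\<close>, and \<open>a (1 - b ^ i)\<close> tends to \<open>2 i\<close>.\<close>
lemma nonneg_imp_infinitely_divisible:
  fixes Y :: "'w \<Rightarrow> real \<times> real"
  assumes M: "prob_space M" and Y: "Y \<in> borel_measurable M"
    and pos: "\<And>w. 0 \<le> fst (Y w)" "\<And>w. 0 \<le> snd (Y w)"
    and a: "\<And>r. 0 < a r" "filterlim a at_top sequentially"
    and T: "\<And>r. has_log_coefficients M Y (a r) (T r)" and T0: "\<And>r k m. 0 \<le> T r k m"
  shows "infinitely_divisible M Y"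
proof (rule infinitely_divisibleI_moments[OF M Y pos])
  fix n :: nat assume n: "1 \<le> n"
  interpret M: prob_space M by fact
  let ?\<psi> = "half_laplace M Y"
  have fst_Y: "(\<lambda>w. fst (Y w) / 2) \<in> borel_measurable M" and snd_Y: "(\<lambda>w. snd (Y w) / 2) \<in> borel_measurable M"
    by (rule measurable_compose[OF Y], intro borel_measurable_continuous_onI continuous_intros, simp)+
  have "\<forall>r. \<exists>p :: (nat \<times> nat) pmf. \<forall>x\<in>{0..1}. \<forall>y\<in>{0..1}.
     measure_pmf.expectation p (\<lambda>z. x ^ fst z * y ^ snd z) = root n (?\<psi> (a r * (1 - x)) (a r * (1 - y)))"
  proof
    fix r
    define w where "w j k = T r k (j - k) / real j / (2 * real n)" for j k
    let ?f = "\<lambda>x y j. \<Sum>k\<le>j. x ^ k * y ^ (j - k) * (T r k (j - k) / real j)"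
    have sm: "summable (?f x y)" and eq: "?\<psi> (a r * (1 - x)) (a r * (1 - y)) = ?\<psi> (a r) (a r) * exp ((\<Sum>j. ?f x y j) / 2)"
      if "x \<in> {0..1}" "y \<in> {0..1}" for x y
      using summable_rabs_cancel[OF has_log_coefficientsD(1)[OF T that]] has_log_coefficientsD(2)[OF T that]
      by blast+
    have w_sum: "(\<Sum>k\<le>j. x ^ k * y ^ (j - k) * w j k) = ?f x y j / (2 * real n)" for j x y
      unfolding sum_divide_distrib by (simp add: w_def)
    have w_suminf: "(\<Sum>j. \<Sum>k\<le>j. x ^ k * y ^ (j - k) * w j k) = (\<Sum>j. ?f x y j) / (2 * real n)"
      if "x \<in> {0..1}" "y \<in> {0..1}" for x y
      unfolding w_sum by (rule suminf_divide[OF sm[OF that]])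
    have "summable (\<lambda>j. \<Sum>k\<le>j. w j k)"
      using summable_divide[OF sm[of 1 1], of "2 * real n"] w_sum[of 1 1] by simp
    moreover have "0 \<le> w j k" for j k using T0 by (simp add: w_def)
    moreover have "w 0 0 = 0" by (simp add: w_def)
    ultimately obtain p :: "(nat \<times> nat) pmf" where p: "\<And>x y. x \<in> {0..1} \<Longrightarrow> y \<in> {0..1} \<Longrightarrow>
      measure_pmf.expectation p (\<lambda>z. x ^ fst z * y ^ snd z) =
       exp ((\<Sum>j. \<Sum>k\<le>j. x ^ k * y ^ (j - k) * w j k) - (\<Sum>j. \<Sum>k\<le>j. w j k))"
      using compound_poisson_generating_function[of w] by blast
    have "measure_pmf.expectation p (\<lambda>z. x ^ fst z * y ^ snd z) = root n (?\<psi> (a r * (1 - x)) (a r * (1 - y)))"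
      if xy: "x \<in> {0..1}" "y \<in> {0..1}" for x y
    proof -
      let ?d = "(\<Sum>j. ?f x y j) - (\<Sum>j. ?f 1 1 j)"
      have "?\<psi> (a r * (1 - 1)) (a r * (1 - 1)) = 1" by (simp add: half_laplace_def M.prob_space)
      moreover have "?\<psi> (a r * (1 - 1)) (a r * (1 - 1)) = ?\<psi> (a r) (a r) * exp ((\<Sum>j. ?f 1 1 j) / 2)"
        by (rule eq) auto
      ultimately have one: "?\<psi> (a r) (a r) * exp ((\<Sum>j. ?f 1 1 j) / 2) = 1" by (simp only:)
      have "measure_pmf.expectation p (\<lambda>z. x ^ fst z * y ^ snd z) = exp (?d / (2 * real n))"
        using p[OF xy] w_suminf[OF xy] w_suminf[of 1 1] by (simp add: diff_divide_distrib)
      moreover have "exp (?d / (2 * real n)) ^ n = exp (?d / 2)"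
        using n by (simp add: exp_of_nat_mult[symmetric])
      moreover have "exp (?d / 2) = ?\<psi> (a r * (1 - x)) (a r * (1 - y))"
      proof -
        have "exp (?d / 2) = ?\<psi> (a r) (a r) * exp ((\<Sum>j. ?f 1 1 j) / 2) * exp (?d / 2)"
          by (simp only: one mult_1_left)
        also have "\<dots> = ?\<psi> (a r) (a r) * exp ((\<Sum>j. ?f x y j) / 2)"
          by (simp only: mult.assoc exp_add[symmetric]) (simp add: diff_divide_distrib)
        finally show ?thesis using eq[OF xy] by simp
      qed
      moreover have "root n (exp (?d / (2 * real n)) ^ n) = exp (?d / (2 * real n))"
        using n by (intro real_root_power_cancel) auto
      ultimately show ?thesis by simp
    qed
    then show "\<exists>p :: (nat \<times> nat) pmf. \<forall>x\<in>{0..1}. \<forall>y\<in>{0..1}.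
     measure_pmf.expectation p (\<lambda>z. x ^ fst z * y ^ snd z) = root n (?\<psi> (a r * (1 - x)) (a r * (1 - y)))"
      by blast
  qed
  from choice[OF this] obtain p :: "nat \<Rightarrow> (nat \<times> nat) pmf" where p: "\<And>r x y. x \<in> {0..1} \<Longrightarrow> y \<in> {0..1} \<Longrightarrow>
     measure_pmf.expectation (p r) (\<lambda>z. x ^ fst z * y ^ snd z) = root n (?\<psi> (a r * (1 - x)) (a r * (1 - y)))"
    by blast
  define b where "b r = exp (- 2 / a r)" for r
  have b: "b r ^ i \<in> {0..1}" for r i using a(1)[of r] by (auto simp: b_def intro!: power_le_one)
  define q where "q r = map_pmf (\<lambda>z. (b r ^ fst z, b r ^ snd z)) (p r)" for r
  have a_lim: "(\<lambda>r. a r * (1 - b r ^ i)) \<longlonglongrightarrow> 2 * real i" for i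
  proof -
    have "a r * (1 - b r ^ i) = - (a r * (exp (- (2 * real i) / a r) - 1))" for r
      by (simp add: b_def exp_of_nat_mult[symmetric] algebra_simps)
    then show ?thesis
      using tendsto_minus[OF tendsto_scaled_exp[OF a(2), of "- (2 * real i)"]] by simp
  qed
  have law: "\<exists>P :: (real \<times> real) measure. prob_space P \<and> sets P = sets borel \<and>
     (AE z in P. z \<in> {0..1} \<times> {0..1}) \<and>
     (\<forall>i j. (LINT z|P. fst z ^ i * snd z ^ j) = root n (?\<psi> (2 * real i) (2 * real j)))"
  proof (rule unit_square_compactness)
    show "set_pmf (q r) \<subseteq> {0..1} \<times> {0..1}" for r using b by (auto simp: q_def)
    fix i j
    have "measure_pmf.expectation (q r) (\<lambda>z. fst z ^ i * snd z ^ j) =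
        root n (?\<psi> (a r * (1 - b r ^ i)) (a r * (1 - b r ^ j)))" for r
    proof -
      have "measure_pmf.expectation (q r) (\<lambda>z. fst z ^ i * snd z ^ j) =
          measure_pmf.expectation (p r) (\<lambda>z. (b r ^ i) ^ fst z * (b r ^ j) ^ snd z)"
        by (simp add: q_def power_mult[symmetric] mult.commute)
      then show ?thesis using p[OF b[of r i] b[of r j], of r] by simp
    qed
    moreover have "(\<lambda>r. ?\<psi> (a r * (1 - b r ^ i)) (a r * (1 - b r ^ j))) \<longlonglongrightarrow> ?\<psi> (2 * real i) (2 * real j)"
    proof -
      have nn: "0 \<le> a r * (1 - b r ^ i)" for r i using a(1)[of r] b[of r i] by simp
      have "?\<psi> x y = (LINT w|M. exp (- (x * (fst (Y w) / 2) + y * (snd (Y w) / 2))))" for x y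
        by (simp add: half_laplace_def add_divide_distrib diff_divide_distrib)
      then show ?thesis
        using M.laplace_tendsto[OF fst_Y snd_Y _ _ a_lim[of i] nn a_lim[of j] nn] pos by simp
    qed
    ultimately show "(\<lambda>r. measure_pmf.expectation (q r) (\<lambda>z. fst z ^ i * snd z ^ j)) \<longlonglongrightarrow>
        root n (?\<psi> (2 * real i) (2 * real j))"
      by (simp add: tendsto_real_root)
  qed
  have power: "root n (?\<psi> (2 * real i) (2 * real j)) ^ n =
      (LINT w|M. exp (- (real i * fst (Y w) + real j * snd (Y w))))" for i j
  proof -
    have "0 \<le> ?\<psi> (2 * real i) (2 * real j)"
      unfolding half_laplace_def by (rule Bochner_Integration.integral_nonneg) simp
    then show ?thesis using n by (simp add: half_laplace_double)
  qed
  obtain P :: "(real \<times> real) measure" where P: "prob_space P" "sets P = sets borel"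
      "AE z in P. z \<in> {0..1} \<times> {0..1}"
    and mom: "\<And>i j. (LINT z|P. fst z ^ i * snd z ^ j) = root n (?\<psi> (2 * real i) (2 * real j))"
    using law by blast
  show "\<exists>P :: (real \<times> real) measure. prob_space P \<and> sets P = sets borel \<and>
      (AE z in P. z \<in> {0..1} \<times> {0..1}) \<and>
      (\<forall>i j. (LINT z|P. fst z ^ i * snd z ^ j) ^ n =
        (LINT w|M. exp (- (real i * fst (Y w) + real j * snd (Y w)))))"
  proof (intro exI[of _ P] conjI allI P)
    fix i j
    show "(LINT z|P. fst z ^ i * snd z ^ j) ^ n = (LINT w|M. exp (- (real i * fst (Y w) + real j * snd (Y w))))"
      unfolding mom by (rule power)
  qed
qed

text \<open>The coefficient of degree zero, a sum of traces of two identity matrices, is invisible in the logarithm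
of the Laplace transform.\<close>
lemma trace_sum_0_0: "0 \<le> trace_sum Q 0 0"
  by (simp add: trace_sum_alt_sum alt_sum_0 trace_def mat_def)

theorem theorem2p2:
  fixes M :: "'w measure"
    and X :: "'w \<Rightarrow> real ^ ('n1::finite + 'n2::finite)"
    and \<Sigma> :: "real ^ ('n1 + 'n2) ^ ('n1 + 'n2)"
  assumes "prob_space M"
    and "gaussian_vector M X"
    and "\<And>i. (LINT w|M. X w $ i) = 0"
    and "covariance_matrix M X = \<Sigma>"
    and "positive_definite \<Sigma>"
  shows "infinitely_divisible M
           (\<lambda>w. (\<Sum>i\<in>UNIV. (X w $ Inl i)\<^sup>2, \<Sum>j\<in>UNIV. (X w $ Inr j)\<^sup>2) :: real \<times> real)
         \<longleftrightarrow> (\<exists>a0>0. \<forall>a\<ge>a0. \<forall>k m. trace_sum (resolvent_Q \<Sigma> a) k m \<ge> 0)"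
proof -
  let ?Y = "\<lambda>w. (\<Sum>i\<in>UNIV. (X w $ Inl i)\<^sup>2, \<Sum>j\<in>UNIV. (X w $ Inr j)\<^sup>2) :: real \<times> real"
  interpret prob_space M by fact
  have X [measurable]: "X \<in> borel_measurable M" using assms(2) by (simp add: gaussian_vector_def)
  have X_comp [measurable]: "(\<lambda>w. X w $ i) \<in> borel_measurable M" for i
  proof -
    have "(\<lambda>w. axis i 1 \<bullet> X w) \<in> borel_measurable M" by measurable
    then show ?thesis by (simp add: inner_axis_mult)
  qed
  have Y: "?Y \<in> borel_measurable M" by (intro borel_measurable_Pair) measurable
  have pos: "0 \<le> fst (?Y w)" "0 \<le> snd (?Y w)" for w by (auto intro: sum_nonneg)
  have log_coeffs: "has_log_coefficients M ?Y a (trace_sum (resolvent_Q \<Sigma> a))" if a: "0 < a" for a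
    unfolding has_log_coefficients_def half_laplace_def fst_conv snd_conv
    using gaussian_laplace_resolvent(1,2)[OF assms(2-5) a]
      gaussian_laplace_resolvent(3)[OF assms(2-5) a, of 0 0] by auto
  show ?thesis
  proof
    assume id: "infinitely_divisible M ?Y"
    have "0 \<le> trace_sum (resolvent_Q \<Sigma> a) k m" if "1 \<le> a" for a k m
    proof (cases "k + m = 0")
      case True
      then show ?thesis by (simp add: trace_sum_0_0)
    next
      case False
      then show ?thesis
        using infinitely_divisible_imp_nonneg[OF assms(1) id pos _ log_coeffs, of a k m] that by simp
    qed
    then show "\<exists>a0>0. \<forall>a\<ge>a0. \<forall>k m. trace_sum (resolvent_Q \<Sigma> a) k m \<ge> 0"
      by (intro exI[of _ 1]) simp
  next
    assume "\<exists>a0>0. \<forall>a\<ge>a0. \<forall>k m. trace_sum (resolvent_Q \<Sigma> a) k m \<ge> 0"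
    then obtain a0 where a0: "0 < a0" "\<And>a k m. a0 \<le> a \<Longrightarrow> 0 \<le> trace_sum (resolvent_Q \<Sigma> a) k m" by blast
    define a where "a r = a0 + real r" for r
    have "0 < a r" "a0 \<le> a r" for r using a0(1) by (auto simp: a_def)
    moreover have "filterlim a at_top sequentially"
      unfolding a_def[abs_def]
      by (intro filterlim_tendsto_add_at_top[OF tendsto_const] filterlim_real_sequentially)
    ultimately show "infinitely_divisible M ?Y"
      by (intro nonneg_imp_infinitely_divisible[OF assms(1) Y pos, of a "\<lambda>r. trace_sum (resolvent_Q \<Sigma> (a r))"]
          log_coeffs a0(2))
  qed
qed

end
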